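(* Let $\mu$ be a finite complex Borel measure on $\mathbb{T}^\infty$ with Lebesgue decomposition $d\mu=f\,dm+d\mu_s$ with respect to the normalized Haar measure $m$ of $\mathbb{T}^\infty$, where $f\in L^1(\mathbb{T}^\infty)$, $\mu_s$ is singular with respect to $m$, and both $f$ and $\mu_s$ have Fourier spectrum supported on $\mathbb{N}^\infty_0\cup(-\mathbb{N}^\infty_0)$. Then for almost every $e^{it}\in\mathbb{T}^\infty$ the radial limit $\mu^*(e^{it})=\lim_{r\to1^-}\mu_r(e^{it})$ exists and $$\mu^*(e^{it})=f(e^{it}).$$
   Context: $\mathbb{T}$ is the unit circle and $\mathbb{T}^\infty=\{(z_1,z_2,\ldots):z_n\in\mathbb{T}\}$ is the compact abelian group (product topology) with normalized Haar measure $dm=d\theta=d\theta_1\times d\theta_2\times\cdots$; "almost every" refers to $m$. Points are written $e^{i\theta}=(e^{i\theta_1},e^{i\theta_2},\ldots)$. $\mathbb{Z}^\infty_0$ is the set of integer sequences $\nu$ with only finitely many non-zero entries, and $\mathbb{N}^\infty_0$ is the subset of those with all entries $\ge0$. For a finite complex Borel measure $\mu$, $\widehat\mu(\nu)=\int e^{-i\nu\cdot\theta}\,d\mu$ for $\nu\in\mathbb{Z}^\infty_0$, where $\nu\cdot\theta=\sum_j\nu_j\theta_j$; functions $f\in L^1$ are identified with $f\,dm$. "Fourier spectrum supported on $S$" means the Fourier coefficients vanish off $S$. For $0\le r<1$ define $$\mu_r(e^{i\theta})=\sum_{\nu\in\mathbb{Z}^\infty_0}\widehat\mu(\nu)\,r^{\sum_j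 j|\nu_j|}\,e^{i\nu\cdot\theta},$$ an absolutely convergent series (equivalently, $\mu_r$ is the convolution of $\mu$ with $\prod_n\frac{1-r^{2n}}{1-2r^n\cos\theta_n+r^{2n}}$). *)

theory Defs
  imports "HOL-Probability.Probability"
begin

section \<open>The infinite torus\<close>

text \<open>Coordinates are indexed by \<^typ>\<open>nat\<close> starting from 0, so the coordinate called
  $z_n$ in the usual 1-based numbering is \<open>z (n - 1)\<close>. The type \<^typ>\<open>nat \<Rightarrow> complex\<close> carries
  the product topology, and \<open>torus\<close> the induced one.\<close>

definition torus :: "(nat \<Rightarrow> complex) set" where
  "torus = {z. \<forall>n. cmod (z n) = 1}"

definition torus_borel :: "(nat \<Rightarrow> complex) measure" where
  "torus_borel = restrict_space borel torus"

definition circle_measure :: "complex measure" where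
  "circle_measure =
     distr (uniform_measure lborel {0..<2 * pi}) (restrict_space borel (sphere 0 1)) cis"

definition haar :: "(nat \<Rightarrow> complex) measure" where
  "haar = (\<Pi>\<^sub>M n\<in>UNIV. circle_measure)"

lemma space_circle_measure [simp]: "space circle_measure = sphere 0 1"
  by (simp add: circle_measure_def space_restrict_space)

lemma sets_circle_measure [measurable_cong]:
  "sets circle_measure = sets (restrict_space borel (sphere 0 1))"
  by (simp add: circle_measure_def)

lemma prob_space_circle_measure: "prob_space circle_measure"
  unfolding circle_measure_def
proof (rule prob_space.prob_space_distr)
  show "prob_space (uniform_measure lborel {0..<2 * pi})"
    by (rule prob_space_uniform_measure) auto
  have "cis \<in> borel \<rightarrow>\<^sub>M borel"
    by (intro borel_measurable_continuous_onI continuous_intros)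
  then show "cis \<in> uniform_measure lborel {0..<2 * pi} \<rightarrow>\<^sub>M restrict_space borel (sphere 0 1)"
    by (intro measurable_restrict_space2) auto
qed

lemma prob_space_haar: "prob_space haar"
  unfolding haar_def by (intro prob_space_PiM prob_space_circle_measure)

lemma space_torus_borel: "space torus_borel = torus"
  by (simp add: torus_borel_def space_restrict_space)

lemma space_haar: "space haar = torus"
  by (auto simp: haar_def space_PiM torus_def PiE_def)

text \<open>The product \<open>\<sigma>\<close>-algebra of \<open>haar\<close> is the Borel \<open>\<sigma>\<close>-algebra of the torus.\<close>

lemma sets_haar: "sets haar = sets torus_borel"
proof -
  have comp: "(\<lambda>z. z n) \<in> haar \<rightarrow>\<^sub>M borel" for n
  proof -
    have "(\<lambda>z. z n) \<in> haar \<rightarrow>\<^sub>M circle_measure"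
      unfolding haar_def by (rule measurable_component_singleton) simp
    then have "(\<lambda>z. z n) \<in> haar \<rightarrow>\<^sub>M restrict_space borel (sphere 0 1)"
      by (simp cong: measurable_cong_sets add: sets_circle_measure)
    then show ?thesis
      by (simp add: measurable_restrict_space2_iff)
  qed
  have "(\<lambda>z. z) \<in> haar \<rightarrow>\<^sub>M (\<Pi>\<^sub>M n\<in>(UNIV :: nat set). (borel :: complex measure))"
    by (rule measurable_PiM_single') (auto simp: comp)
  then have 1: "(\<lambda>z. z) \<in> haar \<rightarrow>\<^sub>M torus_borel"
    unfolding torus_borel_def
    by (intro measurable_restrict_space2)
       (auto simp: space_haar cong: measurable_cong_sets sets_PiM_equal_borel)
  have comp': "(\<lambda>z. z n) \<in> torus_borel \<rightarrow>\<^sub>M circle_measure" for n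
  proof -
    have "(\<lambda>z. z n) \<in> (borel :: (nat \<Rightarrow> complex) measure) \<rightarrow>\<^sub>M borel"
      by (intro borel_measurable_continuous_onI) (auto intro: continuous_on_product_coordinates)
    then have "(\<lambda>z. z n) \<in> torus_borel \<rightarrow>\<^sub>M restrict_space borel (sphere 0 1)"
      unfolding torus_borel_def
      by (intro measurable_restrict_space2 measurable_restrict_space1)
         (auto simp: space_restrict_space torus_def)
    then show ?thesis
      by (simp cong: measurable_cong_sets add: sets_circle_measure)
  qed
  have 2: "(\<lambda>z. z) \<in> torus_borel \<rightarrow>\<^sub>M haar"
    unfolding haar_def
    by (rule measurable_PiM_single')
       (use comp' in \<open>auto simp: space_torus_borel torus_def\<close>)
  show ?thesis
  proof (intro antisym subsetI)
    fix A assume A: "A \<in> sets haar"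
    from measurable_sets[OF 2 A] sets.sets_into_space[OF A]
    show "A \<in> sets torus_borel"
      by (simp add: space_haar space_torus_borel Int_absorb2)
  next
    fix A assume A: "A \<in> sets torus_borel"
    from measurable_sets[OF 1 A] sets.sets_into_space[OF A]
    show "A \<in> sets haar"
      by (simp add: space_haar space_torus_borel Int_absorb2)
  qed
qed


section \<open>Complex measures\<close>

text \<open>A complex measure is a countably additive set function on \<^term>\<open>sets M\<close>; only the
  \<open>\<sigma>\<close>-algebra of \<open>M\<close> matters. Finiteness is automatic, since the values are
  complex numbers.\<close>

definition complex_measure :: "'a measure \<Rightarrow> ('a set \<Rightarrow> complex) \<Rightarrow> bool" where
  "complex_measure M \<mu> \<longleftrightarrow>
     \<mu> {} = 0 \<and>
     (\<forall>A :: nat \<Rightarrow> 'a set. range A \<subseteq> sets M \<longrightarrow> disjoint_family A \<longrightarrow>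
        (\<lambda>n. \<mu> (A n)) sums \<mu> (\<Union>n. A n))"

text \<open>The positive part of a finite signed measure in its Jordan decomposition; the negative part
  is \<open>positive_part M (\<lambda>A. - \<mu> A)\<close>. Here \<^const>\<open>ennreal\<close> sends negative reals to 0,
  which is harmless because \<open>B = {}\<close> already contributes 0 to the supremum.\<close>

definition positive_part :: "'a measure \<Rightarrow> ('a set \<Rightarrow> real) \<Rightarrow> 'a measure" where
  "positive_part M \<mu> =
     measure_of (space M) (sets M) (\<lambda>A. SUP B\<in>{B \<in> sets M. B \<subseteq> A}. ennreal (\<mu> B))"

definition signed_integral :: "'a measure \<Rightarrow> ('a set \<Rightarrow> real) \<Rightarrow> ('a \<Rightarrow> complex) \<Rightarrow> complex" where
  "signed_integral M \<mu> g =
     (LINT x|positive_part M \<mu>. g x) - (LINT x|positive_part M (\<lambda>A. - \<mu> A). g x)"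

definition complex_integral ::
    "'a measure \<Rightarrow> ('a set \<Rightarrow> complex) \<Rightarrow> ('a \<Rightarrow> complex) \<Rightarrow> complex" where
  "complex_integral M \<mu> g =
     signed_integral M (\<lambda>A. Re (\<mu> A)) g + \<i> * signed_integral M (\<lambda>A. Im (\<mu> A)) g"

definition singular_to :: "'a measure \<Rightarrow> ('a set \<Rightarrow> complex) \<Rightarrow> bool" where
  "singular_to M \<mu> \<longleftrightarrow>
     (\<exists>N \<in> null_sets M. \<forall>A \<in> sets M. A \<inter> N = {} \<longrightarrow> \<mu> A = 0)"

text \<open>The complex measure \<open>f dM\<close>.\<close>

definition density_measure :: "'a measure \<Rightarrow> ('a \<Rightarrow> complex) \<Rightarrow> 'a set \<Rightarrow> complex" where
  "density_measure M f A = (LINT x:A|M. f x)"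

text \<open>Consistency check: for a finite positive measure the integral is the usual one.\<close>

lemma (in finite_measure) positive_part_measure: "positive_part M (measure M) = M"
proof -
  have "(SUP B\<in>{B \<in> sets M. B \<subseteq> A}. ennreal (measure M B)) = emeasure M A"
    if "A \<in> sets M" for A
    using that by (intro antisym SUP_least SUP_upper2[of A])
      (auto simp: emeasure_eq_measure[symmetric] intro: emeasure_mono)
  then have "positive_part M (measure M) = measure_of (space M) (sets M) (emeasure M)"
    unfolding positive_part_def by (intro measure_of_eq) (auto simp: sets.space_closed sets.sigma_sets_eq)
  then show ?thesis
    by (simp add: measure_of_of_measure)
qed

lemma integral_positive_part_nonpos:
  fixes g :: "'a \<Rightarrow> complex"
  assumes "\<And>A. \<mu> A \<le> 0"
  shows "(LINT x|positive_part M \<mu>. g x) = 0"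
proof -
  have "(\<lambda>A. SUP B\<in>{B \<in> sets M. B \<subseteq> A}. ennreal (\<mu> B)) = (\<lambda>A. 0)"
    using assms by (intro ext antisym SUP_least) (auto simp: ennreal_neg)
  then have "positive_part M \<mu> = null_measure M"
    by (simp add: positive_part_def null_measure_def)
  then show ?thesis
    by simp
qed

lemma (in finite_measure) complex_integral_measure:
  "complex_integral M (\<lambda>A. complex_of_real (measure M A)) g = (LINT x|M. g x)"
  by (simp add: complex_integral_def signed_integral_def positive_part_measure
      integral_positive_part_nonpos)


section \<open>Fourier analysis on the infinite torus\<close>

definition Z0 :: "(nat \<Rightarrow> int) set" where
  "Z0 = {\<nu>. finite {j. \<nu> j \<noteq> 0}}"

definition N0 :: "(nat \<Rightarrow> int) set" where
  "N0 = {\<nu> \<in> Z0. \<forall>j. 0 \<le> \<nu> j}"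

text \<open>The character $e^{i \nu\cdot\theta}$ at the point $z = e^{i\theta}$.\<close>

definition character :: "(nat \<Rightarrow> int) \<Rightarrow> (nat \<Rightarrow> complex) \<Rightarrow> complex" where
  "character \<nu> z = (\<Prod>j | \<nu> j \<noteq> 0. z j powi \<nu> j)"

definition fourier_coeff :: "((nat \<Rightarrow> complex) set \<Rightarrow> complex) \<Rightarrow> (nat \<Rightarrow> int) \<Rightarrow> complex" where
  "fourier_coeff \<mu> \<nu> = complex_integral torus_borel \<mu> (character (\<lambda>j. - \<nu> j))"

definition spectrum_in ::
    "((nat \<Rightarrow> complex) set \<Rightarrow> complex) \<Rightarrow> (nat \<Rightarrow> int) set \<Rightarrow> bool" where
  "spectrum_in \<mu> S \<longleftrightarrow> (\<forall>\<nu> \<in> Z0 - S. fourier_coeff \<mu> \<nu> = 0)"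

text \<open>The exponent $\sum_{j\ge 1} j|\nu_j|$, with \<open>j\<close> shifted because of the 0-based
  indexing.\<close>

definition weight :: "(nat \<Rightarrow> int) \<Rightarrow> nat" where
  "weight \<nu> = (\<Sum>j | \<nu> j \<noteq> 0. Suc j * nat \<bar>\<nu> j\<bar>)"

definition radial_mean ::
    "((nat \<Rightarrow> complex) set \<Rightarrow> complex) \<Rightarrow> real \<Rightarrow> (nat \<Rightarrow> complex) \<Rightarrow> complex" where
  "radial_mean \<mu> r z =
     (\<Sum>\<^sub>\<infinity>\<nu>\<in>Z0. fourier_coeff \<mu> \<nu> * of_real r ^ weight \<nu> * character \<nu> z)"

end

theory Submission
  imports Defs "HOL-Complex_Analysis.Complex_Analysis"
begin

text \<open>
  Why the theorem is true. Let \<open>torus_flow s\<close> multiply the coordinate \<open>z j\<close> by \<open>cis (Suc j * s)\<close>. It turns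
  the character of index \<open>\<nu>\<close> by the angle $s \sum_j (j+1) \nu_j$, and for $\nu$ in $\pm N_0$ this integer is plus
  or minus the exponent \<open>weight \<nu>\<close> of $r$ in the radial mean. Hence, for a measure with spectrum in
  $N_0 \cup -N_0$, the radial mean at \<open>torus_flow s z\<close> is $A(w) + \overline{B(w)}$ with $w = r e^{is}$ and
  holomorphic $A$, $B$ on the unit disc: along each orbit of the flow the radial means form one harmonic
  function (\<open>radial_slice\<close>).

  Existence of the limit. The kernel of the radial means is an infinite product of Poisson kernels, so
  it is nonnegative (\<open>torus_kernel_nonneg\<close>), and the $L^1$ norms of the radial means stay bounded. Haar
  measure is invariant under the flow, so Fubini's theorem and Fatou's lemma bound, for almost every
  orbit, the $L^1$ means of the harmonic function along some sequence of circles tending to the unit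
  circle. The one-variable theorem \<open>Fatou_h1\<close> then gives radial limits almost everywhere on the orbit,
  and by invariance almost everywhere on the torus (\<open>AE_radial_limit_exists\<close>).

  The one-variable theorem. A real harmonic function whose $L^1$ means are bounded along a sequence of
  circles is a difference of two nonnegative ones: split the boundary values on each circle, form
  Schwarz integrals and take a limit by Montel's theorem. If \<open>Re P\<close> is nonnegative, \<open>exp (- P)\<close> is
  bounded by 1, so it has radial limits almost everywhere; these are almost everywhere nonzero, because
  \<open>Re P\<close> has constant mean on circles and cannot tend to infinity on a set of positive measure. A
  bounded holomorphic function has square-summable coefficients; for such a power series, the
  once-integrated Fourier series is an indefinite integral, so Lebesgue's theorem differentiates it
  almost everywhere, and Abel means of a differentiated series converge wherever the derivative exists
  (\<open>Abel_sum_derivative_series\<close>).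

  Value of the limit. The radial means of $f$ tend to $f$ in $L^1$, so along a subsequence they tend to
  $f$ almost everywhere, and the remaining part $D$ of the limit comes from the singular measure. If $N$
  is a null set that carries it, choose a trigonometric polynomial $q$ that is close to 1 in $L^1$ of Haar
  measure and close to 0 in $L^1$ of the singular measure. Since the kernel is nonnegative, the integral
  of $|q|^2$ times the modulus of the radial mean is controlled by the integral of the smoothed $|q|^2$
  against the singular measure, which is small. Letting first $r$ tend to 1 and then $q$ to the
  indicator of the complement of $N$ gives $D = 0$ (\<open>singular_radial_limit_zero\<close>).
\<close>

section \<open>Averages over the circle\<close>

text \<open>The absolute convergence of the series, uniform on the space, makes the sum of the integrals of the moduli finite.\<close>

lemma sums_integral_dominated:
  fixes h :: "'a \<Rightarrow> complex" and g :: "nat \<Rightarrow> 'a \<Rightarrow> complex"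
  assumes h: "integrable M h" and g: "\<And>n. g n \<in> borel_measurable M"
    and bd: "\<And>n x. x \<in> space M \<Longrightarrow> cmod (g n x) \<le> b n" and b: "summable b"
  shows "(\<lambda>n. LINT x|M. h x * g n x) sums (LINT x|M. h x * (\<Sum>n. g n x))"
    and "integrable M (\<lambda>x. h x * (\<Sum>n. g n x))"
proof -
  have [measurable]: "h \<in> borel_measurable M" "\<And>n. g n \<in> borel_measurable M" using h g by auto
  have i: "integrable M (\<lambda>x. h x * g n x)" for n
  proof (rule Bochner_Integration.integrable_bound[OF integrable_mult_right[OF integrable_norm[OF h], of "b n"]])
    show "AE x in M. norm (h x * g n x) \<le> norm (b n * norm (h x))"
    proof (rule AE_I2)
      fix x assume "x \<in> space M"
      then have "cmod (g n x) \<le> \<bar>b n\<bar>"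
        using bd[of x n] by linarith
      then show "norm (h x * g n x) \<le> norm (b n * norm (h x))"
        using mult_right_mono[of "cmod (g n x)" "\<bar>b n\<bar>" "norm (h x)"]
        by (simp add: norm_mult abs_mult mult.commute)
    qed
  qed simp
  have s: "summable (\<lambda>n. norm (g n x))" if "x \<in> space M" for x
    by (rule summable_comparison_test[OF _ b]) (use bd that in auto)
  have ae: "AE x in M. summable (\<lambda>n. norm (h x * g n x))"
    by (rule AE_I2) (auto simp: norm_mult intro!: summable_mult s)
  have sm: "summable (\<lambda>n. LINT x|M. norm (h x * g n x))"
  proof (rule summable_comparison_test[OF _ summable_mult2[OF b, of "LINT x|M. norm (h x)"]], intro exI allI impI)
    fix n
    have "(LINT x|M. norm (h x * g n x)) \<le> (LINT x|M. b n * norm (h x))"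
    proof (rule integral_mono)
      show "norm (h x * g n x) \<le> b n * norm (h x)" if "x \<in> space M" for x
        using mult_right_mono[OF bd[OF that], of "norm (h x)" n] by (simp add: norm_mult mult.commute)
    qed (use i h in auto)
    then show "norm (LINT x|M. norm (h x * g n x)) \<le> b n * (LINT x|M. norm (h x))"
      by simp
  qed
  have eq: "(\<Sum>n. h x * g n x) = h x * (\<Sum>n. g n x)" if "x \<in> space M" for x
    using suminf_mult[OF summable_norm_cancel[OF s[OF that]]] by simp
  show "(\<lambda>n. LINT x|M. h x * g n x) sums (LINT x|M. h x * (\<Sum>n. g n x))"
    using sums_integral[OF i ae sm] by (simp add: eq cong: Bochner_Integration.integral_cong)
  show "integrable M (\<lambda>x. h x * (\<Sum>n. g n x))"
    using integrable_suminf[OF i ae sm] by (simp add: eq cong: Bochner_Integration.integrable_cong)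
qed

definition angle :: "real measure" where
  "angle = uniform_measure lborel {-pi..pi}"

lemma sets_angle [simp, measurable_cong]: "sets angle = sets borel"
  and space_angle [simp]: "space angle = UNIV"
  by (simp_all add: angle_def)

lemma prob_space_angle: "prob_space angle"
  unfolding angle_def by (rule prob_space_uniform_measure) auto

interpretation angle: prob_space angle by (rule prob_space_angle)

lemma angle_density: "angle = density lborel (\<lambda>t. ennreal (indicator {-pi..pi} t / (2 * pi)))"
  unfolding angle_def uniform_measure_def
  by (intro density_cong) (auto simp: indicator_def divide_ennreal[symmetric] ennreal_1[symmetric] simp del: ennreal_1)

lemma AE_angle: "(AE t in angle. P t) \<longleftrightarrow> (AE t in lborel. t \<in> {-pi..pi} \<longrightarrow> P t)"
  unfolding angle_density by (subst AE_density) (auto simp: indicator_def)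

lemma integral_angle:
  fixes f :: "real \<Rightarrow> complex"
  assumes "f \<in> borel_measurable borel"
  shows "(LINT t|angle. f t) = (LBINT t:{-pi..pi}. f t) / (2 * pi)"
proof -
  have "(LINT t|angle. f t) = (LBINT t. (indicator {-pi..pi} t / (2 * pi)) *\<^sub>R f t)"
    unfolding angle_density by (subst integral_density) (use assms in auto)
  also have "\<dots> = (LBINT t. (indicator {-pi..pi} t *\<^sub>R f t) / (2*pi))"
    by (intro Bochner_Integration.integral_cong) (auto simp: scaleR_conv_of_real)
  finally show ?thesis by (simp add: set_lebesgue_integral_def)
qed

lemma integrable_angle_bounded:
  fixes f :: "real \<Rightarrow> 'b::{banach, second_countable_topology}"
  assumes "f \<in> borel_measurable borel" "\<And>t. norm (f t) \<le> B"
  shows "integrable angle f"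
  by (rule angle.integrable_const_bound[of f B]) (use assms in auto)

lemma integral_angle_FTC:
  fixes F :: "real \<Rightarrow> complex"
  assumes "\<And>t. (F has_vector_derivative f t) (at t)" "continuous_on UNIV f"
  shows "(LINT t|angle. f t) = (F pi - F (-pi)) / (2 * pi)"
proof -
  have "(LBINT t. indicator {-pi..pi} t *\<^sub>R f t) = F pi - F (-pi)"
    by (rule integral_FTC_Icc) (use assms in \<open>auto intro: has_vector_derivative_at_within continuous_on_subset\<close>)
  then show ?thesis
    using assms(2) by (subst integral_angle) (auto simp: set_lebesgue_integral_def intro: borel_measurable_continuous_onI)
qed

lemma cis_has_vector_derivative [derivative_intros]:
  "((\<lambda>t. cis (a * t)) has_vector_derivative \<i> * a * cis (a * t)) (at t within S)"
proof -
  have "((\<lambda>z. exp (\<i> * a * z)) has_field_derivative \<i> * a * exp (\<i> * a * of_real t)) (at (of_real t))"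
    by (auto intro!: derivative_eq_intros)
  from has_vector_derivative_real_field[OF this, of S] show ?thesis
    by (simp add: cis_conv_exp mult.assoc)
qed

lemma integral_angle_cis: "(LINT t|angle. cis (of_int k * t)) = (if k = 0 then 1 else 0)"
proof (cases "k = 0")
  case False
  have d: "((\<lambda>t. cis (of_int k * t) / (\<i> * of_int k)) has_vector_derivative cis (of_int k * t)) (at t)" for t
    using has_vector_derivative_divide[OF cis_has_vector_derivative[of "of_int k" t UNIV], of "\<i> * of_int k"] False by simp
  have "cis (of_int k * pi) = cis (of_int k * (- pi))"
    by (auto simp: complex_eq_iff)  (metis sin_integer_2pi sin_times_pi_eq_0 mult.commute Ints_of_int minus_zero)
  then show ?thesis using False
    by (subst integral_angle_FTC[OF d]) (auto intro!: continuous_intros)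
qed (use angle.prob_space in simp)

section \<open>The Poisson kernel and its derivative\<close>

definition poisson :: "real \<Rightarrow> real \<Rightarrow> real" where
  "poisson r t = (1 - r\<^sup>2) / (1 - 2 * r * cos t + r\<^sup>2)"

definition poisson' :: "real \<Rightarrow> real \<Rightarrow> real" where
  "poisson' r t = - ((1 - r\<^sup>2) * (2 * r * sin t) / (1 - 2 * r * cos t + r\<^sup>2)\<^sup>2)"

lemma poisson_denom_pos:
  fixes r :: real
  assumes "0 \<le> r" "r < 1"
  shows "0 < 1 - 2 * r * cos t + r\<^sup>2"
proof -
  have "0 < (1 - r)\<^sup>2" using assms by simp
  moreover have "0 \<le> 2 * r * (1 - cos t)" using assms by simp
  ultimately have "0 < (1 - r)\<^sup>2 + 2 * r * (1 - cos t)" by linarith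
  then show ?thesis by (simp add: power2_eq_square algebra_simps)
qed

lemma poisson_nonneg: "0 \<le> r \<Longrightarrow> r < 1 \<Longrightarrow> 0 \<le> poisson r t"
  unfolding poisson_def using poisson_denom_pos[of r t]
  by (intro divide_nonneg_nonneg) (auto simp: power_le_one)

lemma poisson_derivative:
  assumes "0 \<le> r" "r < 1"
  shows "(poisson r has_real_derivative poisson' r t) (at t)"
  unfolding poisson_def poisson'_def
  using poisson_denom_pos[OF assms, of t]
  by (auto intro!: derivative_eq_intros simp: power2_eq_square mult_ac)

lemma continuous_poisson: "0 \<le> r \<Longrightarrow> r < 1 \<Longrightarrow> continuous_on S (poisson r)"
  by (meson DERIV_continuous continuous_at_imp_continuous_on poisson_derivative)

lemma continuous_poisson': "0 \<le> r \<Longrightarrow> r < 1 \<Longrightarrow> continuous_on S (poisson' r)"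
  unfolding poisson'_def using poisson_denom_pos[of r]
  by (intro continuous_intros) (auto simp: less_imp_neq[symmetric])

text \<open>The two geometric series are the parts of nonnegative and of nonpositive frequency; the constant term is counted in both.\<close>

lemma poisson_eq_geometric:
  assumes "0 \<le> r" "r < 1"
  shows "complex_of_real (poisson r t) = (\<Sum>n. (of_real r * cis t) ^ n) + (\<Sum>n. (of_real r * cis (-t)) ^ n) - 1"
proof -
  define a b where "a = complex_of_real r * cis t" and "b = complex_of_real r * cis (-t)"
  have "a * b = of_real r * of_real r * (cis t * cis (-t))"
    unfolding a_def b_def by (simp only: mult_ac)
  then have ab: "a * b = of_real (r\<^sup>2)" "a + b = of_real (2 * r * cos t)"
    unfolding a_def b_def by (simp_all add: cis_mult power2_eq_square complex_eq_iff)
  have n: "cmod a < 1" "cmod b < 1" unfolding a_def b_def using assms by (simp_all add: norm_mult)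
  then have nz: "1 - a \<noteq> 0" "1 - b \<noteq> 0" by auto
  have "(1 - a) * (1 - b) = 1 - (a + b) + a * b" by (simp add: algebra_simps)
  then have den: "(1 - a) * (1 - b) = of_real (1 - 2 * r * cos t + r\<^sup>2)" unfolding ab by simp
  have "1 / (1 - a) + 1 / (1 - b) - 1 = (1 - a * b) / ((1 - a) * (1 - b))"
    using nz by (simp add: divide_simps) (simp add: algebra_simps)
  also have "\<dots> = of_real (poisson r t)"
    unfolding den ab(1) poisson_def by simp
  finally show ?thesis
    using n by (simp add: suminf_geometric flip: a_def b_def)
qed

lemma integral_poisson_cis:
  assumes r: "0 \<le> r" "r < 1"
  shows "(LINT t|angle. of_real (poisson r t) * cis (of_nat m * t)) = of_real r ^ m"
proof -
  have m [measurable]: "(\<lambda>t. cis (a * t)) \<in> borel_measurable borel" for a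
    by (intro borel_measurable_continuous_onI continuous_intros)
  have ih: "integrable angle (\<lambda>t. cis (a * t))" for a
    by (rule integrable_angle_bounded[where B = 1]) auto
  have sg: "summable (\<lambda>n. r ^ n)" using r by (simp add: summable_geometric)
  have 1: "(\<lambda>n. LINT t|angle. cis (of_nat m * t) * (of_real r * cis (e * t)) ^ n) sums
           (LINT t|angle. cis (of_nat m * t) * (\<Sum>n. (of_real r * cis (e * t)) ^ n))"
       "integrable angle (\<lambda>t. cis (of_nat m * t) * (\<Sum>n. (of_real r * cis (e * t)) ^ n))" for e
    by (rule sums_integral_dominated[OF ih _ _ sg]; use r in \<open>auto simp: norm_power norm_mult\<close>)+
  have *: "(LINT t|angle. cis (of_nat m * t) * (of_real r * cis (of_int e * t)) ^ n) =
        (if int m + e * int n = 0 then of_real r ^ n else 0)" for n and e :: int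
  proof -
    have "cis (of_nat m * t) * (of_real r * cis (of_int e * t)) ^ n
         = of_real r ^ n * cis (of_int (int m + e * int n) * t)" for t
      by (simp add: power_mult_distrib Complex.DeMoivre cis_mult algebra_simps)
    then show ?thesis by (simp add: integral_angle_cis del: of_int_add of_int_mult)
  qed
  have A: "(LINT t|angle. cis (of_nat m * t) * (\<Sum>n. (of_real r * cis t) ^ n)) = (if m = 0 then 1 else 0)"
  proof -
    have "(LINT t|angle. cis (of_nat m * t) * (of_real r * cis (1 * t)) ^ n) = (if n = 0 then if m = 0 then 1 else 0 else 0)" for n
      using *[of 1 n] by auto
    then have "(\<lambda>n. if n = 0 then if m = 0 then 1 else 0 else 0) sums (LINT t|angle. cis (of_nat m * t) * (\<Sum>n. (of_real r * cis t) ^ n))"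
      using 1(1)[of 1] by simp
    then show ?thesis
      using sums_unique2 sums_single[of 0 "\<lambda>n. if m = 0 then 1::complex else 0"] by fastforce
  qed
  have B: "(LINT t|angle. cis (of_nat m * t) * (\<Sum>n. (of_real r * cis (-t)) ^ n)) = of_real r ^ m"
  proof -
    have "(LINT t|angle. cis (of_nat m * t) * (of_real r * cis (-1 * t)) ^ n) = (if n = m then of_real r ^ m else 0)" for n
      using *[of "-1" n] by auto
    then have "(\<lambda>n. if n = m then of_real r ^ m else 0) sums (LINT t|angle. cis (of_nat m * t) * (\<Sum>n. (of_real r * cis (-t)) ^ n))"
      using 1(1)[of "-1"] by simp
    then show ?thesis
      using sums_unique2 sums_single[of m "\<lambda>n. of_real r ^ m :: complex"] by fastforce
  qed
  have "(LINT t|angle. of_real (poisson r t) * cis (of_nat m * t)) =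
    (LINT t|angle. cis (of_nat m * t) * (\<Sum>n. (of_real r * cis t) ^ n)
       + cis (of_nat m * t) * (\<Sum>n. (of_real r * cis (-t)) ^ n) - cis (of_nat m * t))"
    by (simp add: poisson_eq_geometric[OF r] algebra_simps)
  also have "\<dots> = (if m = 0 then 1 else 0) + of_real r ^ m - (LINT t|angle. cis (of_nat m * t))"
    using A B 1(2)[of 1] 1(2)[of "-1"] ih by simp
  also have "(LINT t|angle. cis (of_nat m * t)) = (if m = 0 then 1 else 0)"
    using integral_angle_cis[of "int m"] by simp
  finally show ?thesis by simp
qed

lemma integrable_angle_continuous:
  fixes f :: "real \<Rightarrow> 'b::{banach, second_countable_topology}"
  assumes "continuous_on UNIV f"
  shows "integrable angle f"
proof -
  have "compact (f ` {-pi..pi})"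
    using assms by (intro compact_continuous_image continuous_on_subset[OF assms]) auto
  then obtain B where "\<And>t. t \<in> {-pi..pi} \<Longrightarrow> norm (f t) \<le> B"
    by (meson compact_imp_bounded bounded_iff imageI)
  moreover have [measurable]: "f \<in> borel_measurable borel"
    using assms by (rule borel_measurable_continuous_onI)
  ultimately show ?thesis
    by (intro angle.integrable_const_bound[of f B]) (auto simp: AE_angle)
qed

text \<open>Integration by parts in \<open>integral_poisson_cis\<close>; the boundary terms cancel because the integrand is periodic.\<close>

lemma integral_poisson'_cis:
  assumes r: "0 \<le> r" "r < 1"
  shows "(LINT t|angle. of_real (- poisson' r t) * cis (of_nat m * t)) = \<i> * of_nat m * of_real r ^ m"
proof -
  have d: "((\<lambda>t. of_real (poisson r t) * cis (of_nat m * t)) has_vector_derivative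
       (of_real (poisson r t) * (\<i> * of_nat m * cis (of_nat m * t)) + of_real (poisson' r t) * cis (of_nat m * t))) (at t)" for t
    using has_vector_derivative_mult[OF has_vector_derivative_of_real[OF poisson_derivative[OF r, of t]]
        cis_has_vector_derivative[of "of_nat m" t UNIV]]
    by simp
  have c1: "continuous_on UNIV (\<lambda>t. of_real (poisson r t) * (\<i> * of_nat m * cis (of_nat m * t)))"
    and c2: "continuous_on UNIV (\<lambda>t. of_real (poisson' r t) * cis (of_nat m * t))"
    by (intro continuous_intros continuous_poisson continuous_poisson' r)+
  have per: "cis (of_nat m * pi) = cis (of_nat m * (- pi))"
    by (simp add: complex_eq_iff)
  have "(LINT t|angle. (of_real (poisson r t) * (\<i> * of_nat m * cis (of_nat m * t)) + of_real (poisson' r t) * cis (of_nat m * t))) = 0"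
    by (subst integral_angle_FTC[OF d]) (use c1 c2 per in \<open>auto simp: poisson_def intro!: continuous_on_add\<close>)
  then have "(LINT t|angle. of_real (poisson r t) * (\<i> * of_nat m * cis (of_nat m * t))) = - (LINT t|angle. of_real (poisson' r t) * cis (of_nat m * t))"
    using integrable_angle_continuous[OF c1] integrable_angle_continuous[OF c2]
    by (simp add: add_eq_0_iff2)
  moreover have "(LINT t|angle. of_real (poisson r t) * (\<i> * of_nat m * cis (of_nat m * t))) = \<i> * of_nat m * of_real r ^ m"
    using integral_poisson_cis[OF r, of m]
    by (simp add: mult.left_commute[of "of_real _"] mult.assoc)
  ultimately show ?thesis by simp
qed

text \<open>After integration by parts, the Poisson integral of a derivative is the average of difference
  quotients against this weight.\<close>

definition slope_kernel :: "real \<Rightarrow> real \<Rightarrow> real" where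
  "slope_kernel r t = - t * poisson' r t"

lemma continuous_slope_kernel: "0 \<le> r \<Longrightarrow> r < 1 \<Longrightarrow> continuous_on S (slope_kernel r)"
  unfolding slope_kernel_def by (intro continuous_intros continuous_poisson')

lemma slope_kernel_nonneg:
  assumes r: "0 \<le> r" "r < 1" and t: "\<bar>t\<bar> \<le> pi"
  shows "0 \<le> slope_kernel r t"
proof -
  have "0 \<le> t * sin t"
  proof (cases "0 \<le> t")
    case True then show ?thesis using t by (intro mult_nonneg_nonneg sin_ge_zero) auto
  next
    case False
    then have "0 \<le> (-t) * sin (-t)" using t by (intro mult_nonneg_nonneg sin_ge_zero) auto
    then show ?thesis by simp
  qed
  moreover have "slope_kernel r t = (1 - r\<^sup>2) * (2 * r) * (t * sin t) / (1 - 2 * r * cos t + r\<^sup>2)\<^sup>2"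
    by (simp add: slope_kernel_def poisson'_def mult_ac)
  moreover have "0 \<le> 1 - r\<^sup>2" using r by (simp add: power_le_one)
  ultimately show ?thesis using r by simp
qed

text \<open>Integration by parts: the Poisson kernel has mean 1, and the boundary term \<open>poisson r pi\<close> is $(1-r)/(1+r)$.\<close>

lemma integral_slope_kernel:
  assumes r: "0 \<le> r" "r < 1"
  shows "(LINT t|angle. slope_kernel r t) = 2 * r / (1 + r)"
proof -
  have "((\<lambda>t. complex_of_real (t * poisson r t)) has_vector_derivative of_real (poisson r t + t * poisson' r t)) (at t)" for t
  proof (rule has_vector_derivative_of_real)
    show "((\<lambda>t. t * poisson r t) has_real_derivative (poisson r t + t * poisson' r t)) (at t)"
      by (auto intro!: derivative_eq_intros poisson_derivative r)
  qed
  then have "(LINT t|angle. complex_of_real (poisson r t + t * poisson' r t)) = (complex_of_real (pi * poisson r pi) - complex_of_real (- pi * poisson r (- pi))) / of_real (2 * pi)"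
    by (rule integral_angle_FTC) (intro continuous_intros continuous_poisson continuous_poisson' r)
  also have "\<dots> = of_real (poisson r pi)"
    by (simp add: poisson_def)
  finally have "(LINT t|angle. poisson r t + t * poisson' r t) = poisson r pi"
    using of_real_eq_iff by (metis integral_complex_of_real)
  moreover have "(LINT t|angle. poisson r t) = 1"
    using integral_poisson_cis[OF r, of 0] integral_complex_of_real[of angle "poisson r"] of_real_eq_1_iff by simp
  moreover have "integrable angle (poisson r)" "integrable angle (\<lambda>t. t * poisson' r t)"
    by (intro integrable_angle_continuous continuous_intros continuous_poisson continuous_poisson' r)+
  ultimately have "(LINT t|angle. t * poisson' r t) = poisson r pi - 1"
    by simp
  also have "\<dots> = - (2 * r / (1 + r))"
  proof -
    have "poisson r pi = ((1 - r) * (1 + r)) / ((1 + r) * (1 + r))"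
      by (simp add: poisson_def power2_eq_square algebra_simps)
    also have "\<dots> = (1 - r) / (1 + r)" using r by simp
    finally show ?thesis using r by (simp add: divide_simps) (simp add: algebra_simps)
  qed
  finally show ?thesis by (simp add: slope_kernel_def)
qed

text \<open>Away from the origin the denominator stays bounded below while the factor $1 - r^2$ tends to 0.\<close>

lemma slope_kernel_small:
  assumes r: "1/2 \<le> r" "r < 1" and t: "\<delta> \<le> \<bar>t\<bar>" "\<bar>t\<bar> \<le> pi" and \<delta>: "0 < \<delta>"
  shows "slope_kernel r t \<le> (1 - r\<^sup>2) * (2 * pi / (1 - cos \<delta>)\<^sup>2)"
proof -
  have cd: "cos \<delta> < 1" using \<delta> t cos_monotone_0_pi[of 0 \<delta>] by auto
  have "cos t \<le> cos \<delta>"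
    using cos_monotone_0_pi_le[of \<delta> "\<bar>t\<bar>"] \<delta> t by simp
  then have "1 - cos \<delta> \<le> 2 * r * (1 - cos t)"
    using r mult_mono[of 1 "2 * r" "1 - cos \<delta>" "1 - cos t"] cd by simp
  also have "\<dots> \<le> 1 - 2 * r * cos t + r\<^sup>2"
    using zero_le_power2[of "1 - r"] by (simp add: power2_eq_square algebra_simps)
  finally have den: "(1 - cos \<delta>)\<^sup>2 \<le> (1 - 2 * r * cos t + r\<^sup>2)\<^sup>2"
    using cd by (intro power_mono) auto
  have "t * sin t \<le> \<bar>t\<bar> * \<bar>sin t\<bar>" by (metis abs_ge_self abs_mult)
  also have "\<dots> \<le> pi * 1" using t by (intro mult_mono) auto
  finally have ts: "2 * r * (t * sin t) \<le> 2 * pi"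
    using r mult_mono[of r 1 "t * sin t" pi] order.trans[OF mult_nonneg_nonpos[of r "t * sin t"], of pi]
    by (cases "0 \<le> t * sin t") (simp_all del: mult_le_0_iff)
  have nn: "0 \<le> 1 - r\<^sup>2" using r by (simp add: power_le_one)
  have "slope_kernel r t = (1 - r\<^sup>2) * (2 * r * (t * sin t) / (1 - 2 * r * cos t + r\<^sup>2)\<^sup>2)"
    by (simp add: slope_kernel_def poisson'_def mult_ac)
  also have "2 * r * (t * sin t) / (1 - 2 * r * cos t + r\<^sup>2)\<^sup>2 \<le> 2 * pi / (1 - 2 * r * cos t + r\<^sup>2)\<^sup>2"
    using ts by (intro divide_right_mono) auto
  also have "\<dots> \<le> 2 * pi / (1 - cos \<delta>)\<^sup>2"
    using den cd by (intro divide_left_mono mult_pos_pos) auto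
  finally show ?thesis using nn by (simp add: mult_left_mono)
qed

text \<open>The kernel is nonnegative with mass at most 1, and its mass concentrates at the origin; only the
  values of \<open>\<eta>\<close> near 0, which are small, contribute in the limit.\<close>

lemma slope_kernel_approximate_identity:
  fixes \<eta> :: "real \<Rightarrow> complex"
  assumes [measurable]: "\<eta> \<in> borel_measurable borel" and B: "\<And>t. \<bar>t\<bar> \<le> pi \<Longrightarrow> cmod (\<eta> t) \<le> B"
    and lim: "(\<eta> \<longlongrightarrow> 0) (at 0)"
  shows "((\<lambda>r. LINT t|angle. of_real (slope_kernel r t) * \<eta> t) \<longlongrightarrow> 0) (at_left 1)"
proof (rule tendstoI)
  fix e :: real assume e: "0 < e"
  obtain \<delta> where \<delta>: "0 < \<delta>" "\<And>t. t \<noteq> 0 \<Longrightarrow> \<bar>t\<bar> < \<delta> \<Longrightarrow> cmod (\<eta> t) \<le> e / 2"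
  proof -
    from tendstoD[OF lim, of "e/2"] e obtain d where "0 < d" "\<And>t. t \<noteq> 0 \<Longrightarrow> dist t 0 < d \<Longrightarrow> dist (\<eta> t) 0 < e / 2"
      unfolding eventually_at by auto
    then show ?thesis by (intro that[of d]) (auto simp: less_imp_le)
  qed
  have B0: "0 \<le> B" using B[of 0] norm_ge_zero[of "\<eta> 0"] by (simp del: norm_ge_zero)
  define \<kappa> where "\<kappa> r = (1 - r\<^sup>2) * (2 * pi / (1 - cos \<delta>)\<^sup>2)" for r :: real
  have "(\<kappa> \<longlongrightarrow> (1 - 1\<^sup>2) * (2 * pi / (1 - cos \<delta>)\<^sup>2)) (at_left 1)"
    unfolding \<kappa>_def by (intro tendsto_intros)
  then have "((\<lambda>r. B * \<kappa> r) \<longlongrightarrow> 0) (at_left 1)"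
    by (intro tendsto_eq_intros) auto
  then have "\<forall>\<^sub>F r in at_left 1. B * \<kappa> r < e / 2"
    using e by (intro order_tendstoD) auto
  moreover have "\<forall>\<^sub>F r in at_left (1::real). r \<in> {1/2<..<1}"
    by (rule eventually_at_leftI[of "1/2"]) auto
  ultimately show "\<forall>\<^sub>F r in at_left 1. dist (LINT t|angle. of_real (slope_kernel r t) * \<eta> t) 0 < e"
  proof eventually_elim
    case (elim r)
    then have r: "0 \<le> r" "r < 1" "1/2 \<le> r" by auto
    have [measurable]: "slope_kernel r \<in> borel_measurable borel"
      by (intro borel_measurable_continuous_onI continuous_slope_kernel r)
    have iw: "integrable angle (slope_kernel r)"
      by (intro integrable_angle_continuous continuous_slope_kernel r)
    have \<kappa>0: "0 \<le> \<kappa> r" unfolding \<kappa>_def using r by (intro mult_nonneg_nonneg) (auto simp: power_le_one)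
    have pt: "cmod (of_real (slope_kernel r t) * \<eta> t) \<le> e / 2 * slope_kernel r t + B * \<kappa> r"
      if t: "\<bar>t\<bar> \<le> pi" for t
    proof -
      have w0: "0 \<le> slope_kernel r t" using slope_kernel_nonneg r t by blast
      consider "t = 0" | "t \<noteq> 0" "\<bar>t\<bar> < \<delta>" | "\<delta> \<le> \<bar>t\<bar>" by linarith
      then show ?thesis
      proof cases
        case 1 then show ?thesis using B0 \<kappa>0 by (simp add: slope_kernel_def)
      next
        case 2
        then have "cmod (\<eta> t) * slope_kernel r t \<le> e / 2 * slope_kernel r t"
          using \<delta> w0 by (intro mult_right_mono) auto
        then show ?thesis using w0 B0 \<kappa>0 by (simp add: norm_mult mult.commute add_increasing2)
      next
        case 3
        then have "cmod (\<eta> t) * slope_kernel r t \<le> B * \<kappa> r"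
          using slope_kernel_small[of r \<delta> t] r t \<delta>(1) B[OF t] B0 w0 unfolding \<kappa>_def by (intro mult_mono) auto
        then show ?thesis using w0 e by (simp add: norm_mult mult.commute add_increasing)
      qed
    qed
    have "cmod (LINT t|angle. of_real (slope_kernel r t) * \<eta> t) \<le> (LINT t|angle. e / 2 * slope_kernel r t + B * \<kappa> r)"
    proof -
      have i2: "integrable angle (\<lambda>t. e / 2 * slope_kernel r t + B * \<kappa> r)" using iw by simp
      have ae: "AE t in angle. cmod (of_real (slope_kernel r t) * \<eta> t) \<le> e / 2 * slope_kernel r t + B * \<kappa> r"
        using pt by (auto simp: AE_angle)
      have i1: "integrable angle (\<lambda>t. of_real (slope_kernel r t) * \<eta> t)"
        by (rule Bochner_Integration.integrable_bound[OF i2]) (use ae in \<open>auto intro: order.trans[OF _ abs_ge_self] simp del: abs_le_iff elim!: eventually_mono\<close>)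
      show ?thesis
        using integral_norm_bound integral_mono_AE[OF integrable_norm[OF i1] i2 ae] by (rule order.trans)
    qed
    also have "\<dots> = e / 2 * (2 * r / (1 + r)) + B * \<kappa> r"
      using iw angle.prob_space r by (simp add: integral_slope_kernel divide_simps) (simp add: algebra_simps)
    also have "\<dots> \<le> e / 2 * 1 + B * \<kappa> r"
      using r e by (intro add_right_mono mult_left_mono) (auto simp: divide_simps)
    also have "\<dots> < e" using elim by simp
    finally show ?case by simp
  qed
qed

section \<open>Radial limits of square-summable power series\<close>

text \<open>Fatou's theorem in its differential form. The Abel mean of the formally differentiated series is
  the Poisson integral of the derivative of the sum \<open>\<Gamma>\<close>; integrated by parts, it averages the
  difference quotients of \<open>\<Gamma>\<close> at \<open>s\<close> against \<open>slope_kernel\<close>, an approximate identity.\<close>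

lemma Abel_sum_derivative_series:
  fixes d :: "nat \<Rightarrow> complex"
  assumes d: "summable (\<lambda>n. cmod (d n))"
    and deriv: "((\<lambda>\<theta>. \<Sum>n. d n * cis (real n * \<theta>)) has_vector_derivative L) (at s)"
  shows "((\<lambda>r. \<Sum>n. \<i> * of_nat n * d n * of_real r ^ n * cis (real n * s)) \<longlongrightarrow> L) (at_left 1)"
proof -
  define \<Gamma> where "\<Gamma> \<theta> = (\<Sum>n. d n * cis (real n * \<theta>))" for \<theta>
  \<comment> \<open>the difference quotient, continuously extended by the derivative at 0\<close>
  define q where "q t = (if t = 0 then L else (\<Gamma> (s + t) - \<Gamma> s) / of_real t)" for t
  have n: "cmod (d n * cis (real n * \<theta>)) = cmod (d n)" for n \<theta>
    by (simp add: norm_mult)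
  have cont: "continuous_on UNIV \<Gamma>"
  proof (rule uniform_limit_theorem)
    show "uniform_limit UNIV (\<lambda>m \<theta>. \<Sum>i<m. d i * cis (real i * \<theta>)) \<Gamma> sequentially"
      unfolding \<Gamma>_def by (rule Weierstrass_m_test[OF _ d]) (simp add: n)
  qed (auto intro!: always_eventually continuous_intros)
  have cs: "continuous_on UNIV (\<lambda>t. \<Gamma> (s + t))"
    by (rule continuous_on_compose2[OF cont]) (auto intro!: continuous_intros)
  have [measurable]: "(\<lambda>t. \<Gamma> (s + t)) \<in> borel_measurable borel"
    using cs by (rule borel_measurable_continuous_onI)
  have qm [measurable]: "q \<in> borel_measurable borel" unfolding q_def by measurable
  have lim: "(q \<longlongrightarrow> L) (at 0)"
  proof -
    have "((\<lambda>y. (\<Gamma> y - \<Gamma> s - (y - s) *\<^sub>R L) /\<^sub>R norm (y - s)) \<longlongrightarrow> 0) (at s)"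
      using deriv unfolding has_vector_derivative_def has_derivative_at_within \<Gamma>_def by simp
    then have "((\<lambda>t. (\<Gamma> (s + t) - \<Gamma> s - t *\<^sub>R L) /\<^sub>R \<bar>t\<bar>) \<longlongrightarrow> 0) (at 0)"
      by (subst (asm) at_to_0) (simp add: filterlim_filtermap add.commute)
    then have "((\<lambda>t. norm ((\<Gamma> (s + t) - \<Gamma> s - t *\<^sub>R L) /\<^sub>R \<bar>t\<bar>)) \<longlongrightarrow> 0) (at 0)"
      by (rule tendsto_norm_zero)
    moreover have "\<forall>\<^sub>F t in at 0. norm ((\<Gamma> (s + t) - \<Gamma> s - t *\<^sub>R L) /\<^sub>R \<bar>t\<bar>) = norm (q t - L)"
      using eventually_neq_at_within[of 0 0 UNIV]
    proof eventually_elim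
      case (elim t)
      have "q t - L = (\<Gamma> (s + t) - \<Gamma> s - t *\<^sub>R L) / of_real t"
        using elim by (simp add: q_def scaleR_conv_of_real divide_simps)
      then show ?case by (simp add: norm_divide norm_mult norm_inverse divide_inverse mult.commute)
    qed
    ultimately have "((\<lambda>t. norm (q t - L)) \<longlongrightarrow> 0) (at 0)"
      by (rule Lim_transform_eventually)
    then show ?thesis by (simp add: tendsto_norm_zero_iff LIM_zero_iff)
  qed
  have bdd: "\<exists>B. \<forall>t. \<bar>t\<bar> \<le> pi \<longrightarrow> cmod (q t - L) \<le> B"
  proof -
    have "continuous_on UNIV q"
    proof (rule continuous_at_imp_continuous_on, rule ballI)
      fix t :: real
      show "isCont q t"
      proof (cases "t = 0")
        case True then show ?thesis using lim by (simp add: isCont_def q_def)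
      next
        case False
        have "\<forall>\<^sub>F u in nhds t. (\<Gamma> (s + u) - \<Gamma> s) / of_real u = q u"
          by (rule eventually_mono[OF t1_space_nhds[OF False]]) (simp add: q_def)
        moreover have "isCont (\<lambda>u. (\<Gamma> (s + u) - \<Gamma> s) / of_real u) t"
          using False cs by (intro continuous_intros) (auto simp: continuous_on_eq_continuous_at)
        ultimately show ?thesis by (rule isCont_cong[THEN iffD1])
      qed
    qed
    then have "continuous_on {-pi..pi} (\<lambda>t. q t - L)"
      by (intro continuous_intros) (auto intro: continuous_on_subset)
    then have "compact ((\<lambda>t. q t - L) ` {-pi..pi})"
      by (intro compact_continuous_image) auto
    then obtain B where B: "\<forall>x \<in> (\<lambda>t. q t - L) ` {-pi..pi}. norm x \<le> B"
      by (meson compact_imp_bounded bounded_iff)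
    have "cmod (q t - L) \<le> B" if "\<bar>t\<bar> \<le> pi" for t
      using B that by (auto simp: abs_le_iff)
    then show ?thesis by blast
  qed
  then obtain B where B: "\<And>t. \<bar>t\<bar> \<le> pi \<Longrightarrow> cmod (q t - L) \<le> B" by blast
  have l0: "((\<lambda>r. LINT t|angle. of_real (slope_kernel r t) * (q t - L)) \<longlongrightarrow> 0) (at_left 1)"
    by (rule slope_kernel_approximate_identity[OF _ B]) (use lim in \<open>auto simp: LIM_zero_iff\<close>)
  have l1: "((\<lambda>r. of_real (2 * r / (1 + r)) * L) \<longlongrightarrow> L) (at_left (1::real))"
    by (auto intro!: tendsto_eq_intros)
  have ev: "\<forall>\<^sub>F r in at_left 1. (LINT t|angle. of_real (slope_kernel r t) * (q t - L)) + of_real (2 * r / (1 + r)) * L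
       = (\<Sum>n. \<i> * of_nat n * d n * of_real r ^ n * cis (real n * s))"
  proof -
    have "\<forall>\<^sub>F r in at_left (1::real). r \<in> {0<..<1}"
      by (rule eventually_at_leftI[of 0]) auto
    then show ?thesis
    proof eventually_elim
      case (elim r)
      then have r: "0 \<le> r" "r < 1" by auto
      have [measurable]: "poisson' r \<in> borel_measurable borel"
        by (intro borel_measurable_continuous_onI continuous_poisson' r)
      have iw: "integrable angle (slope_kernel r)"
        by (intro integrable_angle_continuous continuous_slope_kernel r)
      have ip: "integrable angle (\<lambda>t. complex_of_real (- poisson' r t))"
        by (intro integrable_angle_continuous continuous_intros continuous_poisson' r)
      have ipG: "integrable angle (\<lambda>t. of_real (- poisson' r t) * \<Gamma> (s + t))"
        by (intro integrable_angle_continuous continuous_intros continuous_poisson' r cs)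
      have cm [measurable]: "(\<lambda>t. c * cis (a * (s + t))) \<in> borel_measurable borel" for a c
        by (intro borel_measurable_continuous_onI continuous_intros)
      have "(\<lambda>n. LINT t|angle. of_real (- poisson' r t) * (d n * cis (real n * (s + t)))) sums
          (LINT t|angle. of_real (- poisson' r t) * (\<Sum>n. d n * cis (real n * (s + t))))"
        by (rule sums_integral_dominated(1)[OF ip _ _ d]) (auto simp: norm_mult)
      moreover have "(LINT t|angle. of_real (- poisson' r t) * (d n * cis (real n * (s + t))))
          = \<i> * of_nat n * d n * of_real r ^ n * cis (real n * s)" for n
      proof -
        have "(LINT t|angle. of_real (- poisson' r t) * (d n * cis (real n * (s + t)))) =
            (LINT t|angle. (d n * cis (real n * s)) * (of_real (- poisson' r t) * cis (real n * t)))"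
          by (intro Bochner_Integration.integral_cong) (simp_all add: distrib_left cis_mult[symmetric] mult_ac)
        also have "\<dots> = (d n * cis (real n * s)) * (\<i> * of_nat n * of_real r ^ n)"
          by (simp only: integral_mult_right_zero integral_poisson'_cis[OF r])
        finally show ?thesis by (simp add: mult_ac)
      qed
      ultimately have A: "(LINT t|angle. of_real (- poisson' r t) * \<Gamma> (s + t)) =
          (\<Sum>n. \<i> * of_nat n * d n * of_real r ^ n * cis (real n * s))"
        by (simp add: \<Gamma>_def sums_iff)
      have z: "(LINT t|angle. complex_of_real (- poisson' r t)) = 0"
        using integral_poisson'_cis[OF r, of 0] by simp
      have "of_real (slope_kernel r t) * q t = of_real (- poisson' r t) * \<Gamma> (s + t) - of_real (- poisson' r t) * \<Gamma> s" for t
        by (cases "t = 0") (simp_all add: slope_kernel_def q_def algebra_simps diff_divide_distrib poisson'_def)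
      then have eq: "of_real (slope_kernel r t) * (q t - L) = of_real (- poisson' r t) * \<Gamma> (s + t) - of_real (- poisson' r t) * \<Gamma> s
           - of_real (slope_kernel r t) * L" for t
        by (simp add: right_diff_distrib)
      have "(LINT t|angle. of_real (slope_kernel r t) * (q t - L)) =
          (LINT t|angle. of_real (- poisson' r t) * \<Gamma> (s + t)) - (LINT t|angle. of_real (- poisson' r t)) * \<Gamma> s
           - of_real (LINT t|angle. slope_kernel r t) * L"
        unfolding eq using ip ipG iw by (simp add: integral_complex_of_real del: of_real_minus)
      then show ?case unfolding A z integral_slope_kernel[OF r] by simp
    qed
  qed
  show ?thesis
    using Lim_transform_eventually[OF tendsto_add[OF l0 l1] ev] by simp
qed

text \<open>Lebesgue's differentiation theorem for one-sided averages, applied to \<open>f\<close> and to its reflection,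
  handles increments to the right and to the left.\<close>

lemma AE_has_vector_derivative_indefinite_integral:
  fixes F f :: "real \<Rightarrow> complex"
  assumes f: "integrable lborel f"
    and F: "\<And>a b. \<alpha> \<le> a \<Longrightarrow> a \<le> b \<Longrightarrow> b \<le> \<beta> \<Longrightarrow> F b - F a = integral {a..b} f"
  shows "AE s in lborel. s \<in> {\<alpha><..<\<beta>} \<longrightarrow> (F has_vector_derivative f s) (at s)"
proof -
  have f_on: "f integrable_on S" if "S \<in> sets lborel" for S
    using integrable_mult_indicator[OF that f] 
    by (metis (no_types) integrable_on_lborel integrable_on_indicator that set_borel_integral_eq_integral(1) set_integrable_def)
  have "f integrable_on cbox a b" for a b by (rule f_on) simp
  then obtain N1 where N1: "negligible N1"
      "\<And>x e. x \<notin> N1 \<Longrightarrow> 0 < e \<Longrightarrow> \<exists>d>0. \<forall>h. 0 < h \<and> h < d \<longrightarrow>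
          norm (integral (cbox x (x + h *\<^sub>R One)) f /\<^sub>R h ^ DIM(real) - f x) < e"
    by (rule integrable_ccontinuous_explicit) (rule that)
  \<comment> \<open>the reflected function, for the averages to the left\<close>
  have "(\<lambda>x. f (- x)) integrable_on cbox a b" for a b
    using f_on[of "cbox (-b) (-a)"] Henstock_Kurzweil_Integration.integrable_reflect_real[where f=f and a="-b" and b="-a"] by simp
  then obtain N2 where N2: "negligible N2"
      "\<And>x e. x \<notin> N2 \<Longrightarrow> 0 < e \<Longrightarrow> \<exists>d>0. \<forall>h. 0 < h \<and> h < d \<longrightarrow>
          norm (integral (cbox x (x + h *\<^sub>R One)) (\<lambda>x. f (- x)) /\<^sub>R h ^ DIM(real) - f (- x)) < e"
    by (rule integrable_ccontinuous_explicit) (rule that)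
  have "negligible (uminus ` N2)"
    by (rule negligible_differentiable_image_negligible[OF _ N2(1)]) (auto intro!: derivative_intros)
  with N1(1) have "negligible (N1 \<union> uminus ` N2)" by (rule negligible_Un)
  then have "N1 \<union> uminus ` N2 \<in> null_sets lebesgue"
    by (simp add: negligible_iff_null_sets)
  then have "AE s in lborel. s \<notin> N1 \<union> uminus ` N2"
    using AE_not_in AE_completion_iff by blast
  then show ?thesis
  proof (rule AE_mp, intro AE_I2 impI)
    fix s assume s: "s \<notin> N1 \<union> uminus ` N2" and sab: "s \<in> {\<alpha><..<\<beta>}"
    then have s1: "s \<notin> N1" and s2: "- s \<notin> N2" by (auto simp: image_iff)
    show "(F has_vector_derivative f s) (at s)"
      unfolding has_vector_derivative_def has_derivative_at_alt
    proof (intro conjI allI impI bounded_linear_scaleR_left)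
      fix e :: real assume e: "0 < e"
      from N1(2)[OF s1 e] obtain d1 where d1: "0 < d1"
          "\<And>h. 0 < h \<Longrightarrow> h < d1 \<Longrightarrow> norm (integral {s..s + h} f /\<^sub>R h - f s) < e" by auto
      from N2(2)[OF s2 e] obtain d2 where d2: "0 < d2"
          "\<And>h. 0 < h \<Longrightarrow> h < d2 \<Longrightarrow> norm (integral {-s..-s + h} (\<lambda>x. f (-x)) /\<^sub>R h - f s) < e" by auto
      define d where "d = Min {d1, d2, s - \<alpha>, \<beta> - s}"
      have d0: "0 < d" using d1 d2 sab by (simp add: d_def)
      have key: "norm (I - h *\<^sub>R c) \<le> e * h" if "norm (I /\<^sub>R h - c) < e" "0 < h" for I c :: complex and h
      proof -
        have "I - h *\<^sub>R c = h *\<^sub>R (I /\<^sub>R h - c)" using that by (simp add: scaleR_right_diff_distrib)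
        then have "norm (I - h *\<^sub>R c) = h * norm (I /\<^sub>R h - c)" using that(2) by (metis abs_of_pos norm_scaleR)
        then show ?thesis using that by (simp add: mult.commute)
      qed
      show "\<exists>d>0. \<forall>y. norm (y - s) < d \<longrightarrow> norm (F y - F s - (y - s) *\<^sub>R f s) \<le> e * norm (y - s)"
      proof (intro exI[of _ d] conjI allI impI d0)
        fix y assume y: "norm (y - s) < d"
        then have yd: "\<bar>y - s\<bar> < d1" "\<bar>y - s\<bar> < d2" "\<bar>y - s\<bar> < s - \<alpha>" "\<bar>y - s\<bar> < \<beta> - s"
          by (simp_all add: d_def)
        consider "y = s" | "s < y" | "y < s" by linarith
        then show "norm (F y - F s - (y - s) *\<^sub>R f s) \<le> e * norm (y - s)"
        proof cases
          case 2
          have "F y - F s = integral {s..s + (y - s)} f"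
            using F[of s y] sab yd 2 by simp
          then show ?thesis using key[OF d1(2)[of "y - s"]] 2 yd by simp
        next
          case 3
          have "F s - F y = integral {y..s} f" using F[of y s] sab yd 3 by simp
          also have "\<dots> = integral {-s..-s + (s - y)} (\<lambda>x. f (-x))"
            using integral_reflect_real[where f=f and a=y and b=s] by simp
          finally have "norm (F s - F y - (s - y) *\<^sub>R f s) \<le> e * (s - y)"
            using key[OF d2(2)[of "s - y"]] 3 yd by simp
          moreover have "F y - F s - (y - s) *\<^sub>R f s = - (F s - F y - (s - y) *\<^sub>R f s)"
            by (simp add: algebra_simps)
          ultimately show ?thesis using 3 by (simp only: norm_minus_cancel) simp
        qed simp
      qed
    qed
  qed
qed

lemma integral_angle_cnj_cis:
  "(LINT t|angle. cis (real m * t) * cnj (cis (real n * t))) = (if m = n then 1 else 0)"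
proof -
  have "cis (real m * t) * cnj (cis (real n * t)) = cis (of_int (int m - int n) * t)" for t
    by (simp add: cis_cnj cis_mult algebra_simps)
  then show ?thesis using integral_angle_cis[of "int m - int n"] by simp
qed

lemma Parseval_finite:
  fixes c :: "nat \<Rightarrow> complex"
  assumes "finite S"
  shows "(LINT t|angle. (cmod (\<Sum>n\<in>S. c n * cis (real n * t)))\<^sup>2) = (\<Sum>n\<in>S. (cmod (c n))\<^sup>2)"
proof -
  have i: "integrable angle (\<lambda>t. c m * cnj (c n) * (cis (real m * t) * cnj (cis (real n * t))))" for m n
    by (intro integrable_angle_continuous continuous_intros)
  have "complex_of_real (LINT t|angle. (cmod (\<Sum>n\<in>S. c n * cis (real n * t)))\<^sup>2) =
      (LINT t|angle. (\<Sum>m\<in>S. c m * cis (real m * t)) * cnj (\<Sum>n\<in>S. c n * cis (real n * t)))"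
    by (simp only: complex_norm_square[symmetric] integral_complex_of_real)
  also have "\<dots> = (LINT t|angle. (\<Sum>m\<in>S. \<Sum>n\<in>S. c m * cnj (c n) * (cis (real m * t) * cnj (cis (real n * t)))))"
    by (simp only: cnj_sum sum_product complex_cnj_mult) (simp only: mult_ac)
  also have "\<dots> = (\<Sum>m\<in>S. \<Sum>n\<in>S. c m * cnj (c n) * (LINT t|angle. (cis (real m * t) * cnj (cis (real n * t)))))"
    using i by (simp add: Bochner_Integration.integral_sum del: complex_cnj_mult)
  also have "\<dots> = (\<Sum>m\<in>S. \<Sum>n\<in>S. if n = m then c m * cnj (c m) else 0)"
    unfolding integral_angle_cnj_cis by (intro sum.cong) auto
  also have "\<dots> = (\<Sum>m\<in>S. of_real ((cmod (c m))\<^sup>2))"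
    using assms by (simp only: sum.delta) (simp add: complex_norm_square del: of_real_power)
  finally show ?thesis by (simp flip: of_real_sum del: of_real_power add: of_real_eq_iff)
qed

text \<open>The once-integrated series \<open>\<Gamma>\<close> converges absolutely. Blocks of partial sums of the original series
  are summable in $L^1$, so the partial sums have an $L^1$ limit \<open>g\<close> along a subsequence, and \<open>\<Gamma>\<close> is the
  indefinite integral of \<open>g\<close>. It is therefore differentiable almost everywhere, and the Abel means
  converge at each such point.\<close>

lemma Fatou_square_summable:
  fixes c :: "nat \<Rightarrow> complex"
  assumes c: "summable (\<lambda>n. (cmod (c n))\<^sup>2)"
  shows "AE s in angle. \<exists>L. ((\<lambda>r. \<Sum>n. c n * of_real r ^ n * cis (real n * s)) \<longlongrightarrow> L) (at_left 1)"
proof -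
  \<comment> \<open>coefficients of the antiderivative; division by 0 drops the constant term, which is restored at the end\<close>
  define d where "d n = c n / (\<i> * of_nat n)" for n
  define b where "b n = \<i> * of_nat n * d n" for n
  have b_eq: "b n = (if n = 0 then 0 else c n)" for n by (simp add: b_def d_def)
  have d: "summable (\<lambda>n. cmod (d n))"
  proof (rule summable_comparison_test[OF _ summable_add[OF c inverse_power_summable[of 2, where 'a=real]]], intro exI allI impI)
    fix n :: nat
    have "cmod (c n) * inverse (real n) \<le> (cmod (c n))\<^sup>2 + (inverse (real n))\<^sup>2"
    proof -
      have "0 \<le> cmod (c n) * inverse (real n)" by simp
      then show ?thesis using sum_squares_bound[of "cmod (c n)" "inverse (real n)"] by linarith
    qed
    moreover have "cmod (d n) = cmod (c n) / real n"
      by (simp add: d_def norm_divide norm_mult)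
    ultimately show "norm (cmod (d n)) \<le> (cmod (c n))\<^sup>2 + inverse (real n ^ 2)"
      by (simp add: divide_inverse power_inverse)
  qed simp
  define \<Gamma> where "\<Gamma> \<theta> = (\<Sum>n. d n * cis (real n * \<theta>))" for \<theta>
  have \<Gamma>_sums: "(\<lambda>n. d n * cis (real n * \<theta>)) sums \<Gamma> \<theta>" for \<theta>
    unfolding \<Gamma>_def by (rule summable_sums, rule summable_norm_cancel) (simp add: norm_mult d)
  have b2: "summable (\<lambda>n. (cmod (b n))\<^sup>2)"
    by (rule summable_comparison_test[OF _ c]) (auto simp: b_eq)
  have "\<exists>N. \<forall>m\<ge>N. \<forall>n. (\<Sum>i\<in>{m..<n}. (cmod (b i))\<^sup>2) < (1/4)^k" for k :: nat
    using b2[unfolded summable_Cauchy, rule_format, of "(1/4)^k"] by (auto simp: abs_less_iff)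
  then obtain N0 where N0: "\<And>k m n. N0 k \<le> m \<Longrightarrow> (\<Sum>i\<in>{m..<n}. (cmod (b i))\<^sup>2) < (1/4)^k"
    by metis
  \<comment> \<open>increasing, unbounded and at least \<open>N0 k\<close>\<close>
  define N where "N k = k + (\<Sum>j\<le>k. N0 j)" for k
  have N_ge: "N0 k \<le> N k" for k
    unfolding N_def by (simp add: trans_le_add2 member_le_sum)
  have N_mono: "N k \<le> N (Suc k)" for k by (simp add: N_def)
  have N_top: "filterlim N at_top sequentially"
    by (rule filterlim_at_top_mono[OF filterlim_ident]) (simp add: N_def)
  define u where "u k t = (\<Sum>n\<in>{N k..<N (Suc k)}. b n * cis (real n * t))" for k t
  have u_cont: "continuous_on UNIV (u k)" for k unfolding u_def by (intro continuous_intros)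
  have [measurable]: "u k \<in> borel_measurable borel" for k
    using u_cont by (rule borel_measurable_continuous_onI)
  have ui: "integrable angle (u k)" for k by (rule integrable_angle_continuous[OF u_cont])
  have half: "((1/2)^k)\<^sup>2 = (1/4::real)^k" for k :: nat
  proof -
    have "((1/2)^k)\<^sup>2 = (((1/2)\<^sup>2)^k :: real)" by (simp only: power_mult[symmetric] mult.commute)
    then show ?thesis by (simp add: power2_eq_square)
  qed
  have u1: "(LINT t|angle. cmod (u k t)) \<le> (1/2)^k" for k
  proof -
    have i2: "integrable angle (\<lambda>t. (cmod (u k t))\<^sup>2)"
      by (intro integrable_angle_continuous continuous_intros u_cont)
    \<comment> \<open>arithmetic-geometric mean: the square of the $L^2$ norm of \<open>u k\<close> is at most $4^{-k}$, so its $L^1$ norm is at most $2^{-k}$\<close>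
    have "2 * (1/2)^k * cmod (u k t) \<le> (cmod (u k t))\<^sup>2 + (1/4)^k" for t
      using sum_squares_bound[of "(1/2)^k" "cmod (u k t)"] unfolding half by linarith
    then have "(LINT t|angle. 2 * (1/2)^k * cmod (u k t)) \<le> (LINT t|angle. (cmod (u k t))\<^sup>2 + (1/4)^k)"
      using ui i2 by (intro integral_mono) auto
    also have "\<dots> = (LINT t|angle. (cmod (u k t))\<^sup>2) + (1/4)^k"
      using i2 angle.prob_space by simp
    also have "(LINT t|angle. (cmod (u k t))\<^sup>2) = (\<Sum>n\<in>{N k..<N (Suc k)}. (cmod (b n))\<^sup>2)"
      unfolding u_def by (rule Parseval_finite) simp
    also have "\<dots> \<le> (1/4)^k" using N0[OF N_ge] less_imp_le by blast
    finally have "2 * (1/2)^k * (LINT t|angle. cmod (u k t)) \<le> 2 * (1/2)^k * (1/2)^k"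
      unfolding integral_mult_right_zero half[symmetric] power2_eq_square by linarith
    then show ?thesis by (rule mult_left_le_imp_le) simp
  qed
  have sm: "summable (\<lambda>k. LINT t|angle. cmod (u k t))"
    by (rule summable_comparison_test[OF _ summable_geometric[of "1/2 :: real"]]) (use u1 in auto)
  have ae: "AE t in angle. summable (\<lambda>k. cmod (u k t))"
  proof -
    have "(\<integral>\<^sup>+t. (\<Sum>k. ennreal (cmod (u k t))) \<partial>angle) = (\<Sum>k. \<integral>\<^sup>+t. ennreal (cmod (u k t)) \<partial>angle)"
      by (rule nn_integral_suminf) simp
    also have "\<dots> = (\<Sum>k. ennreal (LINT t|angle. cmod (u k t)))"
      using ui by (intro suminf_cong nn_integral_eq_integral) auto
    also have "\<dots> = ennreal (\<Sum>k. LINT t|angle. cmod (u k t))"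
      by (rule suminf_ennreal2) (use sm in auto)
    finally have "(\<integral>\<^sup>+t. (\<Sum>k. ennreal (cmod (u k t))) \<partial>angle) \<noteq> \<infinity>" by simp
    then have "AE t in angle. (\<Sum>k. ennreal (cmod (u k t))) \<noteq> \<infinity>"
      by (rule nn_integral_PInf_AE[rotated]) measurable
    then show ?thesis
    proof eventually_elim
      case (elim t)
      show ?case by (rule summable_suminf_not_top[OF norm_ge_zero]) (use elim in simp)
    qed
  qed
  define p where "p t = (\<Sum>n<N 0. b n * cis (real n * t))" for t
  define g where "g t = p t + (\<Sum>k. u k t)" for t
  have p_cont: "continuous_on UNIV p" unfolding p_def by (intro continuous_intros)
  have [measurable]: "p \<in> borel_measurable borel"
    using p_cont by (rule borel_measurable_continuous_onI)
  have pi_int: "integrable angle p" by (rule integrable_angle_continuous[OF p_cont])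
  have partial: "p t + (\<Sum>k<K. u k t) = (\<Sum>n<N K. b n * cis (real n * t))" for K t
  proof (induction K)
    case (Suc K)
    have "(\<Sum>n<N (Suc K). b n * cis (real n * t)) = (\<Sum>n<N K. b n * cis (real n * t)) + u K t"
      unfolding u_def by (metis (no_types, lifting) N_mono lessThan_atLeast0 sum.atLeastLessThan_concat zero_le)
    then show ?case using Suc by (simp add: add.assoc)
  qed (simp add: p_def)
  have FTC: "(LINT t|angle. indicator {x..y} t *\<^sub>R (\<Sum>n<m. b n * cis (real n * t))) =
       (\<Sum>n<m. d n * cis (real n * y) - d n * cis (real n * x)) / (2 * pi)" if "-pi \<le> x" "x \<le> y" "y \<le> pi" for x y m
  proof -
    have "((\<lambda>t. \<Sum>n<m. d n * cis (real n * t)) has_vector_derivative (\<Sum>n<m. b n * cis (real n * t))) (at t within {x..y})" for t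
    proof (rule has_vector_derivative_sum)
      fix n
      show "((\<lambda>t. d n * cis (real n * t)) has_vector_derivative b n * cis (real n * t)) (at t within {x..y})"
        using has_vector_derivative_mult_right[OF cis_has_vector_derivative[of "real n" t "{x..y}"], of "d n"]
        by (simp add: b_def mult_ac)
    qed
    then have "(LBINT t. indicator {x..y} t *\<^sub>R (\<Sum>n<m. b n * cis (real n * t))) = (\<Sum>n<m. d n * cis (real n * y)) - (\<Sum>n<m. d n * cis (real n * x))"
      using that by (intro integral_FTC_Icc) (auto intro!: continuous_intros)
    moreover have "(LINT t|angle. indicator {x..y} t *\<^sub>R (\<Sum>n<m. b n * cis (real n * t))) = (LBINT t:{-pi..pi}. indicator {x..y} t *\<^sub>R (\<Sum>n<m. b n * cis (real n * t))) / (2 * pi)"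
      by (intro integral_angle borel_measurable_scaleR borel_measurable_indicator borel_measurable_continuous_onI continuous_intros) auto
    moreover have "(LBINT t:{-pi..pi}. indicator {x..y} t *\<^sub>R (\<Sum>n<m. b n * cis (real n * t))) = (LBINT t. indicator {x..y} t *\<^sub>R (\<Sum>n<m. b n * cis (real n * t)))"
      unfolding set_lebesgue_integral_def using that
      by (intro Bochner_Integration.integral_cong) (auto simp: indicator_def)
    ultimately show ?thesis by (simp add: sum_subtractf)
  qed
  have gi: "integrable angle g"
    unfolding g_def using integrable_suminf[OF ui ae sm] pi_int by simp
  have [measurable]: "g \<in> borel_measurable borel" using gi by (simp add: measurable_cong_sets[OF sets_angle refl] borel_measurable_integrable)
  have gint: "(LINT t|angle. indicator {x..y} t *\<^sub>R g t) = (\<Gamma> y - \<Gamma> x) / (2 * pi)" if xy: "-pi \<le> x" "x \<le> y" "y \<le> pi" for x y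
  proof -
    have iu: "integrable angle (\<lambda>t. indicator {x..y} t *\<^sub>R u k t)" for k
      by (intro integrable_mult_indicator ui) simp
    have ip: "integrable angle (\<lambda>t. indicator {x..y} t *\<^sub>R p t)"
      by (intro integrable_mult_indicator pi_int) simp
    have ae': "AE t in angle. summable (\<lambda>k. norm (indicator {x..y} t *\<^sub>R u k t))"
      using ae by (rule AE_mp) (auto intro!: AE_I2 summable_mult)
    have "summable (\<lambda>k. LINT t|angle. norm (indicator {x..y} t *\<^sub>R u k t))"
    proof (rule summable_comparison_test[OF _ sm], intro exI allI impI)
      fix k
      have "(LINT t|angle. norm (indicator {x..y} t *\<^sub>R u k t)) \<le> (LINT t|angle. cmod (u k t))"
        by (rule integral_mono[OF integrable_norm[OF iu] integrable_norm[OF ui]]) (simp add: indicator_def)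
      then show "norm (LINT t|angle. norm (indicator {x..y} t *\<^sub>R u k t)) \<le> (LINT t|angle. cmod (u k t))"
        by simp
    qed
    note S = sums_integral[OF iu ae' this] integrable_suminf[OF iu ae' this]
    have eq: "(\<Sum>k. indicator {x..y} t *\<^sub>R u k t) = indicator {x..y} t *\<^sub>R (\<Sum>k. u k t)" for t
      by (cases "t \<in> {x..y}") auto
    have "(\<lambda>K. (LINT t|angle. indicator {x..y} t *\<^sub>R p t) + (\<Sum>k<K. LINT t|angle. indicator {x..y} t *\<^sub>R u k t))
        \<longlonglongrightarrow> (LINT t|angle. indicator {x..y} t *\<^sub>R p t) + (LINT t|angle. indicator {x..y} t *\<^sub>R (\<Sum>k. u k t))"
      using S(1) unfolding sums_def eq by (intro tendsto_intros)
    moreover have "(LINT t|angle. indicator {x..y} t *\<^sub>R p t) + (LINT t|angle. indicator {x..y} t *\<^sub>R (\<Sum>k. u k t)) = (LINT t|angle. indicator {x..y} t *\<^sub>R g t)"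
      using S(2) ip unfolding eq g_def scaleR_add_right by simp
    moreover have "(LINT t|angle. indicator {x..y} t *\<^sub>R p t) + (\<Sum>k<K. LINT t|angle. indicator {x..y} t *\<^sub>R u k t)
       = (\<Sum>n<N K. d n * cis (real n * y) - d n * cis (real n * x)) / (2 * pi)" for K
    proof -
      have "(LINT t|angle. indicator {x..y} t *\<^sub>R (p t + (\<Sum>k<K. u k t)))
          = (LINT t|angle. indicator {x..y} t *\<^sub>R p t) + (\<Sum>k<K. LINT t|angle. indicator {x..y} t *\<^sub>R u k t)"
        unfolding scaleR_add_right scaleR_sum_right
        by (simp only: Bochner_Integration.integral_add[OF ip Bochner_Integration.integrable_sum[OF iu]]
            Bochner_Integration.integral_sum[OF iu])
      then show ?thesis unfolding partial FTC[OF xy] by simp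
    qed
    ultimately have "(\<lambda>K. (\<Sum>n<N K. d n * cis (real n * y) - d n * cis (real n * x)) / (2 * pi)) \<longlonglongrightarrow> (LINT t|angle. indicator {x..y} t *\<^sub>R g t)"
      by simp
    moreover have "(\<lambda>K. (\<Sum>n<N K. d n * cis (real n * y) - d n * cis (real n * x)) / (2 * pi)) \<longlonglongrightarrow> (\<Gamma> y - \<Gamma> x) / (2 * pi)"
      using filterlim_compose[OF sums_diff[OF \<Gamma>_sums[of y] \<Gamma>_sums[of x], unfolded sums_def] N_top]
      by (intro tendsto_divide tendsto_const) auto
    ultimately show ?thesis by (rule LIMSEQ_unique)
  qed
  define f where "f t = indicator {-pi..pi} t *\<^sub>R g t" for t
  have fi: "integrable lborel f"
  proof -
    have "integrable lborel (\<lambda>t. (indicator {-pi..pi} t / (2 * pi)) *\<^sub>R g t)"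
      using gi unfolding angle_density by (subst (asm) integrable_density) auto
    then have "integrable lborel (\<lambda>t. (2 * pi) *\<^sub>R ((indicator {-pi..pi} t / (2 * pi)) *\<^sub>R g t))"
      by (rule integrable_scaleR_right)
    then show ?thesis by (simp add: f_def[abs_def])
  qed
  have "AE s in lborel. s \<in> {-pi<..<pi} \<longrightarrow> (\<Gamma> has_vector_derivative f s) (at s)"
  proof (rule AE_has_vector_derivative_indefinite_integral[OF fi])
    fix x y :: real assume xy: "-pi \<le> x" "x \<le> y" "y \<le> pi"
    have [measurable]: "(\<lambda>t. indicator {x..y} t *\<^sub>R g t) \<in> borel_measurable borel" by simp
    have "set_integrable lborel {x..y} f"
      unfolding set_integrable_def by (intro integrable_mult_indicator fi) simp
    then have "integral {x..y} f = (LBINT t:{x..y}. f t)"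
      by (rule set_borel_integral_eq_integral(2)[symmetric])
    also have "\<dots> = (LBINT t:{-pi..pi}. indicator {x..y} t *\<^sub>R g t)"
      unfolding set_lebesgue_integral_def f_def by (intro Bochner_Integration.integral_cong) (auto simp: indicator_def)
    also have "\<dots> = (LINT t|angle. indicator {x..y} t *\<^sub>R g t) * (2 * pi)"
      by (subst integral_angle) auto
    also have "\<dots> = \<Gamma> y - \<Gamma> x" using gint[OF xy] by simp
    finally show "\<Gamma> y - \<Gamma> x = integral {x..y} f" by simp
  qed
  moreover have "AE s in lborel. s \<noteq> -pi" "AE s in lborel. s \<noteq> pi"
    by (rule AE_lborel_singleton)+
  ultimately show ?thesis unfolding AE_angle
  proof eventually_elim
    case (elim s)
    show ?case
    proof
      assume "s \<in> {-pi..pi}"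
      with elim have "(\<Gamma> has_vector_derivative f s) (at s)" by auto
      from Abel_sum_derivative_series[OF d this[unfolded \<Gamma>_def]]
      have "((\<lambda>r. c 0 + (\<Sum>n. b n * of_real r ^ n * cis (real n * s))) \<longlongrightarrow> c 0 + f s) (at_left 1)"
        unfolding b_def by (intro tendsto_intros)
      moreover have "\<forall>\<^sub>F r in at_left 1. c 0 + (\<Sum>n. b n * of_real r ^ n * cis (real n * s)) = (\<Sum>n. c n * of_real r ^ n * cis (real n * s))"
      proof -
        obtain C where C: "\<And>n. cmod (c n) \<le> C"
        proof -
          have "(\<lambda>n. sqrt ((cmod (c n))\<^sup>2)) \<longlonglongrightarrow> sqrt 0"
            by (intro tendsto_intros summable_LIMSEQ_zero c)
          then have "(\<lambda>n. cmod (c n)) \<longlonglongrightarrow> 0" by simp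
          then have "Bseq (\<lambda>n. cmod (c n))" by (intro convergent_imp_Bseq convergentI)
          then show ?thesis using that unfolding Bseq_def by auto
        qed
        have "\<forall>\<^sub>F r in at_left (1::real). r \<in> {0<..<1}"
          by (rule eventually_at_leftI[of 0]) auto
        then show ?thesis
        proof eventually_elim
          case (elim r)
          have "summable (\<lambda>n. cmod (c n * of_real r ^ n * cis (real n * s)))"
          proof (rule summable_comparison_test[OF _ summable_mult[OF summable_geometric[of r], of C]], intro exI allI impI)
            fix n show "norm (cmod (c n * of_real r ^ n * cis (real n * s))) \<le> C * r ^ n"
              using elim C[of n] by (simp add: norm_mult norm_power mult_right_mono)
          qed (use elim in auto)
          then have s1: "summable (\<lambda>n. c n * of_real r ^ n * cis (real n * s))"
            by (rule summable_norm_cancel)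
          have "(\<Sum>n. c n * of_real r ^ n * cis (real n * s)) = (\<Sum>n. c (Suc n) * of_real r ^ Suc n * cis (real (Suc n) * s)) + c 0"
            using suminf_split_head[OF s1] by simp
          moreover have bs: "summable (\<lambda>n. b n * of_real r ^ n * cis (real n * s))"
            using s1 unfolding summable_Suc_iff[of "\<lambda>n. b n * of_real r ^ n * cis (real n * s)", symmetric]
              summable_Suc_iff[of "\<lambda>n. c n * of_real r ^ n * cis (real n * s)", symmetric]
            by (simp only: b_eq nat.simps if_False)
          then have "(\<Sum>n. b n * of_real r ^ n * cis (real n * s)) = (\<Sum>n. c (Suc n) * of_real r ^ Suc n * cis (real (Suc n) * s))"
            using suminf_split_head[OF bs] by (simp add: b_eq)
          ultimately show ?case by simp
        qed
      qed
      ultimately have "((\<lambda>r. \<Sum>n. c n * of_real r ^ n * cis (real n * s)) \<longlongrightarrow> c 0 + f s) (at_left 1)"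
        by (rule Lim_transform_eventually)
      then show "\<exists>L. ((\<lambda>r. \<Sum>n. c n * of_real r ^ n * cis (real n * s)) \<longlongrightarrow> L) (at_left 1)" ..
    qed
  qed
qed

section \<open>Radial limits of harmonic functions with bounded means\<close>

lemma holomorphic_disc_power_series:
  assumes "H holomorphic_on ball 0 1"
  shows "\<exists>a. (\<forall>w. cmod w < 1 \<longrightarrow> (\<lambda>n. a n * w ^ n) sums H w) \<and>
    (\<forall>r. 0 \<le> r \<longrightarrow> r < 1 \<longrightarrow> summable (\<lambda>n. cmod (a n) * r ^ n))"
proof -
  define a where "a n = (deriv ^^ n) H 0 / fact n" for n
  have s: "(\<lambda>n. a n * w ^ n) sums H w" if "cmod w < 1" for w
    using holomorphic_power_series[OF assms, of w] that by (simp add: a_def)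
  have "summable (\<lambda>n. cmod (a n) * r ^ n)" if r: "0 \<le> r" "r < 1" for r :: real
  proof -
    define \<rho> where "\<rho> = (r + 1) / 2"
    have "summable (\<lambda>n. a n * of_real \<rho> ^ n)"
      using s[of "of_real \<rho>"] r by (intro sums_summable) (auto simp: \<rho>_def)
    then have "summable (\<lambda>n. norm (a n * of_real r ^ n))"
      using r by (rule_tac powser_insidea) (auto simp: \<rho>_def)
    then show ?thesis
      using r by (simp add: norm_mult norm_power)
  qed
  with s show ?thesis by blast
qed

lemma continuous_on_circle_of_holomorphic:
  assumes "H holomorphic_on ball 0 1" "0 \<le> r" "r < 1"
  shows "continuous_on S (\<lambda>t. H (of_real r * cis t))"
  by (rule continuous_on_compose2[OF holomorphic_on_imp_continuous_on[OF assms(1)]])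
     (use assms in \<open>auto intro!: continuous_intros simp: norm_mult\<close>)

text \<open>Termwise integration against \<open>cis (k * t)\<close> leaves the single term of index \<open>- k\<close>.\<close>

lemma circle_power_series_coefficient:
  assumes a: "\<And>w. cmod w < 1 \<Longrightarrow> (\<lambda>n. a n * w ^ n) sums H w"
    and sm: "summable (\<lambda>n. cmod (a n) * r ^ n)" and r: "0 \<le> r" "r < 1"
  shows "(LINT t|angle. cis (of_int k * t) * H (of_real r * cis t)) = (if k \<le> 0 then a (nat (- k)) * of_real r ^ nat (- k) else 0)"
proof -
  have eq: "H (of_real r * cis t) = (\<Sum>n. a n * of_real r ^ n * cis (real n * t))" for t
    using a[of "of_real r * cis t"] r
    by (simp add: norm_mult sums_iff power_mult_distrib Complex.DeMoivre mult_ac)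
  have [measurable]: "(\<lambda>t. c * cis (x * t)) \<in> borel_measurable borel" for x c
    by (intro borel_measurable_continuous_onI continuous_intros)
  have "(\<lambda>n. LINT t|angle. cis (of_int k * t) * (a n * of_real r ^ n * cis (real n * t))) sums
      (LINT t|angle. cis (of_int k * t) * (\<Sum>n. a n * of_real r ^ n * cis (real n * t)))"
  proof (rule sums_integral_dominated(1)[OF _ _ _ sm])
    show "integrable angle (\<lambda>t. cis (of_int k * t))"
      by (intro integrable_angle_continuous continuous_intros)
  qed (use r in \<open>auto simp: norm_mult norm_power\<close>)
  moreover have "(LINT t|angle. cis (of_int k * t) * (a n * of_real r ^ n * cis (real n * t)))
      = (if n = nat (- k) then (if k \<le> 0 then a n * of_real r ^ n else 0) else 0)" for n
  proof -
    have "(LINT t|angle. cis (of_int k * t) * (a n * of_real r ^ n * cis (real n * t))) =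
        (LINT t|angle. (a n * of_real r ^ n) * cis (of_int (k + int n) * t))"
      by (intro Bochner_Integration.integral_cong) (simp_all add: cis_mult algebra_simps)
    also have "\<dots> = (a n * of_real r ^ n) * (if k + int n = 0 then 1 else 0)"
      by (simp only: integral_mult_right_zero integral_angle_cis)
    finally show ?thesis by auto
  qed
  ultimately show ?thesis
    using sums_unique2[OF _ sums_single[of "nat (- k)" "\<lambda>n. if k \<le> 0 then a n * of_real r ^ n else 0"]]
    by (simp add: eq)
qed

lemma mean_value_disc:
  assumes H: "H holomorphic_on ball 0 1" and r: "0 \<le> r" "r < 1"
  shows "(LINT t|angle. H (of_real r * cis t)) = H 0"
proof -
  obtain a where a: "\<And>w. cmod w < 1 \<Longrightarrow> (\<lambda>n. a n * w ^ n) sums H w"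
      "\<And>r. 0 \<le> r \<Longrightarrow> r < 1 \<Longrightarrow> summable (\<lambda>n. cmod (a n) * r ^ n)"
    using holomorphic_disc_power_series[OF H] by auto
  have "H 0 = a 0" using a(1)[of 0] powser_sums_zero[of a] sums_unique2 by fastforce
  then show ?thesis
    using circle_power_series_coefficient[OF a(1) a(2)[OF r] r, of 0] by simp
qed

text \<open>Parseval's identity for long partial sums on the circles of radius \<open>r\<close> shows that the coefficients
  are square-summable.\<close>

lemma Fatou_bounded:
  assumes H: "H holomorphic_on ball 0 1" and bd: "\<And>w. cmod w < 1 \<Longrightarrow> cmod (H w) \<le> 1"
  shows "AE s in angle. \<exists>L. ((\<lambda>r. H (of_real r * cis s)) \<longlongrightarrow> L) (at_left 1)"
proof -
  obtain a where a: "\<And>w. cmod w < 1 \<Longrightarrow> (\<lambda>n. a n * w ^ n) sums H w"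
      "\<And>r. 0 \<le> r \<Longrightarrow> r < 1 \<Longrightarrow> summable (\<lambda>n. cmod (a n) * r ^ n)"
    using holomorphic_disc_power_series[OF H] by auto
  have ser: "(\<lambda>n. a n * of_real r ^ n * cis (real n * t)) sums H (of_real r * cis t)" if "0 \<le> r" "r < 1" for r t
    using a(1)[of "of_real r * cis t"] that
    by (simp add: norm_mult power_mult_distrib Complex.DeMoivre mult_ac)
  have B: "(\<Sum>n<M. (cmod (a n) * r ^ n)\<^sup>2) \<le> 4" if r: "0 \<le> r" "r < 1" for r M
  proof -
    have "(\<lambda>m. \<Sum>n. cmod (a (n + m)) * r ^ (n + m)) \<longlonglongrightarrow> 0"
      by (rule suminf_exist_split2[OF a(2)[OF r]])
    then have "\<forall>\<^sub>F m in sequentially. (\<Sum>n. cmod (a (n + m)) * r ^ (n + m)) < 1"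
      by (rule order_tendstoD) simp
    then obtain m0 where m0: "\<And>m. m \<ge> m0 \<Longrightarrow> (\<Sum>n. cmod (a (n + m)) * r ^ (n + m)) < 1"
      unfolding eventually_sequentially by blast
    \<comment> \<open>the tail beyond \<open>m\<close> is below 1, so the partial sum is bounded by 2 on the circle\<close>
    define m where "m = max m0 M"
    have m: "m \<ge> M" "(\<Sum>n. cmod (a (n + m)) * r ^ (n + m)) < 1"
      using m0[of m] by (auto simp: m_def)
    define p where "p t = (\<Sum>n<m. (a n * of_real r ^ n) * cis (real n * t))" for t
    have pc: "continuous_on UNIV p" unfolding p_def by (intro continuous_intros)
    have "cmod (p t) \<le> 2" for t
    proof -
      have s: "summable (\<lambda>n. norm (a (n + m) * of_real r ^ (n + m) * cis (real (n + m) * t)))"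
        using summable_ignore_initial_segment[OF a(2)[OF r], of m] r by (simp add: norm_mult norm_power)
      have "H (of_real r * cis t) = (\<Sum>n. a (n + m) * of_real r ^ (n + m) * cis (real (n + m) * t)) + p t"
        using suminf_split_initial_segment[OF sums_summable[OF ser[OF r]], of t m] sums_unique[OF ser[OF r]] by (simp add: p_def)
      moreover have "cmod (\<Sum>n. a (n + m) * of_real r ^ (n + m) * cis (real (n + m) * t)) \<le> (\<Sum>n. cmod (a (n + m)) * r ^ (n + m))"
        using summable_norm[OF s] r by (simp add: norm_mult norm_power)
      moreover have "cmod (H (of_real r * cis t)) \<le> 1" using bd r by (simp add: norm_mult)
      ultimately show ?thesis using m norm_triangle_ineq4[of "H (of_real r * cis t)" "\<Sum>n. a (n + m) * of_real r ^ (n + m) * cis (real (n + m) * t)"]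
        by simp
    qed
    then have "(cmod (p t))\<^sup>2 \<le> 2\<^sup>2" for t by (intro power_mono) auto
    then have "(LINT t|angle. (cmod (p t))\<^sup>2) \<le> (LINT t|angle. 2\<^sup>2)"
      by (intro integral_mono integrable_angle_continuous continuous_intros pc) auto
    also have "\<dots> = 4" using angle.prob_space by simp
    finally have "(\<Sum>n<m. (cmod (a n * of_real r ^ n))\<^sup>2) \<le> 4"
      unfolding p_def by (subst (asm) Parseval_finite) auto
    moreover have "(\<Sum>n<M. (cmod (a n) * r ^ n)\<^sup>2) \<le> (\<Sum>n<m. (cmod (a n) * r ^ n)\<^sup>2)"
      using m(1) by (intro sum_mono2) auto
    ultimately show ?thesis using r by (simp add: norm_mult norm_power)
  qed
  have "(\<Sum>n<M. (cmod (a n))\<^sup>2) \<le> 4" for M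
  proof (rule tendsto_upperbound)
    have "((\<lambda>r. \<Sum>n<M. (cmod (a n) * r ^ n)\<^sup>2) \<longlongrightarrow> (\<Sum>n<M. (cmod (a n) * 1 ^ n)\<^sup>2)) (at_left 1)"
      by (intro tendsto_intros)
    then show "((\<lambda>r. \<Sum>n<M. (cmod (a n) * r ^ n)\<^sup>2) \<longlongrightarrow> (\<Sum>n<M. (cmod (a n))\<^sup>2)) (at_left 1)" by simp
    show "\<forall>\<^sub>F r in at_left 1. (\<Sum>n<M. (cmod (a n) * r ^ n)\<^sup>2) \<le> 4"
      by (rule eventually_at_leftI[of 0]) (auto intro!: B)
  qed simp
  then have "summable (\<lambda>n. (cmod (a n))\<^sup>2)"
    by (intro summableI_nonneg_bounded[where x = 4]) auto
  from Fatou_square_summable[OF this] show ?thesis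
  proof eventually_elim
    case (elim s)
    then obtain L where "((\<lambda>r. \<Sum>n. a n * of_real r ^ n * cis (real n * s)) \<longlongrightarrow> L) (at_left 1)" by blast
    moreover have "\<forall>\<^sub>F r in at_left 1. (\<Sum>n. a n * of_real r ^ n * cis (real n * s)) = H (of_real r * cis s)"
      by (rule eventually_at_leftI[of 0]) (auto intro!: sums_unique[symmetric] ser)
    ultimately have "((\<lambda>r. H (of_real r * cis s)) \<longlongrightarrow> L) (at_left 1)" by (rule Lim_transform_eventually)
    then show ?case by blast
  qed
qed

text \<open>The function \<open>exp (- H)\<close> is bounded by 1, and \<open>Re H\<close> is minus the logarithm of its modulus. Its
  radial limit vanishes almost nowhere: \<open>Re H\<close> has the same mean on all circles, so by Fatou's lemma its
  lower limit is finite almost everywhere.\<close>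

lemma Fatou_nonneg_real_part:
  assumes H: "H holomorphic_on ball 0 1" and pos: "\<And>w. cmod w < 1 \<Longrightarrow> 0 \<le> Re (H w)"
  shows "AE s in angle. \<exists>L. ((\<lambda>r. Re (H (of_real r * cis s))) \<longlongrightarrow> L) (at_left 1)"
proof -
  define G where "G w = exp (- H w)" for w
  have G: "G holomorphic_on ball 0 1" unfolding G_def by (intro holomorphic_intros H)
  have normG: "cmod (G w) = exp (- Re (H w))" for w by (simp add: G_def)
  have lim: "AE s in angle. \<exists>L. ((\<lambda>r. G (of_real r * cis s)) \<longlongrightarrow> L) (at_left 1)"
    by (rule Fatou_bounded[OF G]) (use pos in \<open>auto simp: normG\<close>)
  define \<rho> where "\<rho> k = 1 - 1 / real (k + 2)" for k
  have \<rho>: "0 \<le> \<rho> k" "\<rho> k < 1" for k by (auto simp: \<rho>_def divide_simps)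
  have "\<rho> \<longlonglongrightarrow> 1 - 0" unfolding \<rho>_def
    by (intro tendsto_intros LIMSEQ_ignore_initial_segment[OF lim_1_over_n])
  then have \<rho>_lim: "filterlim \<rho> (at_left 1) sequentially"
    unfolding filterlim_at using \<rho> by (auto intro!: always_eventually simp: less_imp_neq)
  define u where "u k t = Re (H (of_real (\<rho> k) * cis t))" for k t
  have uc: "continuous_on UNIV (u k)" for k
    unfolding u_def by (intro continuous_intros continuous_on_circle_of_holomorphic H \<rho>)
  have [measurable]: "u k \<in> borel_measurable borel" for k
    using uc by (rule borel_measurable_continuous_onI)
  have u0: "0 \<le> u k t" for k t unfolding u_def using \<rho>[of k] by (intro pos) (simp add: norm_mult)
  have ui: "(\<integral>\<^sup>+t. ennreal (u k t) \<partial>angle) = ennreal (Re (H 0))" for k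
  proof -
    have "integrable angle (\<lambda>t. H (of_real (\<rho> k) * cis t))"
      by (intro integrable_angle_continuous continuous_on_circle_of_holomorphic H \<rho>)
    then have "(LINT t|angle. u k t) = Re (H 0)"
      unfolding u_def by (simp add: mean_value_disc[OF H \<rho>])
    moreover have "integrable angle (u k)" by (rule integrable_angle_continuous[OF uc])
    ultimately show ?thesis using u0 by (subst nn_integral_eq_integral) auto
  qed
  have "(\<integral>\<^sup>+t. liminf (\<lambda>k. ennreal (u k t)) \<partial>angle) \<le> liminf (\<lambda>k. \<integral>\<^sup>+t. ennreal (u k t) \<partial>angle)"
    by (rule nn_integral_liminf) simp
  also have "\<dots> = ennreal (Re (H 0))" unfolding ui by (simp add: Liminf_const)
  finally have "(\<integral>\<^sup>+t. liminf (\<lambda>k. ennreal (u k t)) \<partial>angle) \<noteq> \<infinity>"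
    by (auto simp: top_unique)
  then have "AE t in angle. liminf (\<lambda>k. ennreal (u k t)) \<noteq> \<infinity>"
    by (intro nn_integral_PInf_AE) auto
  with lim show ?thesis
  proof eventually_elim
    case (elim s)
    then obtain L where L: "((\<lambda>r. G (of_real r * cis s)) \<longlongrightarrow> L) (at_left 1)" by blast
    have L0: "L \<noteq> 0"
    proof
      assume "L = 0"
      have "(\<lambda>k. cmod (G (of_real (\<rho> k) * cis s))) \<longlonglongrightarrow> cmod L"
        by (intro tendsto_norm filterlim_compose[OF L \<rho>_lim])
      then have "(\<lambda>k. exp (- u k s)) \<longlonglongrightarrow> 0"
        unfolding normG u_def using \<open>L = 0\<close> by simp
      then have "filterlim (\<lambda>k. exp (- u k s)) (at_right 0) sequentially"
        unfolding filterlim_at by simp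
      then have "filterlim (\<lambda>k. ln (exp (- u k s))) at_bot sequentially"
        by (rule filterlim_compose[OF ln_at_0])
      then have "filterlim (\<lambda>k. u k s) at_top sequentially"
        unfolding filterlim_uminus_at_top by simp
      then have "(\<lambda>k. ennreal (u k s)) \<longlonglongrightarrow> \<infinity>"
        by (simp add: ennreal_tendsto_top_eq_at_top)
      then have "liminf (\<lambda>k. ennreal (u k s)) = \<infinity>" by (intro lim_imp_Liminf) auto
      then show False using elim by simp
    qed
    have "((\<lambda>r. - ln (cmod (G (of_real r * cis s)))) \<longlongrightarrow> - ln (cmod L)) (at_left 1)"
      using L0 by (intro tendsto_intros L) auto
    then show ?case by (auto simp: normG)
  qed
qed

text \<open>The holomorphic function on the disc whose real part is the Poisson integral of \<open>\<phi>\<close> and which is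
  real at the origin.\<close>

definition schwarz_integral :: "(real \<Rightarrow> real) \<Rightarrow> complex \<Rightarrow> complex" where
  "schwarz_integral \<phi> w = (LINT t|angle. of_real (\<phi> t) * ((cis t + w) / (cis t - w)))"

context
  fixes \<phi> :: "real \<Rightarrow> real" assumes \<phi>: "integrable angle \<phi>"
begin

lemma schwarz_integral_sums:
  assumes w: "cmod w < 1"
  shows "(\<lambda>n. (if n = 0 then 1 else 2) * (LINT t|angle. of_real (\<phi> t) * cis (- real n * t)) * w ^ n) sums schwarz_integral \<phi> w"
    and "integrable angle (\<lambda>t. of_real (\<phi> t) * ((cis t + w) / (cis t - w)))"
proof -
  define g where "g n t = (if n = 0 then 1 else 2) * (w * cis (- t)) ^ n" for n t
  have [measurable]: "g n \<in> borel_measurable borel" for n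
    unfolding g_def by (intro borel_measurable_continuous_onI continuous_intros)
  have g: "g n t = (if n = 0 then 1 else 2) * w ^ n * cis (- real n * t)" for n t
    by (simp add: g_def power_mult_distrib Complex.DeMoivre)
  have gs: "(\<Sum>n. g n t) = (cis t + w) / (cis t - w)" for t
  proof -
    define q where "q = w * cis (- t)"
    have q: "cmod q < 1" using w by (simp add: q_def norm_mult)
    have "(\<lambda>n. 2 * q ^ n - (if n = 0 then 1 else 0)) sums (2 * (1 / (1 - q)) - 1)"
      using sums_single[of 0 "\<lambda>_. 1::complex"]
      by (intro sums_diff sums_mult geometric_sums q) simp
    moreover have "2 * q ^ n - (if n = 0 then 1 else 0) = g n t" for n by (simp add: g_def q_def)
    moreover have "2 * (1 / (1 - q)) - 1 = (cis t + w) / (cis t - w)"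
    proof -
      have w': "w = cis t * q" by (simp add: q_def mult.left_commute cis_mult)
      have "1 - q \<noteq> 0" using q by auto
      then show ?thesis unfolding w'
        by (simp add: divide_simps) (simp add: algebra_simps)
    qed
    ultimately show ?thesis by (simp add: sums_iff)
  qed
  have \<phi>c: "integrable angle (\<lambda>t. complex_of_real (\<phi> t))" using \<phi> by simp
  have sm: "summable (\<lambda>n. 2 * cmod w ^ n)" using w by (intro summable_mult summable_geometric) simp
  have bd: "cmod (g n t) \<le> 2 * cmod w ^ n" for n t by (simp add: g norm_mult norm_power)
  note S = sums_integral_dominated[OF \<phi>c, of g, OF _ bd sm]
  have "(LINT t|angle. of_real (\<phi> t) * g n t) = (if n = 0 then 1 else 2) * (LINT t|angle. of_real (\<phi> t) * cis (- real n * t)) * w ^ n" for n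
  proof -
    have "(LINT t|angle. of_real (\<phi> t) * g n t) = (LINT t|angle. ((if n = 0 then 1 else 2) * w ^ n) * (of_real (\<phi> t) * cis (- real n * t)))"
      by (simp add: g mult_ac)
    also have "\<dots> = ((if n = 0 then 1 else 2) * w ^ n) * (LINT t|angle. of_real (\<phi> t) * cis (- real n * t))"
      by (rule integral_mult_right_zero)
    finally show ?thesis by (simp only: mult_ac)
  qed
  then show "(\<lambda>n. (if n = 0 then 1 else 2) * (LINT t|angle. of_real (\<phi> t) * cis (- real n * t)) * w ^ n) sums schwarz_integral \<phi> w"
    using S(1) unfolding gs schwarz_integral_def by simp
  show "integrable angle (\<lambda>t. of_real (\<phi> t) * ((cis t + w) / (cis t - w)))"
    using S(2) unfolding gs by simp
qed

lemma holomorphic_schwarz_integral: "schwarz_integral \<phi> holomorphic_on ball 0 1"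
  by (rule power_series_holomorphic[where a = "\<lambda>n. (if n = 0 then 1 else 2) * (LINT t|angle. of_real (\<phi> t) * cis (- real n * t))"])
     (simp only: diff_0_right mem_ball_0 schwarz_integral_sums(1))

lemma Re_schwarz_integral_nonneg:
  assumes w: "cmod w < 1" and "\<And>t. 0 \<le> \<phi> t"
  shows "0 \<le> Re (schwarz_integral \<phi> w)"
proof -
  have pos: "0 \<le> Re ((cis t + w) / (cis t - w))" for t
  proof -
    have "Re (cis t + w) * Re (cis t - w) + Im (cis t + w) * Im (cis t - w) = 1 - (cmod w)\<^sup>2"
      unfolding cmod_power2 sin_cos_squared_add3[of t, symmetric]
      by (simp add: power2_eq_square algebra_simps)
    also have "\<dots> \<ge> 0" using w by (simp add: power_le_one)
    finally show ?thesis unfolding Re_divide by (intro divide_nonneg_nonneg) auto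
  qed
  define K where "K t = (cis t + w) / (cis t - w)" for t
  have "Re (schwarz_integral \<phi> w) = (LINT t|angle. \<phi> t * Re (K t))"
    using integral_Re[OF schwarz_integral_sums(2)[OF w]]
    unfolding schwarz_integral_def K_def[symmetric] by simp
  then show ?thesis using pos assms by (simp add: K_def integral_nonneg)
qed

lemma norm_schwarz_integral_le:
  assumes w: "cmod w \<le> \<rho>" and \<rho>: "\<rho> < 1"
  shows "cmod (schwarz_integral \<phi> w) \<le> 2 / (1 - \<rho>) * (LINT t|angle. \<bar>\<phi> t\<bar>)"
proof -
  have w1: "cmod w < 1" using w \<rho> by simp
  have "cmod ((cis t + w) / (cis t - w)) \<le> 2 / (1 - \<rho>)" for t
  proof -
    have "1 - \<rho> \<le> cmod (cis t - w)" using norm_triangle_ineq2[of "cis t" w] w by simp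
    moreover have "cmod (cis t + w) \<le> 2" using norm_triangle_ineq[of "cis t" w] w1 by simp
    ultimately show ?thesis unfolding norm_divide using \<rho> by (intro frac_le) auto
  qed
  then have "cmod (of_real (\<phi> t) * ((cis t + w) / (cis t - w))) \<le> 2 / (1 - \<rho>) * \<bar>\<phi> t\<bar>" for t
    unfolding norm_mult norm_of_real by (subst mult.commute) (intro mult_right_mono; simp)
  then have "cmod (schwarz_integral \<phi> w) \<le> (LINT t|angle. 2 / (1 - \<rho>) * \<bar>\<phi> t\<bar>)"
    unfolding schwarz_integral_def
    using \<phi> by (intro order.trans[OF integral_norm_bound] integral_mono integrable_norm schwarz_integral_sums(2) w1) auto
  then show ?thesis by simp
qed

end

lemma schwarz_integral_diff:
  assumes "integrable angle \<phi>" "integrable angle \<psi>" "cmod w < 1"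
  shows "schwarz_integral (\<lambda>t. \<phi> t - \<psi> t) w = schwarz_integral \<phi> w - schwarz_integral \<psi> w"
  using schwarz_integral_sums(2)[OF assms(1,3)] schwarz_integral_sums(2)[OF assms(2,3)]
  unfolding schwarz_integral_def by (simp add: left_diff_distrib del: times_divide_eq_right)

text \<open>Both sides have the same power series: the nonnegative Fourier coefficients of \<open>Re H\<close> on a circle
  are half of the coefficients of \<open>H\<close>, except for the constant one.\<close>

lemma schwarz_integral_Re:
  assumes H: "H holomorphic_on ball 0 1" and r: "0 \<le> r" "r < 1" and w: "cmod w < 1"
  shows "schwarz_integral (\<lambda>t. Re (H (of_real r * cis t))) w = H (of_real r * w) - \<i> * Im (H 0)"
proof -
  obtain a where a: "\<And>w. cmod w < 1 \<Longrightarrow> (\<lambda>n. a n * w ^ n) sums H w"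
      "\<And>r. 0 \<le> r \<Longrightarrow> r < 1 \<Longrightarrow> summable (\<lambda>n. cmod (a n) * r ^ n)"
    using holomorphic_disc_power_series[OF H] by auto
  have a0: "H 0 = a 0" using a(1)[of 0] powser_sums_zero[of a] sums_unique2 by fastforce
  let ?h = "\<lambda>t. H (of_real r * cis t)"
  have co: "(LINT t|angle. cis (of_int k * t) * ?h t) = (if k \<le> 0 then a (nat (- k)) * of_real r ^ nat (- k) else 0)" for k
    by (rule circle_power_series_coefficient[OF a(1) a(2)[OF r] r])
  have hc: "continuous_on UNIV ?h" by (rule continuous_on_circle_of_holomorphic[OF H r])
  have "integrable angle (\<lambda>t. Re (?h t))" by (intro integrable_angle_continuous continuous_intros hc)
  note S = schwarz_integral_sums(1)[OF this w]
  have coef: "(if n = 0 then 1 else 2) * (LINT t|angle. of_real (Re (?h t)) * cis (- real n * t)) = a n * of_real r ^ n - (if n = 0 then \<i> * Im (H 0) else 0)" for n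
  proof -
    have i: "integrable angle (\<lambda>t. cis (of_int k * t) * ?h t)" for k
      by (intro integrable_angle_continuous continuous_intros hc)
    have "of_real (Re (?h t)) * cis (- real n * t) = (cis (of_int (- int n) * t) * ?h t + cnj (cis (of_int (int n) * t) * ?h t)) / 2" for t
    proof -
      have re: "of_real (Re (?h t)) = (?h t + cnj (?h t)) / 2" by (simp add: complex_eq_iff)
      show ?thesis unfolding re by (simp add: cis_cnj field_simps del: complex_add_cnj)
    qed
    then have "(LINT t|angle. of_real (Re (?h t)) * cis (- real n * t)) =
        (LINT t|angle. (cis (of_int (- int n) * t) * ?h t + cnj (cis (of_int (int n) * t) * ?h t)) / 2)"
      by (simp only:)
    also have "\<dots> =
        ((LINT t|angle. cis (of_int (- int n) * t) * ?h t) + cnj (LINT t|angle. cis (of_int (int n) * t) * ?h t)) / 2"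
      by (simp only: integral_divide_zero Bochner_Integration.integral_cnj
          Bochner_Integration.integral_add[OF i integrable_cnj[OF i]])
    also have "\<dots> = (a n * of_real r ^ n + (if n = 0 then cnj (a 0) else 0)) / 2"
      unfolding co by (cases "n = 0") simp_all
    finally have eq: "(LINT t|angle. of_real (Re (?h t)) * cis (- real n * t)) = \<dots>" .
    show ?thesis unfolding eq a0 by (cases "n = 0") (simp_all add: complex_eq_iff)
  qed
  have "(\<lambda>n. a n * (of_real r * w) ^ n - (if n = 0 then \<i> * Im (H 0) else 0)) sums (H (of_real r * w) - \<i> * Im (H 0))"
  proof (rule sums_diff[OF a(1)])
    have "cmod (of_real r * w) \<le> 1 * cmod w" unfolding norm_mult using r by (intro mult_right_mono) auto
    then show "cmod (of_real r * w) < 1" using w by simp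
    show "(\<lambda>n. if n = 0 then \<i> * Im (H 0) else 0) sums (\<i> * Im (H 0))"
      using sums_single[of 0 "\<lambda>_. \<i> * Im (H 0)"] by simp
  qed
  moreover have "(\<lambda>n. a n * (of_real r * w) ^ n - (if n = 0 then \<i> * Im (H 0) else 0)) sums schwarz_integral (\<lambda>t. Re (?h t)) w"
  proof (rule sums_cong[THEN iffD1, OF _ S])
    fix n
    show "(if n = 0 then 1 else 2) * (LINT t|angle. of_real (Re (?h t)) * cis (- real n * t)) * w ^ n = a n * (of_real r * w) ^ n - (if n = 0 then \<i> * Im (H 0) else 0)"
      unfolding coef by (simp add: power_mult_distrib)
  qed
  ultimately show ?thesis by (rule sums_unique2[symmetric])
qed

text \<open>The Schwarz integrals of the positive parts of \<open>Re H\<close> on the circles of radius \<open>R k\<close> are locally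
  bounded, because the means are bounded. A locally uniform limit \<open>P\<close> of a subsequence and
  \<open>Q = P - H + const\<close> both have nonnegative real part.\<close>

theorem Fatou_h1:
  assumes H: "H holomorphic_on ball 0 1"
    and R: "\<And>k. 0 \<le> R k" "\<And>k. R k < 1" "R \<longlonglongrightarrow> 1"
    and C: "\<And>k. (LINT t|angle. \<bar>Re (H (of_real (R k) * cis t))\<bar>) \<le> C"
  shows "AE s in angle. \<exists>L. ((\<lambda>r. Re (H (of_real r * cis s))) \<longlongrightarrow> L) (at_left 1)"
proof -
  define \<phi> where "\<phi> k t = Re (H (of_real (R k) * cis t))" for k t
  have \<phi>c: "continuous_on UNIV (\<phi> k)" for k
    unfolding \<phi>_def by (intro continuous_intros continuous_on_circle_of_holomorphic H R)
  have ip: "integrable angle (\<lambda>t. max (\<phi> k t) 0)" and im: "integrable angle (\<lambda>t. max (- \<phi> k t) 0)"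
    and ia: "integrable angle (\<lambda>t. \<bar>\<phi> k t\<bar>)" for k
    by (intro integrable_angle_continuous continuous_intros \<phi>c)+
  define F where "F k = schwarz_integral (\<lambda>t. max (\<phi> k t) 0)" for k
  have F_diff: "schwarz_integral (\<lambda>t. max (- \<phi> k t) 0) w = F k w - H (of_real (R k) * w) + \<i> * Im (H 0)" if "cmod w < 1" for k w
  proof -
    have "(\<lambda>t. max (\<phi> k t) 0 - max (- \<phi> k t) 0) = \<phi> k" by (auto simp: max_def)
    then have "schwarz_integral (\<phi> k) w = F k w - schwarz_integral (\<lambda>t. max (- \<phi> k t) 0) w"
      using schwarz_integral_diff[OF ip im that, of k k] by (simp add: F_def)
    moreover have "schwarz_integral (\<phi> k) w = H (of_real (R k) * w) - \<i> * Im (H 0)"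
      using schwarz_integral_Re[OF H R(1,2) that, of k] by (simp only: \<phi>_def[abs_def])
    ultimately show ?thesis by (simp add: algebra_simps)
  qed
  have F_bound: "cmod (F k w) \<le> 2 / (1 - \<rho>) * C" if "cmod w \<le> \<rho>" "\<rho> < 1" for k w \<rho>
  proof -
    have bd: "cmod (F k w) \<le> 2 / (1 - \<rho>) * (LINT t|angle. \<bar>max (\<phi> k t) 0\<bar>)"
      unfolding F_def by (rule norm_schwarz_integral_le[OF ip that])
    have "(LINT t|angle. \<bar>max (\<phi> k t) 0\<bar>) \<le> (LINT t|angle. \<bar>\<phi> k t\<bar>)"
      by (rule integral_mono[OF integrable_abs[OF ip] ia]) auto
    moreover have "(LINT t|angle. \<bar>\<phi> k t\<bar>) \<le> C" using C unfolding \<phi>_def .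
    ultimately have "(LINT t|angle. \<bar>max (\<phi> k t) 0\<bar>) \<le> C" by linarith
    then have "2 / (1 - \<rho>) * (LINT t|angle. \<bar>max (\<phi> k t) 0\<bar>) \<le> 2 / (1 - \<rho>) * C"
      using that by (intro mult_left_mono) auto
    with bd show ?thesis by linarith
  qed
  obtain P \<sigma> where P: "P holomorphic_on ball 0 1" "strict_mono (\<sigma> :: nat \<Rightarrow> nat)"
      "\<And>x. x \<in> ball 0 1 \<Longrightarrow> (\<lambda>n. F (\<sigma> n) x) \<longlonglongrightarrow> P x"
  proof (rule Montel[of "ball 0 1" "range F" F])
    show "h holomorphic_on ball 0 1" if "h \<in> range F" for h
      using that holomorphic_schwarz_integral[OF ip] by (auto simp: F_def)
    show "\<exists>B. \<forall>h\<in>range F. \<forall>z\<in>K. cmod (h z) \<le> B" if K: "compact K" "K \<subseteq> ball 0 1" for K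
    proof (cases "K = {}")
      case False
      obtain x where x: "x \<in> K" "\<And>y. y \<in> K \<Longrightarrow> cmod y \<le> cmod x"
        using continuous_attains_sup[OF K(1) False, of cmod] by (auto intro: continuous_intros)
      have "cmod x < 1" using x(1) K(2) by auto
      then show ?thesis using F_bound x(2) by (intro exI[of _ "2 / (1 - cmod x) * C"]) auto
    qed simp
  qed auto
  define Q where "Q w = P w - H w + \<i> * Im (H 0)" for w
  have Q: "Q holomorphic_on ball 0 1" unfolding Q_def by (intro holomorphic_intros P H)
  have P0: "0 \<le> Re (P w)" if w: "cmod w < 1" for w
  proof (rule tendsto_lowerbound)
    show "(\<lambda>n. Re (F (\<sigma> n) w)) \<longlonglongrightarrow> Re (P w)"
      using P(3)[of w] w by (intro tendsto_intros) auto
    show "\<forall>\<^sub>F n in sequentially. 0 \<le> Re (F (\<sigma> n) w)"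
      unfolding F_def by (intro always_eventually allI Re_schwarz_integral_nonneg[OF ip w]) auto
  qed simp
  have Q0: "0 \<le> Re (Q w)" if w: "cmod w < 1" for w
  proof (rule tendsto_lowerbound)
    have "isCont H w" using H w by (metis holomorphic_on_imp_continuous_on continuous_on_eq_continuous_at open_ball mem_ball_0)
    moreover have "(\<lambda>n. of_real (R (\<sigma> n)) * w) \<longlonglongrightarrow> of_real 1 * w"
      by (intro tendsto_intros LIMSEQ_subseq_LIMSEQ[OF R(3) P(2), unfolded o_def])
    ultimately have "(\<lambda>n. H (of_real (R (\<sigma> n)) * w)) \<longlonglongrightarrow> H w"
      by (intro isCont_tendsto_compose[of w H]) auto
    then show "(\<lambda>n. Re (F (\<sigma> n) w - H (of_real (R (\<sigma> n)) * w) + \<i> * Im (H 0))) \<longlonglongrightarrow> Re (Q w)"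
      unfolding Q_def using P(3)[of w] w by (intro tendsto_intros) auto
    show "\<forall>\<^sub>F n in sequentially. 0 \<le> Re (F (\<sigma> n) w - H (of_real (R (\<sigma> n)) * w) + \<i> * Im (H 0))"
      unfolding F_diff[OF w, symmetric] by (intro always_eventually allI Re_schwarz_integral_nonneg[OF im w]) auto
  qed simp
  have "AE s in angle. \<exists>L. ((\<lambda>r. Re (P (of_real r * cis s))) \<longlongrightarrow> L) (at_left 1)"
    and "AE s in angle. \<exists>L. ((\<lambda>r. Re (Q (of_real r * cis s))) \<longlongrightarrow> L) (at_left 1)"
    by (rule Fatou_nonneg_real_part[OF P(1) P0] Fatou_nonneg_real_part[OF Q Q0]; assumption)+
  then show ?thesis
  proof eventually_elim
    case (elim s)
    then obtain L1 L2 where "((\<lambda>r. Re (P (of_real r * cis s))) \<longlongrightarrow> L1) (at_left 1)"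
        "((\<lambda>r. Re (Q (of_real r * cis s))) \<longlongrightarrow> L2) (at_left 1)" by blast
    from tendsto_diff[OF this] show ?case by (auto simp: Q_def)
  qed
qed

section \<open>Jordan decomposition and integrals against complex measures\<close>

definition signed_measure :: "'a measure \<Rightarrow> ('a set \<Rightarrow> real) \<Rightarrow> bool" where
  "signed_measure M \<rho> \<longleftrightarrow> \<rho> {} = 0 \<and>
     (\<forall>A :: nat \<Rightarrow> 'a set. range A \<subseteq> sets M \<longrightarrow> disjoint_family A \<longrightarrow>
        (\<lambda>n. \<rho> (A n)) sums \<rho> (\<Union>n. A n))"

lemma signed_measure_uminus: "signed_measure M \<rho> \<Longrightarrow> signed_measure M (\<lambda>A. - \<rho> A)"
  unfolding signed_measure_def by (auto intro: sums_minus)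

lemma signed_measure_Re: "complex_measure M \<mu> \<Longrightarrow> signed_measure M (\<lambda>A. Re (\<mu> A))"
  and signed_measure_Im: "complex_measure M \<mu> \<Longrightarrow> signed_measure M (\<lambda>A. Im (\<mu> A))"
  unfolding signed_measure_def complex_measure_def by (auto intro: sums_Re sums_Im)

context
  fixes M :: "'a measure" and \<rho> :: "'a set \<Rightarrow> real"
  assumes \<rho>: "signed_measure M \<rho>"
begin

lemma signed_measure_empty: "\<rho> {} = 0"
  using \<rho> by (simp add: signed_measure_def)

lemma signed_measure_sums:
  "range A \<subseteq> sets M \<Longrightarrow> disjoint_family (A :: nat \<Rightarrow> 'a set) \<Longrightarrow> (\<lambda>n. \<rho> (A n)) sums \<rho> (\<Union>n. A n)"
  using \<rho> unfolding signed_measure_def by blast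

lemma signed_measure_Un:
  assumes "A \<in> sets M" "B \<in> sets M" "A \<inter> B = {}"
  shows "\<rho> (A \<union> B) = \<rho> A + \<rho> B"
proof -
  have "disjoint_family (binaryset A B)"
    using assms(3) by (auto simp: disjoint_family_on_def binaryset_def)
  then have "(\<lambda>n. \<rho> (binaryset A B n)) sums \<rho> (\<Union>n. binaryset A B n)"
    using assms by (intro signed_measure_sums) (auto simp: range_binaryset_eq)
  then show ?thesis
    using binaryset_sums[of \<rho> A B, OF signed_measure_empty] sums_unique2 by (fastforce simp: UN_binaryset_eq)
qed

lemma signed_measure_Diff:
  assumes "A \<in> sets M" "B \<in> sets M" "B \<subseteq> A"
  shows "\<rho> (A - B) = \<rho> A - \<rho> B"
proof -
  have "(A - B) \<union> B = A" "(A - B) \<inter> B = {}" using assms by auto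
  then show ?thesis using signed_measure_Un[of "A - B" B] assms by simp
qed

text \<open>If the values were unbounded, one could pass to smaller and smaller sets on which they are still
  unbounded, each time cutting off a piece whose value exceeds 1 in modulus. The pieces are disjoint,
  so their values would have to tend to 0.\<close>

lemma signed_measure_bounded: "\<exists>C. \<forall>A\<in>sets M. \<bar>\<rho> A\<bar> \<le> C"
proof (rule ccontr)
  define unb where "unb E \<longleftrightarrow> E \<in> sets M \<and> (\<forall>C. \<exists>B\<in>sets M. B \<subseteq> E \<and> C < \<bar>\<rho> B\<bar>)" for E
  assume *: "\<nexists>C. \<forall>A\<in>sets M. \<bar>\<rho> A\<bar> \<le> C"
  have base: "unb (space M)"
    unfolding unb_def using * sets.sets_into_space by (metis linorder_not_le sets.top)
  have step: "\<exists>B. unb B \<and> B \<subseteq> E \<and> 1 < \<bar>\<rho> (E - B)\<bar>" if E: "unb E" for E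
  proof -
    have Es: "E \<in> sets M" using E by (simp add: unb_def)
    obtain B where B: "B \<in> sets M" "B \<subseteq> E" "1 + \<bar>\<rho> E\<bar> < \<bar>\<rho> B\<bar>"
      using E unfolding unb_def by blast
    have d: "\<rho> (E - B) = \<rho> E - \<rho> B" by (rule signed_measure_Diff[OF Es B(1,2)])
    show ?thesis
    proof (cases "unb B")
      case True then show ?thesis using B d by (intro exI[of _ B]) auto
    next
      case False
      then obtain c where c: "\<And>D. D \<in> sets M \<Longrightarrow> D \<subseteq> B \<Longrightarrow> \<bar>\<rho> D\<bar> \<le> c"
        unfolding unb_def using B(1) by (meson linorder_not_le)
      have "unb (E - B)" unfolding unb_def
      proof (intro conjI allI)
        show "E - B \<in> sets M" using Es B by auto
        fix C
        obtain D where D: "D \<in> sets M" "D \<subseteq> E" "C + c < \<bar>\<rho> D\<bar>"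
          using E unfolding unb_def by blast
        have "\<rho> D = \<rho> (D \<inter> B) + \<rho> (D - B)"
          using signed_measure_Un[of "D \<inter> B" "D - B"] D(1) B(1) by (simp add: Int_Diff_Un Int_Diff_disjoint)
        moreover have "\<bar>\<rho> (D \<inter> B)\<bar> \<le> c" using c[of "D \<inter> B"] D B by auto
        ultimately have "C < \<bar>\<rho> (D - B)\<bar>" using D(3) by linarith
        then show "\<exists>B'\<in>sets M. B' \<subseteq> E - B \<and> C < \<bar>\<rho> B'\<bar>"
          using D B by (intro bexI[of _ "D - B"]) auto
      qed
      moreover have "E - (E - B) = B" using B(2) by blast
      ultimately show ?thesis using B by (intro exI[of _ "E - B"]) auto
    qed
  qed
  obtain E where E: "\<And>n. unb (E n)" "\<And>n. E (Suc n) \<subseteq> E n \<and> 1 < \<bar>\<rho> (E n - E (Suc n))\<bar>"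
    using dependent_nat_choice[of "\<lambda>_. unb" "\<lambda>_ A B. B \<subseteq> A \<and> 1 < \<bar>\<rho> (A - B)\<bar>"] base step by metis
  have dec: "decseq E" using E(2) by (intro decseq_SucI) auto
  have "disjoint_family (\<lambda>n. E n - E (Suc n))"
  proof -
    have "(E m - E (Suc m)) \<inter> (E n - E (Suc n)) = {}" if "m < n" for m n
      using decseqD[OF dec, of "Suc m" n] that by auto
    then show ?thesis unfolding disjoint_family_on_def by (metis inf_commute linorder_neqE_nat)
  qed
  then have "(\<lambda>n. \<rho> (E n - E (Suc n))) sums \<rho> (\<Union>n. E n - E (Suc n))"
    using E(1) by (intro signed_measure_sums) (auto simp: unb_def)
  then have "(\<lambda>n. \<rho> (E n - E (Suc n))) \<longlonglongrightarrow> 0"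
    by (intro summable_LIMSEQ_zero) (rule sums_summable)
  then have "\<forall>\<^sub>F n in sequentially. dist (\<rho> (E n - E (Suc n))) 0 < 1" by (rule tendstoD) simp
  then show False using E(2) by (auto simp: eventually_sequentially not_less less_imp_le) (meson less_asym order_refl)
qed

text \<open>Countable additivity of the supremum; it is what makes \<^const>\<open>positive_part\<close> take the values in its definition.\<close>

lemma emeasure_positive_part:
  assumes "A \<in> sets M"
  shows "emeasure (positive_part M \<rho>) A = (SUP B\<in>{B \<in> sets M. B \<subseteq> A}. ennreal (\<rho> B))"
proof -
  define p where "p A = (SUP B\<in>{B \<in> sets M. B \<subseteq> A}. ennreal (\<rho> B))" for A
  have upper: "ennreal (\<rho> B) \<le> p A" if "B \<in> sets M" "B \<subseteq> A" for A B
    unfolding p_def using that by (intro SUP_upper) auto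
  have mono: "p A \<le> p B" if "A \<subseteq> B" for A B
    unfolding p_def using that by (intro SUP_subset_mono) auto
  have super: "p A + p B \<le> p (A \<union> B)" if AB: "A \<inter> B = {}" for A B
  proof -
    have ne: "{B \<in> sets M. B \<subseteq> X} \<noteq> {}" for X by auto
    have pt: "ennreal (\<rho> C) + ennreal (\<rho> D) \<le> p (A \<union> B)" if CD: "C \<in> sets M" "C \<subseteq> A" "D \<in> sets M" "D \<subseteq> B" for C D
    proof -
      \<comment> \<open>sets of negative value count as 0 and may be replaced by the empty set\<close>
      define C' where "C' = (if 0 \<le> \<rho> C then C else {})"
      define D' where "D' = (if 0 \<le> \<rho> D then D else {})"
      have "0 \<le> \<rho> C'" "0 \<le> \<rho> D'" "ennreal (\<rho> C) = ennreal (\<rho> C')" "ennreal (\<rho> D) = ennreal (\<rho> D')"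
        by (auto simp: C'_def D'_def signed_measure_empty ennreal_neg)
      moreover have "\<rho> (C' \<union> D') = \<rho> C' + \<rho> D'"
        using CD AB by (intro signed_measure_Un) (auto simp: C'_def D'_def)
      moreover have "ennreal (\<rho> (C' \<union> D')) \<le> p (A \<union> B)"
        using CD by (intro upper) (auto simp: C'_def D'_def)
      ultimately show ?thesis by simp
    qed
    have "p A + p B = (SUP C\<in>{C \<in> sets M. C \<subseteq> A}. ennreal (\<rho> C) + p B)"
      unfolding p_def[of A] by (rule ennreal_SUP_add_left[symmetric, OF ne])
    also have "\<dots> = (SUP C\<in>{C \<in> sets M. C \<subseteq> A}. SUP D\<in>{D \<in> sets M. D \<subseteq> B}. ennreal (\<rho> C) + ennreal (\<rho> D))"
    proof (intro SUP_cong refl)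
      fix C
      show "ennreal (\<rho> C) + p B = (SUP D\<in>{D \<in> sets M. D \<subseteq> B}. ennreal (\<rho> C) + ennreal (\<rho> D))"
        unfolding p_def[of B] add.commute[of "ennreal (\<rho> C)"] by (rule ennreal_SUP_add_left[symmetric, OF ne])
    qed
    also have "\<dots> \<le> p (A \<union> B)" using pt by (intro SUP_least) auto
    finally show ?thesis .
  qed
  have "countably_additive (sets M) p"
  proof (rule countably_additiveI)
    fix A :: "nat \<Rightarrow> 'a set" assume A: "range A \<subseteq> sets M" "disjoint_family A"
    show "(\<Sum>i. p (A i)) = p (\<Union>i. A i)"
    proof (rule antisym)
      have "(\<Sum>i<n. p (A i)) \<le> p (\<Union>i<n. A i)" for n
      proof (induction n)
        case (Suc n)
        have "(\<Union>i<n. A i) \<inter> A n = {}"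
          using A(2) by (auto simp: disjoint_family_on_def) (metis IntI empty_iff less_irrefl)
        then have "p (\<Union>i<n. A i) + p (A n) \<le> p ((\<Union>i<n. A i) \<union> A n)" by (rule super)
        moreover have "(\<Union>i<n. A i) \<union> A n = (\<Union>i<Suc n. A i)" by (auto simp: lessThan_Suc)
        ultimately show ?case
          using order.trans[OF add_right_mono[OF Suc, of "p (A n)"]] by simp
      qed simp
      also have "p (\<Union>i<n. A i) \<le> p (\<Union>i. A i)" for n by (intro mono) auto
      finally show "(\<Sum>i. p (A i)) \<le> p (\<Union>i. A i)" by (intro suminf_le_const) auto
      show "p (\<Union>i. A i) \<le> (\<Sum>i. p (A i))"
        unfolding p_def[of "\<Union>i. A i"]
      proof (rule SUP_least)
        fix B assume B: "B \<in> {B \<in> sets M. B \<subseteq> (\<Union>i. A i)}"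
        have "(\<lambda>n. \<rho> (B \<inter> A n)) sums \<rho> (\<Union>n. B \<inter> A n)"
          using A B by (intro signed_measure_sums) (auto simp: disjoint_family_on_def)
        moreover have "(\<Union>n. B \<inter> A n) = B" using B by auto
        ultimately have "(\<lambda>n. ennreal (\<Sum>i<n. \<rho> (B \<inter> A i))) \<longlonglongrightarrow> ennreal (\<rho> B)"
          by (intro tendsto_ennrealI) (simp add: sums_def)
        moreover have "ennreal (\<Sum>i<n. \<rho> (B \<inter> A i)) \<le> (\<Sum>i. p (A i))" for n
        proof -
          have "ennreal (\<Sum>i<n. \<rho> (B \<inter> A i)) \<le> ennreal (\<Sum>i<n. max 0 (\<rho> (B \<inter> A i)))"
            by (intro ennreal_leI sum_mono) auto
          also have "\<dots> = (\<Sum>i<n. ennreal (\<rho> (B \<inter> A i)))"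
            by (subst sum_ennreal[symmetric]) (auto simp: ennreal_max_0)
          also have "\<dots> \<le> (\<Sum>i<n. p (A i))"
            using A B by (intro sum_mono upper) auto
          also have "\<dots> \<le> (\<Sum>i. p (A i))" by (intro sum_le_suminf) auto
          finally show ?thesis .
        qed
        ultimately show "ennreal (\<rho> B) \<le> (\<Sum>i. p (A i))"
          by (intro LIMSEQ_le_const2) auto
      qed
    qed
  qed
  moreover have "positive (sets M) p"
    by (auto simp: positive_def p_def signed_measure_empty)
  moreover have "positive_part M \<rho> = measure_of (space M) (sets M) p"
    unfolding positive_part_def p_def ..
  ultimately have "emeasure (positive_part M \<rho>) A = p A"
    using assms by (simp add: sets.sigma_algebra_axioms emeasure_measure_of_sigma)
  then show ?thesis by (simp add: p_def)
qed

lemma sets_positive_part: "sets (positive_part M \<rho>) = sets M"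
  unfolding positive_part_def by simp

lemma space_positive_part: "space (positive_part M \<rho>) = space M"
  unfolding positive_part_def by (simp add: space_measure_of_conv)

lemma finite_measure_positive_part: "finite_measure (positive_part M \<rho>)"
proof
  obtain C where C: "\<And>A. A \<in> sets M \<Longrightarrow> \<bar>\<rho> A\<bar> \<le> C" using signed_measure_bounded by blast
  have "emeasure (positive_part M \<rho>) (space M) \<le> ennreal C"
    unfolding emeasure_positive_part[OF sets.top] using C by (intro SUP_least ennreal_leI) (auto simp: abs_le_iff)
  then show "emeasure (positive_part M \<rho>) (space (positive_part M \<rho>)) \<noteq> \<infinity>"
    unfolding space_positive_part by (auto simp: top_unique)
qed

lemma le_measure_positive_part:
  assumes "A \<in> sets M" "B \<in> sets M" "B \<subseteq> A"
  shows "\<rho> B \<le> measure (positive_part M \<rho>) A"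
proof -
  interpret finite_measure "positive_part M \<rho>" by (rule finite_measure_positive_part)
  have "ennreal (\<rho> B) \<le> emeasure (positive_part M \<rho>) A"
    unfolding emeasure_positive_part[OF assms(1)] using assms by (intro SUP_upper) auto
  then show ?thesis unfolding emeasure_eq_measure by (simp add: ennreal_le_iff2 split: if_splits) (meson measure_nonneg order.trans le_cases not_le)?
qed

lemma measure_positive_part_le:
  assumes "A \<in> sets M" and K: "\<And>B. B \<in> sets M \<Longrightarrow> B \<subseteq> A \<Longrightarrow> \<rho> B \<le> K"
  shows "measure (positive_part M \<rho>) A \<le> K"
proof -
  interpret finite_measure "positive_part M \<rho>" by (rule finite_measure_positive_part)
  have "0 \<le> K" using K[of "{}"] by (simp add: signed_measure_empty)
  moreover have "emeasure (positive_part M \<rho>) A \<le> ennreal K"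
    unfolding emeasure_positive_part[OF assms(1)] using K by (intro SUP_least ennreal_leI) auto
  ultimately show ?thesis unfolding emeasure_eq_measure by simp
qed

end

text \<open>Passing to complements, the supremum of \<open>\<rho> B\<close> over \<open>B \<subseteq> A\<close> is \<open>\<rho> A\<close> plus the supremum of \<open>- \<rho> B\<close>.\<close>

lemma Jordan_decomposition:
  assumes \<rho>: "signed_measure M \<rho>" and A: "A \<in> sets M"
  shows "\<rho> A = measure (positive_part M \<rho>) A - measure (positive_part M (\<lambda>A. - \<rho> A)) A"
proof -
  have \<rho>': "signed_measure M (\<lambda>A. - \<rho> A)" by (rule signed_measure_uminus[OF \<rho>])
  have "measure (positive_part M \<rho>) A \<le> \<rho> A + measure (positive_part M (\<lambda>A. - \<rho> A)) A"
  proof (rule measure_positive_part_le[OF \<rho> A])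
    fix B assume B: "B \<in> sets M" "B \<subseteq> A"
    then show "\<rho> B \<le> \<rho> A + measure (positive_part M (\<lambda>A. - \<rho> A)) A"
      using le_measure_positive_part[OF \<rho>' A, of "A - B"] signed_measure_Diff[OF \<rho> A B] A by auto
  qed
  moreover have "measure (positive_part M (\<lambda>A. - \<rho> A)) A \<le> measure (positive_part M \<rho>) A - \<rho> A"
  proof (rule measure_positive_part_le[OF \<rho>' A])
    fix B assume B: "B \<in> sets M" "B \<subseteq> A"
    then show "- \<rho> B \<le> measure (positive_part M \<rho>) A - \<rho> A"
      using le_measure_positive_part[OF \<rho> A, of "A - B"] signed_measure_Diff[OF \<rho> A B] A by auto
  qed
  ultimately show ?thesis by linarith
qed

definition bounded_measurable :: "'a measure \<Rightarrow> ('a \<Rightarrow> complex) set" where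
  "bounded_measurable M = {g \<in> borel_measurable M. \<exists>B. \<forall>x\<in>space M. cmod (g x) \<le> B}"

text \<open>Integration against a complex measure and against an integrable density are functionals of this
  kind, and such a functional is determined by its values on indicators
  (\<open>continuous_functional_eqI\<close>). This identifies integrals without comparing Jordan decompositions.\<close>

definition continuous_functional :: "'a measure \<Rightarrow> (('a \<Rightarrow> complex) \<Rightarrow> complex) \<Rightarrow> bool" where
  "continuous_functional M L \<longleftrightarrow>
     (\<forall>g\<in>bounded_measurable M. \<forall>h\<in>bounded_measurable M. L (\<lambda>x. g x + h x) = L g + L h) \<and>
     (\<forall>c. \<forall>g\<in>bounded_measurable M. L (\<lambda>x. c * g x) = c * L g) \<and>
     (\<forall>s g B. (\<forall>k::nat. s k \<in> borel_measurable M) \<longrightarrow> g \<in> borel_measurable M \<longrightarrow>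
        (\<forall>k. \<forall>x\<in>space M. cmod (s k x) \<le> B) \<longrightarrow> (\<forall>x\<in>space M. (\<lambda>k. s k x) \<longlonglongrightarrow> g x) \<longrightarrow>
        (\<lambda>k. L (s k)) \<longlonglongrightarrow> L g)"

lemma continuous_functional_integral:
  assumes N: "sets N = sets M" and u: "integrable N u"
  shows "continuous_functional M (\<lambda>g. LINT x|N. u x * g x)"
proof -
  have sp: "space N = space M" using N by (rule sets_eq_imp_space_eq)
  have [measurable_cong]: "sets N = sets M" by (rule N)
  have [measurable]: "u \<in> borel_measurable M"
    using u by (simp add: measurable_cong_sets[OF N refl, symmetric] borel_measurable_integrable)
  have i: "integrable N (\<lambda>x. u x * g x)" if g: "g \<in> bounded_measurable M" for g
  proof -
    obtain B where B: "\<And>x. x \<in> space M \<Longrightarrow> cmod (g x) \<le> B" and [measurable]: "g \<in> borel_measurable M"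
      using g by (auto simp: bounded_measurable_def)
    show ?thesis
    proof (rule Bochner_Integration.integrable_bound[OF integrable_mult_right[OF integrable_norm[OF u], of B]])
      show "AE x in N. norm (u x * g x) \<le> norm (B * norm (u x))"
      proof (rule AE_I2)
        fix x assume "x \<in> space N"
        then have "cmod (g x) \<le> \<bar>B\<bar>" using B[of x] by (simp add: sp)
        then show "norm (u x * g x) \<le> norm (B * norm (u x))"
          using mult_right_mono[of "cmod (g x)" "\<bar>B\<bar>" "norm (u x)"] by (simp add: norm_mult abs_mult mult.commute)
      qed
    qed measurable
  qed
  show ?thesis unfolding continuous_functional_def
  proof (intro conjI ballI allI impI)
    fix g h assume "g \<in> bounded_measurable M" "h \<in> bounded_measurable M"
    then show "(LINT x|N. u x * (g x + h x)) = (LINT x|N. u x * g x) + (LINT x|N. u x * h x)"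
      using i by (simp add: distrib_left)
  next
    fix c and g :: "'a \<Rightarrow> complex"
    show "(LINT x|N. u x * (c * g x)) = c * (LINT x|N. u x * g x)"
      by (simp add: mult.left_commute)
  next
    fix s g B
    assume s: "\<forall>k::nat. s k \<in> borel_measurable M" "\<forall>k. \<forall>x\<in>space M. cmod (s k x) \<le> B"
      and g: "g \<in> borel_measurable M" and lim: "\<forall>x\<in>space M. (\<lambda>k. s k x) \<longlonglongrightarrow> g x"
    have [measurable]: "s k \<in> borel_measurable M" "g \<in> borel_measurable M" for k using s g by auto
    show "(\<lambda>k. LINT x|N. u x * s k x) \<longlonglongrightarrow> (LINT x|N. u x * g x)"
    proof (rule integral_dominated_convergence[where w = "\<lambda>x. B * cmod (u x)"])
      show "integrable N (\<lambda>x. B * cmod (u x))" using u by simp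
      show "AE x in N. (\<lambda>k. u x * s k x) \<longlonglongrightarrow> u x * g x"
        using lim by (intro AE_I2 tendsto_mult tendsto_const) (auto simp: sp)
      show "AE x in N. cmod (u x * s k x) \<le> B * cmod (u x)" for k
      proof (rule AE_I2)
        fix x assume "x \<in> space N"
        then show "cmod (u x * s k x) \<le> B * cmod (u x)"
          using s(2) mult_right_mono[of "cmod (s k x)" B "cmod (u x)"] by (simp add: sp norm_mult mult.commute)
      qed
    qed measurable
  qed
qed

lemma continuous_functional_plus:
  "continuous_functional M L \<Longrightarrow> g \<in> bounded_measurable M \<Longrightarrow> h \<in> bounded_measurable M \<Longrightarrow>
    L (\<lambda>x. g x + h x) = L g + L h"
  and continuous_functional_scale:
  "continuous_functional M L \<Longrightarrow> g \<in> bounded_measurable M \<Longrightarrow> L (\<lambda>x. c * g x) = c * L g"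
  unfolding continuous_functional_def by blast+

lemma continuous_functional_tendsto:
  assumes "continuous_functional M L" "\<And>k::nat. s k \<in> borel_measurable M" "g \<in> borel_measurable M"
    "\<And>k x. x \<in> space M \<Longrightarrow> cmod (s k x) \<le> B" "\<And>x. x \<in> space M \<Longrightarrow> (\<lambda>k. s k x) \<longlonglongrightarrow> g x"
  shows "(\<lambda>k. L (s k)) \<longlonglongrightarrow> L g"
  using assms unfolding continuous_functional_def by blast

lemma continuous_functional_add:
  assumes L: "continuous_functional M L" and K: "continuous_functional M K"
  shows "continuous_functional M (\<lambda>g. L g + K g)"
  unfolding continuous_functional_def
proof (intro conjI ballI allI impI)
  fix s g B
  assume "\<forall>k::nat. s k \<in> borel_measurable M" "g \<in> borel_measurable M"
    "\<forall>k. \<forall>x\<in>space M. cmod (s k x) \<le> B" "\<forall>x\<in>space M. (\<lambda>k. s k x) \<longlonglongrightarrow> g x"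
  then show "(\<lambda>k. L (s k) + K (s k)) \<longlonglongrightarrow> L g + K g"
    by (intro tendsto_add continuous_functional_tendsto[OF L] continuous_functional_tendsto[OF K]) auto
qed (simp_all add: continuous_functional_plus[OF L] continuous_functional_plus[OF K]
      continuous_functional_scale[OF L] continuous_functional_scale[OF K] distrib_left)

lemma continuous_functional_cmult:
  assumes L: "continuous_functional M L"
  shows "continuous_functional M (\<lambda>g. c * L g)"
  unfolding continuous_functional_def
proof (intro conjI ballI allI impI)
  fix s g B
  assume "\<forall>k::nat. s k \<in> borel_measurable M" "g \<in> borel_measurable M"
    "\<forall>k. \<forall>x\<in>space M. cmod (s k x) \<le> B" "\<forall>x\<in>space M. (\<lambda>k. s k x) \<longlonglongrightarrow> g x"
  then show "(\<lambda>k. c * L (s k)) \<longlonglongrightarrow> c * L g"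
    by (intro tendsto_mult tendsto_const continuous_functional_tendsto[OF L]) auto
qed (simp_all add: continuous_functional_plus[OF L] continuous_functional_scale[OF L] distrib_left)

text \<open>Bounded measurable functions are bounded pointwise limits of linear combinations of indicators.\<close>

lemma continuous_functional_eqI:
  assumes L: "continuous_functional M L" and K: "continuous_functional M K"
    and ind: "\<And>A. A \<in> sets M \<Longrightarrow> L (indicator A) = K (indicator A)"
    and g: "g \<in> bounded_measurable M"
  shows "L g = K g"
proof -
  have simple: "L (\<lambda>x. \<Sum>y\<in>S. y * indicator (A y) x) = K (\<lambda>x. \<Sum>y\<in>S. y * indicator (A y) x) \<and> (\<lambda>x. \<Sum>y\<in>S. y * indicator (A y) x) \<in> bounded_measurable M"
    if "finite S" "\<And>y. y \<in> S \<Longrightarrow> A y \<in> sets M" for S A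
    using that
  proof (induction S)
    case empty
    have z: "(\<lambda>x. 0) \<in> bounded_measurable M" by (auto simp: bounded_measurable_def)
    show ?case
      using z continuous_functional_scale[OF L z, of 0] continuous_functional_scale[OF K z, of 0] by simp
  next
    case (insert y S)
    have i: "indicator (A y) \<in> bounded_measurable M"
      using insert.prems[of y] unfolding bounded_measurable_def by (auto intro!: exI[of _ 1] simp: indicator_def)
    have yi: "(\<lambda>x. y * indicator (A y) x) \<in> bounded_measurable M"
      using insert.prems[of y] unfolding bounded_measurable_def by (auto intro!: exI[of _ "cmod y"] simp: indicator_def)
    have IH: "L (\<lambda>x. \<Sum>y\<in>S. y * indicator (A y) x) = K (\<lambda>x. \<Sum>y\<in>S. y * indicator (A y) x)"
        "(\<lambda>x. \<Sum>y\<in>S. y * indicator (A y) x) \<in> bounded_measurable M"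
      using insert by auto
    have "(\<lambda>x. y * indicator (A y) x + (\<Sum>y\<in>S. y * indicator (A y) x)) \<in> bounded_measurable M"
    proof -
      obtain B1 B2 where "\<And>x. x \<in> space M \<Longrightarrow> cmod (y * indicator (A y) x) \<le> B1"
          "\<And>x. x \<in> space M \<Longrightarrow> cmod (\<Sum>y\<in>S. y * indicator (A y) x) \<le> B2"
        using yi IH(2) unfolding bounded_measurable_def by auto
      then show ?thesis
        using yi IH(2) unfolding bounded_measurable_def
        by (auto intro!: exI[of _ "B1 + B2"] norm_triangle_le add_mono)
    qed
    moreover have "L (\<lambda>x. y * indicator (A y) x + (\<Sum>y\<in>S. y * indicator (A y) x)) = K (\<lambda>x. y * indicator (A y) x + (\<Sum>y\<in>S. y * indicator (A y) x))"
    proof -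
      show ?thesis
        using continuous_functional_plus[OF L yi IH(2)] continuous_functional_plus[OF K yi IH(2)]
          continuous_functional_scale[OF L i, of y] continuous_functional_scale[OF K i, of y] ind[OF insert.prems[of y]] IH(1) by simp
    qed
    ultimately show ?case by (simp only: sum.insert[OF insert.hyps(1,2)] simp_thms)
  qed
  obtain B where B: "\<And>x. x \<in> space M \<Longrightarrow> cmod (g x) \<le> B" and gm: "g \<in> borel_measurable M"
    using g by (auto simp: bounded_measurable_def)
  obtain s where s: "\<And>k. simple_function M (s k)" "\<And>x. x \<in> space M \<Longrightarrow> (\<lambda>k. s k x) \<longlonglongrightarrow> g x"
      "\<And>k x. x \<in> space M \<Longrightarrow> dist (s k x) 0 \<le> 2 * dist (g x) 0"
    using borel_measurable_implies_sequence_metric[OF gm, of 0] by blast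
  define s' where "s' k x = (\<Sum>y\<in>s k ` space M. y * indicator (s k -` {y} \<inter> space M) x)" for k x
  have s_eq: "s' k x = s k x" if "x \<in> space M" for k x
  proof -
    have "indicator X x *\<^sub>R y = y * indicator X x" for X and y :: complex
      by (simp add: indicator_def)
    then show ?thesis
      using simple_function_indicator_representation_banach[OF s(1) that, of k] unfolding s'_def by (simp only:)
  qed
  have s'1: "L (s' k) = K (s' k)" "s' k \<in> bounded_measurable M" for k
    using simple[of "s k ` space M" "\<lambda>y. s k -` {y} \<inter> space M"] s(1)[of k]
    unfolding s'_def[abs_def] simple_function_def by auto
  have bd: "cmod (s' k x) \<le> 2 * B" if "x \<in> space M" for k x
    using s(3)[OF that, of k] B[OF that] s_eq[OF that] by simp
  have "(\<lambda>k. F (s' k)) \<longlonglongrightarrow> F g" if "continuous_functional M F" for F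
  proof (rule continuous_functional_tendsto[OF that])
    show "s' k \<in> borel_measurable M" for k using s'1(2) by (simp add: bounded_measurable_def)
    show "(\<lambda>k. s' k x) \<longlonglongrightarrow> g x" if "x \<in> space M" for x using s(2)[OF that] s_eq[OF that] by simp
  qed (use gm bd in auto)
  from this[OF L] this[OF K] show ?thesis
    using s'1(1) LIMSEQ_unique by auto
qed

text \<open>The complex measure is the sum of these four positive measures with the coefficients \<open>\<i> ^ k\<close> for
  \<open>k < 4\<close>.\<close>

definition jordan_part :: "'a measure \<Rightarrow> ('a set \<Rightarrow> complex) \<Rightarrow> nat \<Rightarrow> 'a measure" where
  "jordan_part M \<mu> k = positive_part M (\<lambda>A. Re (cnj (\<i> ^ k) * \<mu> A))"

lemma jordan_part_simps:
  "jordan_part M \<mu> 0 = positive_part M (\<lambda>A. Re (\<mu> A))"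
  "jordan_part M \<mu> 1 = positive_part M (\<lambda>A. Im (\<mu> A))"
  "jordan_part M \<mu> 2 = positive_part M (\<lambda>A. - Re (\<mu> A))"
  "jordan_part M \<mu> 3 = positive_part M (\<lambda>A. - Im (\<mu> A))"
  by (simp_all add: jordan_part_def power2_eq_square power3_eq_cube)

lemma complex_integral_eq:
  "complex_integral M \<mu> g = (\<Sum>k<4. \<i> ^ k * (LINT x|jordan_part M \<mu> k. g x))"
proof -
  have "(\<Sum>k<4. F k) = F 0 + F 1 + F 2 + F 3" for F :: "nat \<Rightarrow> complex"
    by (simp add: lessThan_nat_numeral lessThan_Suc add_ac)
  then show ?thesis
    unfolding complex_integral_def signed_integral_def
    by (simp only: jordan_part_simps) (simp add: power2_eq_square power3_eq_cube algebra_simps)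
qed

context
  fixes M :: "'a measure" and \<mu> :: "'a set \<Rightarrow> complex"
  assumes \<mu>: "complex_measure M \<mu>"
begin

lemma signed_measure_jordan: "signed_measure M (\<lambda>A. Re (cnj (\<i> ^ k) * \<mu> A))"
  unfolding signed_measure_def
proof (intro conjI allI impI)
  fix A :: "nat \<Rightarrow> 'a set" assume "range A \<subseteq> sets M" "disjoint_family A"
  then have "(\<lambda>n. \<mu> (A n)) sums \<mu> (\<Union>n. A n)" using \<mu> by (simp add: complex_measure_def)
  then show "(\<lambda>n. Re (cnj (\<i> ^ k) * \<mu> (A n))) sums Re (cnj (\<i> ^ k) * \<mu> (\<Union>n. A n))"
    by (intro sums_Re sums_mult)
qed (use \<mu> in \<open>simp add: complex_measure_def\<close>)

lemma sets_jordan_part: "sets (jordan_part M \<mu> k) = sets M"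
  unfolding jordan_part_def by (rule sets_positive_part[OF signed_measure_jordan])

lemma finite_measure_jordan_part: "finite_measure (jordan_part M \<mu> k)"
  unfolding jordan_part_def by (rule finite_measure_positive_part[OF signed_measure_jordan])

text \<open>A singular measure keeps its carrier in all four parts.\<close>

lemma jordan_part_null:
  assumes "A \<in> sets M" "\<And>B. B \<in> sets M \<Longrightarrow> B \<subseteq> A \<Longrightarrow> \<mu> B = 0"
  shows "emeasure (jordan_part M \<mu> k) A = 0"
  unfolding jordan_part_def emeasure_positive_part[OF signed_measure_jordan assms(1)]
  using assms(2) by (auto simp: bot_ennreal[symmetric] intro!: antisym SUP_least)

lemma continuous_functional_complex_integral: "continuous_functional M (complex_integral M \<mu>)"
proof -
  have "continuous_functional M (\<lambda>g. \<Sum>k\<in>S. \<i> ^ k * (LINT x|jordan_part M \<mu> k. g x))" if "finite S" for S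
    using that
  proof induction
    case empty
    show ?case by (simp add: continuous_functional_def)
  next
    case (insert k S)
    interpret finite_measure "jordan_part M \<mu> k" by (rule finite_measure_jordan_part)
    have "continuous_functional M (\<lambda>g. LINT x|jordan_part M \<mu> k. 1 * g x)"
      by (rule continuous_functional_integral[OF sets_jordan_part]) simp
    then show ?case using insert by (auto intro!: continuous_functional_add continuous_functional_cmult)
  qed
  then show ?thesis unfolding complex_integral_eq[abs_def] by simp
qed

lemma complex_integral_indicator:
  assumes "A \<in> sets M"
  shows "complex_integral M \<mu> (indicator A) = \<mu> A"
proof -
  have R: "signed_measure M (\<lambda>A. Re (\<mu> A))" and I: "signed_measure M (\<lambda>A. Im (\<mu> A))"
    by (rule signed_measure_Re[OF \<mu>], rule signed_measure_Im[OF \<mu>])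
  have i: "(LINT x|positive_part M \<rho>. indicator A x) = complex_of_real (measure (positive_part M \<rho>) A)"
    if "signed_measure M \<rho>" for \<rho>
  proof -
    interpret finite_measure "positive_part M \<rho>" by (rule finite_measure_positive_part[OF that])
    have "(LINT x|positive_part M \<rho>. complex_of_real (indicator A x)) = complex_of_real (LINT x|positive_part M \<rho>. indicator A x)"
      by (rule integral_complex_of_real)
    then show ?thesis using assms by (simp add: of_real_indicator sets_positive_part[OF that] space_positive_part[OF that] Int_absorb2 sets.sets_into_space)
  qed
  show ?thesis
    unfolding complex_integral_def signed_integral_def
    using Jordan_decomposition[OF R assms] Jordan_decomposition[OF I assms]
    by (simp add: i R I signed_measure_uminus complex_eq_iff)
qed

end

lemma complex_integral_density_measure:
  assumes f: "integrable M f" and M: "sets N = sets M" and c: "complex_measure N (density_measure M f)"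
    and g: "g \<in> bounded_measurable N"
  shows "complex_integral N (density_measure M f) g = (LINT x|M. f x * g x)"
proof (rule continuous_functional_eqI[OF continuous_functional_complex_integral[OF c] _ _ g])
  show "continuous_functional N (\<lambda>g. LINT x|M. f x * g x)"
    by (rule continuous_functional_integral[OF M[symmetric] f])
  show "complex_integral N (density_measure M f) (indicator A) = (LINT x|M. f x * indicator A x)" if "A \<in> sets N" for A
    unfolding complex_integral_indicator[OF c that]
    by (simp add: density_measure_def set_lebesgue_integral_def scaleR_conv_of_real of_real_indicator mult.commute)
qed

lemma complex_measure_density_measure:
  assumes f: "integrable M f" and M: "sets N = sets M"
  shows "complex_measure N (density_measure M f)"
  unfolding complex_measure_def
proof (intro conjI allI impI)
  fix A :: "nat \<Rightarrow> 'a set" assume A: "range A \<subseteq> sets N" "disjoint_family A"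
  have Am: "A i \<in> sets M" for i using A M by auto
  define u where "u n = (\<lambda>x. indicator (\<Union>i<n. A i) x *\<^sub>R f x)" for n
  have "(\<lambda>n. LINT x|M. u n x) \<longlonglongrightarrow> (LINT x|M. indicator (\<Union>i. A i) x *\<^sub>R f x)"
  proof (rule integral_dominated_convergence[where w = "\<lambda>x. norm (f x)"])
    show "AE x in M. (\<lambda>n. u n x) \<longlonglongrightarrow> indicator (\<Union>i. A i) x *\<^sub>R f x"
    proof (rule AE_I2)
      fix x
      have "(\<lambda>n. indicator (\<Union>i<n. A i) x :: real) \<longlonglongrightarrow> indicator (\<Union>i. A i) x"
        by (rule LIMSEQ_indicator_UN)
      then show "(\<lambda>n. u n x) \<longlonglongrightarrow> indicator (\<Union>i. A i) x *\<^sub>R f x"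
        unfolding u_def by (intro tendsto_intros)
    qed
    show "AE x in M. norm (u n x) \<le> norm (f x)" for n
      by (rule AE_I2) (simp add: u_def indicator_def)
  qed (use f Am in \<open>auto simp: u_def\<close>)
  moreover have "(LINT x|M. u n x) = (\<Sum>i<n. LINT x:A i|M. f x)" for n
  proof (induction n)
    case (Suc n)
    have "(\<Union>i<n. A i) \<inter> A n = {}"
      using A(2) by (auto simp: disjoint_family_on_def) (metis IntI empty_iff less_irrefl)
    then have "u (Suc n) x = u n x + indicator (A n) x *\<^sub>R f x" for x
      by (auto simp: u_def lessThan_Suc indicator_def)
    moreover have "integrable M (u n)" "integrable M (\<lambda>x. indicator (A n) x *\<^sub>R f x)"
      unfolding u_def by (intro integrable_mult_indicator f sets.finite_UN Am finite_lessThan)+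
    ultimately show ?case using Suc by (simp add: set_lebesgue_integral_def)
  qed (simp add: u_def)
  ultimately show "(\<lambda>n. density_measure M f (A n)) sums density_measure M f (\<Union>n. A n)"
    by (simp add: sums_def density_measure_def set_lebesgue_integral_def)
qed (simp add: density_measure_def set_lebesgue_integral_def)

section \<open>Characters of the infinite torus\<close>

lemma measurable_cnj [measurable]: "cnj \<in> borel_measurable borel"
  by (intro borel_measurable_continuous_onI continuous_intros)

lemma Z0_add: "\<nu> \<in> Z0 \<Longrightarrow> \<nu>' \<in> Z0 \<Longrightarrow> (\<lambda>j. \<nu> j + \<nu>' j) \<in> Z0"
  unfolding Z0_def by (auto intro: finite_subset[of _ "{j. \<nu> j \<noteq> 0} \<union> {j. \<nu>' j \<noteq> 0}"])

lemma Z0_uminus: "\<nu> \<in> Z0 \<Longrightarrow> (\<lambda>j. - \<nu> j) \<in> Z0"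
  unfolding Z0_def by auto

lemma Z0_zero: "(\<lambda>j. 0) \<in> Z0"
  by (simp add: Z0_def)

lemma Z0_single: "(\<lambda>j. if j = i then k else 0) \<in> Z0"
  unfolding Z0_def by (auto intro: finite_subset[of _ "{i}"])

lemma character_eq_prod:
  "finite J \<Longrightarrow> {j. \<nu> j \<noteq> 0} \<subseteq> J \<Longrightarrow> character \<nu> z = (\<Prod>j\<in>J. z j powi \<nu> j)"
  unfolding character_def by (rule prod.mono_neutral_left) auto

lemma torus_nonzero: "z \<in> torus \<Longrightarrow> z j \<noteq> 0"
  by (auto simp: torus_def dest: spec[of _ j])

lemma cmod_torus: "z \<in> torus \<Longrightarrow> cmod (z j) = 1"
  by (simp add: torus_def)

lemma character_add:
  assumes "\<nu> \<in> Z0" "\<nu>' \<in> Z0" "z \<in> torus"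
  shows "character (\<lambda>j. \<nu> j + \<nu>' j) z = character \<nu> z * character \<nu>' z"
proof -
  define J where "J = {j. \<nu> j \<noteq> 0} \<union> {j. \<nu>' j \<noteq> 0}"
  have "finite J" using assms by (simp add: J_def Z0_def)
  then have "character \<nu> z = (\<Prod>j\<in>J. z j powi \<nu> j)" "character \<nu>' z = (\<Prod>j\<in>J. z j powi \<nu>' j)"
    "character (\<lambda>j. \<nu> j + \<nu>' j) z = (\<Prod>j\<in>J. z j powi (\<nu> j + \<nu>' j))"
    by (auto intro!: character_eq_prod simp: J_def)
  then show ?thesis using torus_nonzero[OF assms(3)] by (simp add: power_int_add prod.distrib)
qed

lemma character_mult:
  "character \<nu> (\<lambda>j. z j * w j) = character \<nu> z * character \<nu> w"
  by (simp add: character_def power_int_mult_distrib prod.distrib)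

lemma character_uminus:
  assumes "z \<in> torus"
  shows "character (\<lambda>j. - \<nu> j) z = cnj (character \<nu> z)"
proof -
  have "z j powi (- \<nu> j) = cnj (z j powi \<nu> j)" for j
  proof -
    have "inverse (z j) = cnj (z j)"
      using cmod_torus[OF assms, of j] by (simp add: inverse_complex_def complex_eq_iff cmod_def)
    then show ?thesis by (simp add: power_int_minus complex_cnj_power_int flip: power_int_inverse)
  qed
  then show ?thesis by (simp add: character_def)
qed

lemma character_cnj: "character \<nu> (\<lambda>j. cnj (z j)) = cnj (character \<nu> z)"
  by (simp add: character_def complex_cnj_power_int)

lemma character_zero [simp]: "character (\<lambda>j. 0) z = 1"
  by (simp add: character_def)

lemma character_single: "character (\<lambda>j. if j = i then k else 0) z = z i powi k"
  by (subst character_eq_prod[of "{i}"]) auto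

lemma norm_character: "z \<in> torus \<Longrightarrow> cmod (character \<nu> z) = 1"
  by (simp add: character_def prod_norm[symmetric] norm_power_int cmod_torus)

lemma continuous_on_character: "continuous_on torus (character \<nu>)"
  unfolding character_def
  by (intro continuous_on_prod continuous_on_power_int continuous_on_subset[OF continuous_on_product_coordinates])
     (auto dest: torus_nonzero)

lemma measurable_character: "character \<nu> \<in> borel_measurable torus_borel"
  unfolding torus_borel_def by (rule borel_measurable_continuous_on_restrict[OF continuous_on_character])

lemma weight_eq_sum:
  "finite J \<Longrightarrow> {j. \<nu> j \<noteq> 0} \<subseteq> J \<Longrightarrow> weight \<nu> = (\<Sum>j\<in>J. Suc j * nat \<bar>\<nu> j\<bar>)"
  unfolding weight_def by (rule sum.mono_neutral_left) auto

lemma weight_uminus: "weight (\<lambda>j. - \<nu> j) = weight \<nu>"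
  by (simp add: weight_def)

lemma weight_zero [simp]: "weight (\<lambda>j. 0) = 0"
  by (simp add: weight_def)

lemma haar_product: "product_prob_space (\<lambda>_::nat. circle_measure)"
  by (rule product_prob_spaceI) (rule prob_space_circle_measure)

interpretation haar: prob_space haar by (rule prob_space_haar)

lemma measurable_haar_cong: "measurable haar N = measurable torus_borel N"
  by (rule measurable_cong_sets[OF sets_haar refl])

lemma integral_circle_powi:
  "(LINT u|circle_measure. u powi k) = (if k = 0 then 1 else 0)"
proof (cases "k = 0")
  case True
  interpret prob_space circle_measure by (rule prob_space_circle_measure)
  show ?thesis using True prob_space by simp
next
  case False
  have m: "cis \<in> uniform_measure lborel {0..<2 * pi} \<rightarrow>\<^sub>M restrict_space borel (sphere 0 1)"
  proof (intro measurable_restrict_space2)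
    have "cis \<in> borel \<rightarrow>\<^sub>M borel" by (intro borel_measurable_continuous_onI continuous_intros)
    then show "cis \<in> borel_measurable (uniform_measure lborel {0..<2 * pi})" by simp
  qed simp
  have [measurable]: "(\<lambda>t. cis (of_int k * t)) \<in> borel_measurable borel"
    by (intro borel_measurable_continuous_onI continuous_intros)
  have m2: "(\<lambda>u. u powi k) \<in> borel_measurable (restrict_space borel (sphere (0::complex) 1))"
    by (rule borel_measurable_continuous_on_restrict) (auto intro!: continuous_intros)
  have "(LINT u|circle_measure. u powi k) = (LINT t|uniform_measure lborel {0..<2 * pi}. cis t powi k)"
    unfolding circle_measure_def by (rule integral_distr[OF m m2])
  also have "uniform_measure lborel {0..<2 * pi} = density lborel (\<lambda>t. ennreal (indicator {0..<2 * pi} t / (2 * pi)))"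
    unfolding uniform_measure_def
    by (intro density_cong) (auto simp: indicator_def divide_ennreal[symmetric] ennreal_1[symmetric] simp del: ennreal_1)
  also have "(LINT t|\<dots>. cis t powi k) = (LBINT t. (indicator {0..<2 * pi} t / (2 * pi)) *\<^sub>R cis (of_int k * t))"
    by (subst integral_density)
       (auto simp: cis_power_int)
  also have "\<dots> = (LBINT t. (indicator {0..2 * pi} t *\<^sub>R cis (of_int k * t)) / (2 * pi))"
  proof (rule integral_cong_AE)
    have "AE t in lborel. t \<noteq> 2 * pi" by (rule AE_lborel_singleton)
    then show "AE t in lborel. (indicator {0..<2 * pi} t / (2 * pi)) *\<^sub>R cis (of_int k * t) = (indicator {0..2 * pi} t *\<^sub>R cis (of_int k * t)) / (2 * pi)"
      by eventually_elim (auto simp: indicator_def scaleR_conv_of_real)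
  qed measurable
  also have "\<dots> = (LBINT t. indicator {0..2 * pi} t *\<^sub>R cis (of_int k * t)) / (2 * pi)" by simp
  also have "(LBINT t. indicator {0..2 * pi} t *\<^sub>R cis (of_int k * t)) = cis (of_int k * (2 * pi)) / (\<i> * of_int k) - cis (of_int k * 0) / (\<i> * of_int k)"
  proof (rule integral_FTC_Icc)
    show "((\<lambda>t. cis (of_int k * t) / (\<i> * of_int k)) has_vector_derivative cis (of_int k * t)) (at t within {0..2 * pi})" for t
      using has_vector_derivative_divide[OF cis_has_vector_derivative[of "of_int k" t "{0..2 * pi}"], of "\<i> * of_int k"] False by simp
  qed (auto intro!: continuous_intros)
  also have "cis (of_int k * (2 * pi)) = 1"
    by (simp add: complex_eq_iff mult.commute[of _ "2 * pi"] sin_int_2pin cos_int_2pin)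
  finally show ?thesis using False by simp
qed

text \<open>A character depends on finitely many coordinates only, so its integral is a finite product of
  integrals over circles.\<close>

lemma integral_haar_character:
  assumes \<nu>: "\<nu> \<in> Z0"
  shows "(LINT z|haar. character \<nu> z) = (if \<nu> = (\<lambda>j. 0) then 1 else 0)"
proof -
  interpret P: product_prob_space "\<lambda>_::nat. circle_measure" UNIV by (rule haar_product)
  define J where "J = {j. \<nu> j \<noteq> 0}"
  have J: "finite J" using \<nu> by (simp add: J_def Z0_def)
  have m1: "(\<lambda>u. u powi k) \<in> borel_measurable circle_measure" for k :: int
    unfolding measurable_cong_sets[OF sets_circle_measure refl]
    by (rule borel_measurable_continuous_on_restrict) (auto intro!: continuous_intros)
  have i1: "integrable circle_measure (\<lambda>u. u powi k)" for k :: int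
  proof -
    have "finite_measure circle_measure" using prob_space_circle_measure by (simp add: prob_space_def)
    then show ?thesis
      by (rule finite_measure.integrable_const_bound[where B = 1]) (auto intro!: AE_I2 simp: norm_power_int m1)
  qed
  have m3: "(\<lambda>x. x j powi k) \<in> borel_measurable (PiM J (\<lambda>_. circle_measure))" if "j \<in> J" for j and k :: int
    by (rule measurable_compose[OF measurable_component_singleton[OF that, of "\<lambda>_. circle_measure"] m1])
  have m4: "(\<lambda>z. restrict z J) \<in> PiM UNIV (\<lambda>_. circle_measure) \<rightarrow>\<^sub>M PiM J (\<lambda>_. circle_measure)"
    by (rule measurable_restrict_subset) simp
  have "(LINT z|haar. character \<nu> z) = (LINT z|haar. (\<lambda>x. \<Prod>j\<in>J. x j powi \<nu> j) (restrict z J))"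
    unfolding character_def J_def[symmetric] by (intro Bochner_Integration.integral_cong) auto
  also have "\<dots> = (LINT x|distr (PiM UNIV (\<lambda>_::nat. circle_measure)) (PiM J (\<lambda>_. circle_measure)) (\<lambda>z. restrict z J). (\<Prod>j\<in>J. x j powi \<nu> j))"
    unfolding haar_def
    by (rule integral_distr[symmetric, OF m4]) (intro borel_measurable_prod m3)
  also have "distr (PiM UNIV (\<lambda>_::nat. circle_measure)) (\<Pi>\<^sub>M j\<in>J. circle_measure) (\<lambda>z. restrict z J) = (\<Pi>\<^sub>M j\<in>J. circle_measure)"
    by (rule P.distr_PiM_restrict_finite) (use J in auto)
  also have "(LINT x|PiM J (\<lambda>_. circle_measure). (\<Prod>j\<in>J. x j powi \<nu> j)) = (\<Prod>j\<in>J. LINT u|circle_measure. u powi \<nu> j)"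
    by (rule P.product_integral_prod[OF J i1])
  also have "\<dots> = (\<Prod>j\<in>J. 0)"
    by (intro prod.cong) (auto simp: integral_circle_powi J_def)
  also have "\<dots> = (if J = {} then 1 else 0)" using J by (auto simp: card_eq_0_iff)
  also have "J = {} \<longleftrightarrow> \<nu> = (\<lambda>j. 0)" by (auto simp: J_def)
  finally show ?thesis .
qed

section \<open>The Poisson kernel of the infinite torus\<close>

text \<open>Sums over these boxes factor into one-dimensional sums; they exhaust \<^const>\<open>Z0\<close>.\<close>

definition Z0_below :: "nat \<Rightarrow> (nat \<Rightarrow> int) set" where
  "Z0_below n = {\<nu>. \<forall>j\<ge>n. \<nu> j = 0}"

lemma Z0_below_subset_Z0: "Z0_below n \<subseteq> Z0"
proof
  fix \<nu> assume "\<nu> \<in> Z0_below n"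
  then have "{j. \<nu> j \<noteq> 0} \<subseteq> {..<n}" by (auto simp: Z0_below_def not_le[symmetric])
  then show "\<nu> \<in> Z0" unfolding Z0_def using finite_subset by blast
qed

lemma finite_subset_Z0_below:
  assumes "finite F" "F \<subseteq> Z0"
  obtains n where "F \<subseteq> Z0_below n"
proof -
  have "finite (\<Union>\<nu>\<in>F. {j. \<nu> j \<noteq> 0})" using assms by (auto simp: Z0_def)
  then obtain n where "\<And>j. j \<in> (\<Union>\<nu>\<in>F. {j. \<nu> j \<noteq> 0}) \<Longrightarrow> j < n" 
    by (metis finite_nat_set_iff_bounded)
  then show ?thesis by (intro that[of n]) (fastforce simp: Z0_below_def)
qed

lemma poisson_has_sum:
  assumes \<rho>: "0 \<le> \<rho>" "\<rho> < 1"
  shows "((\<lambda>k::int. of_real \<rho> ^ nat \<bar>k\<bar> * cis t powi k) has_sum of_real (poisson \<rho> t)) UNIV"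
    and "(\<lambda>k::int. cmod (of_real \<rho> ^ nat \<bar>k\<bar> * cis t powi k)) summable_on UNIV"
proof -
  let ?f = "\<lambda>k::int. complex_of_real \<rho> ^ nat \<bar>k\<bar> * cis t powi k"
  define S where "S t = (\<Sum>n. (complex_of_real \<rho> * cis t) ^ n)" for t
  have sm: "summable (\<lambda>n. norm ((complex_of_real \<rho> * cis t) ^ n))" for t
    using \<rho> by (auto simp: norm_power norm_mult intro!: summable_geometric)
  have g: "((\<lambda>n. (of_real \<rho> * cis t) ^ n) has_sum S t) UNIV" for t
    unfolding S_def by (rule norm_summable_imp_has_sum[OF sm summable_sums[OF summable_norm_cancel[OF sm]]])
  have A: "(?f has_sum S t) (range int)"
  proof -
    have "?f \<circ> int = (\<lambda>n. (of_real \<rho> * cis t) ^ n)" by (auto simp: fun_eq_iff power_mult_distrib)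
    then show ?thesis using g[of t] by (subst has_sum_reindex) simp_all
  qed
  have B: "(?f has_sum (S (-t) - 1)) (range (\<lambda>n. - int (Suc n)))"
  proof -
    have "?f (- int (Suc n)) = (of_real \<rho> * cis (- t)) ^ Suc n" for n
    proof -
      have "cis t powi (- int (Suc n)) = cis (- t) ^ Suc n"
        by (simp only: power_int_minus power_int_of_nat power_inverse[symmetric] cis_inverse)
      then show ?thesis by (simp only: power_mult_distrib abs_minus_cancel abs_of_nat nat_int)
    qed
    then have eq: "?f \<circ> (\<lambda>n. - int (Suc n)) = (\<lambda>n. (of_real \<rho> * cis (- t)) ^ Suc n)"
      by (simp only: fun_eq_iff o_def) simp
    have "((\<lambda>n. (of_real \<rho> * cis (- t)) ^ Suc n) has_sum (S (-t) - 1)) UNIV"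
    proof (rule norm_summable_imp_has_sum)
      show "summable (\<lambda>n. norm ((complex_of_real \<rho> * cis (- t)) ^ Suc n))"
        using sm[of "-t"] by (subst summable_Suc_iff)
      show "(\<lambda>n. (complex_of_real \<rho> * cis (- t)) ^ Suc n) sums (S (-t) - 1)"
        using summable_sums[OF summable_norm_cancel[OF sm[of "-t"]]] unfolding S_def
        by (subst sums_Suc_iff) simp
    qed
    then show ?thesis unfolding eq[symmetric] by (subst has_sum_reindex) (auto simp: inj_on_def)
  qed
  have "range int \<inter> range (\<lambda>n. - int (Suc n)) = {}" by auto
  from has_sum_Un_disjoint[OF A B this]
  have "(?f has_sum of_real (poisson \<rho> t)) (range int \<union> range (\<lambda>n. - int (Suc n)))"
    by (simp add: poisson_eq_geometric[OF \<rho>] S_def algebra_simps)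
  moreover have "range int \<union> range (\<lambda>n. - int (Suc n)) = UNIV"
  proof (rule set_eqI)
    fix k :: int
    show "k \<in> range int \<union> range (\<lambda>n. - int (Suc n)) \<longleftrightarrow> k \<in> UNIV"
      by (cases k rule: int_cases) auto
  qed
  ultimately show "(?f has_sum of_real (poisson \<rho> t)) UNIV" by simp
  then show "(\<lambda>k. cmod (?f k)) summable_on UNIV"
    by (metis has_sum_imp_summable summable_on_iff_abs_summable_on_complex)
qed

text \<open>Both the power of \<open>r\<close> and the character are products over the coordinates.\<close>

lemma box_infsum:
  assumes r: "0 \<le> r" "r < 1" and u: "u \<in> torus"
  shows "(\<Sum>\<^sub>\<infinity>\<nu>\<in>Z0_below n. of_real r ^ weight \<nu> * character \<nu> u) = of_real (\<Prod>j<n. poisson (r ^ Suc j) (Arg (u j)))"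
proof -
  have u': "u j = cis (Arg (u j))" for j
    using cmod_torus[OF u, of j] rcis_cmod_Arg[of "u j"] by (simp add: rcis_def)
  have rj: "0 \<le> r ^ Suc j" "r ^ Suc j < 1" for j using r by (auto simp: power_less_one_iff simp del: power_Suc)
  define f where "f j k = of_real (r ^ Suc j) ^ nat \<bar>k\<bar> * cis (Arg (u j)) powi k" for j and k :: int
  have bij: "bij_betw (\<lambda>\<nu>. restrict \<nu> {..<n}) (Z0_below n) (PiE {..<n} (\<lambda>_. UNIV))"
    by (rule bij_betwI[where g = "\<lambda>g j. if j < n then g j else 0"])
       (auto simp: Z0_below_def fun_eq_iff restrict_def PiE_def extensional_def)
  have "of_real r ^ weight \<nu> * character \<nu> u = (\<Prod>j<n. f j (restrict \<nu> {..<n} j))" if \<nu>: "\<nu> \<in> Z0_below n" for \<nu>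
  proof -
    have s: "{j. \<nu> j \<noteq> 0} \<subseteq> {..<n}" using \<nu> by (auto simp: Z0_below_def not_le[symmetric])
    have "(\<Prod>j<n. f j (restrict \<nu> {..<n} j)) = (\<Prod>j<n. of_real r ^ (Suc j * nat \<bar>\<nu> j\<bar>) * u j powi \<nu> j)"
      by (intro prod.cong refl) (simp add: f_def u'[symmetric] power_mult[symmetric] del: power_Suc mult_Suc)
    then show ?thesis
      by (simp add: weight_eq_sum[OF _ s] character_eq_prod[OF _ s] prod.distrib power_sum)
  qed
  then have "(\<Sum>\<^sub>\<infinity>\<nu>\<in>Z0_below n. of_real r ^ weight \<nu> * character \<nu> u) =
      (\<Sum>\<^sub>\<infinity>\<nu>\<in>Z0_below n. (\<Prod>j<n. f j (restrict \<nu> {..<n} j)))"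
    by (rule infsum_cong)
  also have "\<dots> = (\<Sum>\<^sub>\<infinity>g\<in>PiE {..<n} (\<lambda>_. UNIV). \<Prod>j<n. f j (g j))"
    by (rule infsum_reindex_bij_betw[OF bij])
  also have "\<dots> = (\<Prod>j<n. \<Sum>\<^sub>\<infinity>k. f j k)"
    unfolding f_def by (rule infsum_prod_PiE_abs) (use poisson_has_sum(2)[OF rj] in auto)
  also have "\<dots> = (\<Prod>j<n. of_real (poisson (r ^ Suc j) (Arg (u j))))"
    unfolding f_def by (intro prod.cong refl infsumI poisson_has_sum(1)[OF rj])
  finally show ?thesis by simp
qed

lemma poisson_pos: "0 \<le> r \<Longrightarrow> r < 1 \<Longrightarrow> 0 < poisson r t"
  unfolding poisson_def using poisson_denom_pos[of r t]
  by (intro divide_pos_pos) (auto simp: power_less_one_iff abs_square_less_1)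

text \<open>By \<open>box_infsum\<close> at the point 1, the sum over a box is a product of factors $(1+x)/(1-x)$ with
  $x = r^{j+1}$; these products are bounded because the powers of $r$ are summable.\<close>

lemma summable_weight:
  fixes r :: real
  assumes r: "0 \<le> r" "r < 1"
  shows "(\<lambda>\<nu>. r ^ weight \<nu>) summable_on Z0"
proof (rule nonneg_bdd_above_summable_on)
  show "bdd_above (sum (\<lambda>\<nu>. r ^ weight \<nu>) ` {F. F \<subseteq> Z0 \<and> finite F})"
  proof (rule bdd_aboveI)
    fix x assume "x \<in> sum (\<lambda>\<nu>. r ^ weight \<nu>) ` {F. F \<subseteq> Z0 \<and> finite F}"
    then obtain F where F: "F \<subseteq> Z0" "finite F" "x = (\<Sum>\<nu>\<in>F. r ^ weight \<nu>)" by auto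
    obtain n where n: "F \<subseteq> Z0_below n" using finite_subset_Z0_below[OF F(2,1)] .
    have rj: "0 \<le> r ^ Suc j" "r ^ Suc j < 1" for j using r by (auto simp: power_less_one_iff simp del: power_Suc)
    have one: "(\<lambda>j. 1) \<in> torus" by (simp add: torus_def)
    have [simp]: "character \<nu> (\<lambda>j. 1) = 1" for \<nu> by (simp add: character_def)
    define p where "p = (\<Prod>j<n. poisson (r ^ Suc j) 0)"
    have p: "(\<Sum>\<^sub>\<infinity>\<nu>\<in>Z0_below n. complex_of_real (r ^ weight \<nu>)) = of_real p"
      using box_infsum[OF r one, of n] by (simp add: p_def Arg_of_real del: power_Suc)
    have "0 < p" unfolding p_def by (intro prod_pos) (use poisson_pos rj in auto)
    then have "(\<lambda>\<nu>. complex_of_real (r ^ weight \<nu>)) summable_on Z0_below n"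
      using p infsum_not_exists by force
    then have hs: "((\<lambda>\<nu>. complex_of_real (r ^ weight \<nu>)) has_sum of_real p) (Z0_below n)"
      using p has_sum_infsum by metis
    then have "((\<lambda>\<nu>. r ^ weight \<nu>) has_sum p) (Z0_below n)"
      by (subst (asm) has_sum_of_real_iff)
    then have "x \<le> p" unfolding F(3) using F(2) n r by (intro finite_sum_le_has_sum) auto
    also have "p \<le> (\<Prod>j<n. exp (2 * r ^ Suc j / (1 - r)))"
      unfolding p_def
    proof (rule prod_mono, intro conjI)
      fix j
      let ?x = "r ^ Suc j"
      have "?x \<le> r" using r by (simp add: mult_left_le power_le_one)
      have "poisson ?x 0 = (1 + ?x) / (1 - ?x)"
      proof -
        have "poisson ?x 0 = ((1 + ?x) * (1 - ?x)) / ((1 - ?x) * (1 - ?x))"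
          by (simp add: poisson_def power2_eq_square algebra_simps del: power_Suc)
        then show ?thesis using rj(2)[of j] by (simp del: power_Suc)
      qed
      also have "\<dots> = 1 + 2 * ?x / (1 - ?x)" using rj(2)[of j] by (simp add: divide_simps del: power_Suc)
      also have "\<dots> \<le> 1 + 2 * ?x / (1 - r)"
        using \<open>?x \<le> r\<close> r rj by (intro add_left_mono divide_left_mono) (auto intro!: mult_pos_pos simp del: power_Suc)
      also have "\<dots> \<le> exp (2 * ?x / (1 - r))" by (rule exp_ge_add_one_self)
      finally show "poisson ?x 0 \<le> exp (2 * ?x / (1 - r))" .
      show "0 \<le> poisson ?x 0" using poisson_pos[OF rj] less_imp_le by blast
    qed
    also have "\<dots> = exp ((\<Sum>j<n. r ^ Suc j) * (2 / (1 - r)))"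
    proof -
      have "(\<Sum>j<n. 2 * r ^ Suc j / (1 - r)) = (\<Sum>j<n. r ^ Suc j) * (2 / (1 - r))"
        unfolding sum_distrib_right by (intro sum.cong refl) (simp add: mult_ac)
      then show ?thesis by (simp only: exp_sum[OF finite_lessThan, symmetric])
    qed
    also have "(\<Sum>j<n. r ^ Suc j) \<le> r * (1 / (1 - r))"
    proof -
      have "(\<Sum>j<n. r ^ j) \<le> (\<Sum>j. r ^ j)" using r by (intro sum_le_suminf summable_geometric) auto
      also have "\<dots> = 1 / (1 - r)" using r by (intro suminf_geometric) auto
      finally show ?thesis using r by (simp add: sum_distrib_left[symmetric] mult_left_mono del: times_divide_eq_right)
    qed
    finally show "x \<le> exp (r * (1 / (1 - r)) * (2 / (1 - r)))"
      using r by (simp add: mult_right_mono del: times_divide_eq_right times_divide_eq_left)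
  qed
qed (use r in auto)

lemma summable_character_series:
  assumes r: "0 \<le> r" "r < 1" and c: "\<And>\<nu>. \<nu> \<in> S \<Longrightarrow> cmod (c \<nu>) \<le> C" and S: "S \<subseteq> Z0"
  shows "(\<lambda>\<nu>. c \<nu> * of_real r ^ weight \<nu>) summable_on S"
proof -
  have "(\<lambda>\<nu>. C * r ^ weight \<nu>) summable_on S"
    by (intro summable_on_cmult_right summable_on_subset_banach[OF summable_weight[OF r] S])
  then have "(\<lambda>\<nu>. norm (c \<nu> * of_real r ^ weight \<nu>)) summable_on S"
    by (rule summable_on_comparison_test) (use c r in \<open>auto simp: norm_mult norm_power intro!: mult_right_mono\<close>)
  then show ?thesis by (rule abs_summable_summable)
qed

definition torus_kernel :: "real \<Rightarrow> (nat \<Rightarrow> complex) \<Rightarrow> complex" where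
  "torus_kernel r u = (\<Sum>\<^sub>\<infinity>\<nu>\<in>Z0. of_real r ^ weight \<nu> * character \<nu> u)"

text \<open>The kernel is the limit of its sums over boxes, and these are products of one-dimensional Poisson
  kernels.\<close>

lemma torus_kernel_nonneg:
  assumes r: "0 \<le> r" "r < 1" and u: "u \<in> torus"
  shows "torus_kernel r u = of_real (Re (torus_kernel r u))" and "0 \<le> Re (torus_kernel r u)"
proof -
  let ?f = "\<lambda>\<nu>. of_real r ^ weight \<nu> * character \<nu> u"
  have sm: "?f summable_on S" if "S \<subseteq> Z0" for S
    using summable_character_series[OF r, of S "\<lambda>\<nu>. character \<nu> u" 1] that norm_character[OF u] by (simp add: mult.commute)
  have ex: "\<exists>p\<ge>0. cmod (torus_kernel r u - of_real p) < e" if e: "0 < e" for e :: real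
  proof -
    define near where "near S F \<longleftrightarrow> (\<forall>G. finite G \<and> F \<subseteq> G \<and> G \<subseteq> S \<longrightarrow> dist (sum ?f G) (infsum ?f S) < e / 2)" for S F
    have H: "\<exists>F. finite F \<and> F \<subseteq> S \<and> near S F" if "S \<subseteq> Z0" for S
    proof -
      have "(?f has_sum infsum ?f S) S" using sm[OF that] by simp
      then have "\<forall>\<^sub>F G in finite_subsets_at_top S. dist (sum ?f G) (infsum ?f S) < e / 2"
        unfolding has_sum_def by (rule tendstoD) (use e in simp)
      then show ?thesis unfolding eventually_finite_subsets_at_top near_def .
    qed
    obtain F where F: "finite F" "F \<subseteq> Z0" "near Z0 F" using H[OF subset_refl] by blast
    obtain n where n: "F \<subseteq> Z0_below n" using finite_subset_Z0_below[OF F(1,2)] .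
    obtain F' where F': "finite F'" "F' \<subseteq> Z0_below n" "near (Z0_below n) F'"
      using H[OF Z0_below_subset_Z0[of n]] by blast
    have "dist (sum ?f (F \<union> F')) (torus_kernel r u) < e / 2"
      unfolding torus_kernel_def
      by (rule F(3)[unfolded near_def, rule_format]) (use F F' Z0_below_subset_Z0[of n] in auto)
    moreover have "dist (sum ?f (F \<union> F')) (infsum ?f (Z0_below n)) < e / 2"
      by (rule F'(3)[unfolded near_def, rule_format]) (use F F' n in auto)
    ultimately have "dist (torus_kernel r u) (infsum ?f (Z0_below n)) < e"
      by (rule dist_triangle_half_r)
    moreover have "0 \<le> (\<Prod>j<n. poisson (r ^ Suc j) (Arg (u j)))"
      using r by (intro prod_nonneg poisson_nonneg ballI) (auto simp: power_less_one_iff simp del: power_Suc)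
    ultimately show ?thesis unfolding box_infsum[OF r u] dist_norm by blast
  qed
  have "\<bar>Im (torus_kernel r u)\<bar> \<le> e" if e: "0 < e" for e
  proof -
    obtain p where p: "cmod (torus_kernel r u - of_real p) < e" using ex[OF e] by blast
    show ?thesis using abs_Im_le_cmod[of "torus_kernel r u - of_real p"] p by simp
  qed
  then have "\<bar>Im (torus_kernel r u)\<bar> \<le> 0" by (rule dense_ge)
  then show "torus_kernel r u = of_real (Re (torus_kernel r u))" by (simp add: complex_eq_iff)
  have "- Re (torus_kernel r u) \<le> e" if e: "0 < e" for e
  proof -
    obtain p where p: "0 \<le> p" "cmod (torus_kernel r u - of_real p) < e" using ex[OF e] by blast
    show ?thesis using abs_Re_le_cmod[of "torus_kernel r u - of_real p"] p by simp
  qed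
  then have "- Re (torus_kernel r u) \<le> 0" by (meson dense_ge)
  then show "0 \<le> Re (torus_kernel r u)" by simp
qed

section \<open>Poisson integrals of measures on the torus\<close>

text \<open>The form of \<open>sums_integral_dominated\<close> for sums over a countable index set.\<close>

lemma has_sum_integral_dominated:
  fixes h :: "'a \<Rightarrow> complex" and g :: "'i \<Rightarrow> 'a \<Rightarrow> complex"
  assumes I: "countable I" "infinite I" and h: "integrable M h"
    and g: "\<And>i. i \<in> I \<Longrightarrow> g i \<in> borel_measurable M"
    and bd: "\<And>i x. i \<in> I \<Longrightarrow> x \<in> space M \<Longrightarrow> cmod (g i x) \<le> b i"
    and b: "b summable_on I" "\<And>i. i \<in> I \<Longrightarrow> 0 \<le> b i"
  shows "((\<lambda>i. LINT x|M. h x * g i x) has_sum (LINT x|M. h x * (\<Sum>\<^sub>\<infinity>i\<in>I. g i x))) I"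
    and "integrable M (\<lambda>x. h x * (\<Sum>\<^sub>\<infinity>i\<in>I. g i x))"
    and "(\<lambda>x. \<Sum>\<^sub>\<infinity>i\<in>I. g i x) \<in> borel_measurable M"
proof -
  define e where "e = from_nat_into I"
  have e: "bij_betw e UNIV I" unfolding e_def by (rule bij_betw_from_nat_into[OF I])
  have eI: "e n \<in> I" for n using e by (auto simp: bij_betw_def)
  have be: "summable (\<lambda>n. b (e n))"
    using b eI summable_on_reindex_bij_betw[OF e, of b] by (simp add: summable_on_UNIV_nonneg_real_iff)
  have g_eq: "(\<Sum>\<^sub>\<infinity>i\<in>I. g i x) = (\<Sum>n. g (e n) x)" if x: "x \<in> space M" for x
  proof -
    have sm: "summable (\<lambda>n. cmod (g (e n) x))"
      by (rule summable_comparison_test[OF _ be]) (use bd[OF eI x] in auto)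
    have "((\<lambda>n. g (e n) x) has_sum (\<Sum>n. g (e n) x)) UNIV"
      by (rule norm_summable_imp_has_sum[OF sm summable_sums[OF summable_norm_cancel[OF sm]]])
    then have "((\<lambda>i. g i x) has_sum (\<Sum>n. g (e n) x)) I"
      using has_sum_reindex_bij_betw[OF e, of "\<lambda>i. g i x"] by simp
    then show ?thesis by (rule infsumI)
  qed
  note S = sums_integral_dominated[OF h, of "\<lambda>n. g (e n)" "\<lambda>n. b (e n)", OF g[OF eI] bd[OF eI] be]
  show "integrable M (\<lambda>x. h x * (\<Sum>\<^sub>\<infinity>i\<in>I. g i x))"
    using S(2) by (simp add: g_eq cong: Bochner_Integration.integrable_cong)
  show "(\<lambda>x. \<Sum>\<^sub>\<infinity>i\<in>I. g i x) \<in> borel_measurable M"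
    using borel_measurable_suminf[of "\<lambda>n. g (e n)" M, OF g[OF eI]] by (simp add: g_eq cong: measurable_cong)
  have "summable (\<lambda>n. cmod (LINT x|M. h x * g (e n) x))"
  proof (rule summable_comparison_test[OF _ summable_mult2[OF be, of "LINT x|M. norm (h x)"]], intro exI allI impI)
    fix n
    have [measurable]: "g (e n) \<in> borel_measurable M" "h \<in> borel_measurable M" using g[OF eI] h by auto
    have pt: "norm (h x * g (e n) x) \<le> b (e n) * norm (h x)" if "x \<in> space M" for x
      using mult_right_mono[OF bd[OF eI that], of "norm (h x)" n] by (simp add: norm_mult mult.commute)
    have i1: "integrable M (\<lambda>x. b (e n) * norm (h x))" using h by simp
    have "integrable M (\<lambda>x. h x * g (e n) x)"
      by (rule Bochner_Integration.integrable_bound[OF i1]) (use pt b(2)[OF eI] in \<open>auto simp: abs_mult\<close>)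
    then have "norm (LINT x|M. h x * g (e n) x) \<le> (LINT x|M. b (e n) * norm (h x))"
      by (intro order.trans[OF integral_norm_bound] integral_mono integrable_norm i1 pt)
    then show "norm (cmod (LINT x|M. h x * g (e n) x)) \<le> b (e n) * (LINT x|M. norm (h x))" by simp
  qed
  from norm_summable_imp_has_sum[OF this S(1)]
  have "((\<lambda>n. LINT x|M. h x * g (e n) x) has_sum (LINT x|M. h x * (\<Sum>n. g (e n) x))) UNIV" .
  then show "((\<lambda>i. LINT x|M. h x * g i x) has_sum (LINT x|M. h x * (\<Sum>\<^sub>\<infinity>i\<in>I. g i x))) I"
    using has_sum_reindex_bij_betw[OF e, of "\<lambda>i. LINT x|M. h x * g i x"]
    by (simp add: g_eq cong: Bochner_Integration.integral_cong)
qed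

lemma countable_Z0: "countable Z0"
proof -
  have "Z0 \<subseteq> range (\<lambda>xs::int list. \<lambda>j. if j < length xs then xs ! j else 0)"
  proof
    fix \<nu> :: "nat \<Rightarrow> int" assume "\<nu> \<in> Z0"
    then obtain n where n: "\<And>j. \<nu> j \<noteq> 0 \<Longrightarrow> j < n"
      unfolding Z0_def by (auto simp: finite_nat_set_iff_bounded)
    have "\<nu> = (\<lambda>j. if j < length (map \<nu> [0..<n]) then map \<nu> [0..<n] ! j else 0)"
      using n by (auto simp: fun_eq_iff)
    then show "\<nu> \<in> range (\<lambda>xs::int list. \<lambda>j. if j < length xs then xs ! j else 0)" by blast
  qed
  then show ?thesis by (rule countable_subset) simp
qed

lemma infinite_Z0: "infinite Z0"
proof
  assume "finite Z0"
  moreover have "(\<lambda>k j. if j = 0 then k else 0) ` (UNIV :: int set) \<subseteq> Z0" using Z0_single by auto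
  moreover have "inj (\<lambda>k j. if j = (0::nat) then k else (0::int))" by (auto simp: inj_def fun_eq_iff split: if_splits)
  ultimately show False
    using finite_imageD finite_subset infinite_UNIV_int by blast
qed

text \<open>The convolution of the complex measure \<open>h dM\<close> with the kernel \<open>torus_kernel r\<close>. The density \<open>h\<close> allows
  the same function to serve for \<open>f dm\<close>, for the four parts of a complex measure and for the measure
  \<open>|h| dM\<close> that dominates them.\<close>

definition torus_poisson ::
    "(nat \<Rightarrow> complex) measure \<Rightarrow> ((nat \<Rightarrow> complex) \<Rightarrow> complex) \<Rightarrow> real \<Rightarrow> (nat \<Rightarrow> complex) \<Rightarrow> complex" where
  "torus_poisson M h r z =
     (\<Sum>\<^sub>\<infinity>\<nu>\<in>Z0. (LINT y|M. h y * cnj (character \<nu> y)) * of_real r ^ weight \<nu> * character \<nu> z)"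

lemma space_eq_torus: "sets M = sets torus_borel \<Longrightarrow> space M = torus"
  by (metis space_torus_borel sets_eq_imp_space_eq)

lemma measurable_character_cong: "sets M = sets torus_borel \<Longrightarrow> character \<nu> \<in> borel_measurable M"
  using measurable_cong_sets measurable_character by blast

context
  fixes M :: "(nat \<Rightarrow> complex) measure" and h :: "(nat \<Rightarrow> complex) \<Rightarrow> complex" and r :: real
  assumes M: "sets M = sets torus_borel" and h: "integrable M h" and r: "0 \<le> r" "r < 1"
begin

lemma integrable_times_character: "integrable M (\<lambda>y. h y * cnj (character \<nu> y))"
proof (rule Bochner_Integration.integrable_bound[OF integrable_norm[OF h]])
  have [measurable]: "character \<nu> \<in> borel_measurable M" "h \<in> borel_measurable M"
    using measurable_character_cong[OF M] h by auto
  show "(\<lambda>y. h y * cnj (character \<nu> y)) \<in> borel_measurable M" by measurable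
qed (rule AE_I2, simp add: norm_mult norm_character space_eq_torus[OF M])

lemma norm_coefficient_le: "cmod (LINT y|M. h y * cnj (character \<nu> y)) \<le> (LINT y|M. cmod (h y))"
proof -
  have "cmod (LINT y|M. h y * cnj (character \<nu> y)) \<le> (LINT y|M. cmod (h y * cnj (character \<nu> y)))"
    by (rule integral_norm_bound)
  also have "\<dots> = (LINT y|M. cmod (h y))"
    by (rule Bochner_Integration.integral_cong) (simp_all add: norm_mult norm_character space_eq_torus[OF M])
  finally show ?thesis .
qed

lemma torus_poisson_summable:
  assumes z: "z \<in> torus"
  shows "(\<lambda>\<nu>. (LINT y|M. h y * cnj (character \<nu> y)) * of_real r ^ weight \<nu> * character \<nu> z) summable_on Z0"
proof -
  have "(\<lambda>\<nu>. ((LINT y|M. h y * cnj (character \<nu> y)) * character \<nu> z) * of_real r ^ weight \<nu>) summable_on Z0"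
    by (rule summable_character_series[OF r, of _ _ "LINT y|M. cmod (h y)"])
       (auto simp: norm_mult norm_character z norm_coefficient_le)
  then show ?thesis by (simp add: mult_ac)
qed

lemma torus_poisson_kernel:
  assumes z: "z \<in> torus"
  shows "torus_poisson M h r z = (LINT y|M. h y * torus_kernel r (\<lambda>j. z j * cnj (y j)))"
    and "integrable M (\<lambda>y. h y * torus_kernel r (\<lambda>j. z j * cnj (y j)))"
proof -
  define g where "g \<nu> y = of_real r ^ weight \<nu> * character \<nu> (\<lambda>j. z j * cnj (y j))" for \<nu> y
  have g: "g \<nu> y = (of_real r ^ weight \<nu> * character \<nu> z) * cnj (character \<nu> y)" for \<nu> y
    by (simp add: g_def character_mult character_cnj)
  have gm: "g \<nu> \<in> borel_measurable M" for \<nu>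
    unfolding g[abs_def] using measurable_character_cong[OF M, of \<nu>] by measurable
  have gb: "cmod (g \<nu> y) \<le> r ^ weight \<nu>" if "y \<in> space M" for \<nu> y
    using that r by (simp add: g norm_mult norm_power norm_character z space_eq_torus[OF M])
  note S = has_sum_integral_dominated[OF countable_Z0 infinite_Z0 h, of g, OF gm gb summable_weight[OF r]]
  have "(LINT y|M. h y * g \<nu> y) = (LINT y|M. h y * cnj (character \<nu> y)) * of_real r ^ weight \<nu> * character \<nu> z" for \<nu>
  proof -
    have "(LINT y|M. h y * g \<nu> y) = (LINT y|M. (h y * cnj (character \<nu> y)) * (of_real r ^ weight \<nu> * character \<nu> z))"
      by (simp add: g mult_ac)
    also have "\<dots> = (LINT y|M. h y * cnj (character \<nu> y)) * (of_real r ^ weight \<nu> * character \<nu> z)"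
      by (rule integral_mult_left_zero)
    finally show ?thesis by (simp only: mult.assoc)
  qed
  then show "torus_poisson M h r z = (LINT y|M. h y * torus_kernel r (\<lambda>j. z j * cnj (y j)))"
    using infsumI[OF S(1)] r by (simp add: torus_poisson_def torus_kernel_def g_def)
  show "integrable M (\<lambda>y. h y * torus_kernel r (\<lambda>j. z j * cnj (y j)))"
    using S(2) r by (simp add: torus_kernel_def g_def)
qed

lemma integrable_torus_poisson_times:
  assumes q: "integrable haar q"
  shows "integrable haar (\<lambda>z. q z * torus_poisson M h r z)"
    and "((\<lambda>\<nu>. (LINT y|M. h y * cnj (character \<nu> y)) * of_real r ^ weight \<nu> * (LINT z|haar. q z * character \<nu> z))
      has_sum (LINT z|haar. q z * torus_poisson M h r z)) Z0"
    and "torus_poisson M h r \<in> borel_measurable haar"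
proof -
  define g where "g \<nu> z = (LINT y|M. h y * cnj (character \<nu> y)) * of_real r ^ weight \<nu> * character \<nu> z" for \<nu> z
  define b where "b \<nu> = (LINT y|M. cmod (h y)) * r ^ weight \<nu>" for \<nu>
  have b: "b summable_on Z0" unfolding b_def by (intro summable_on_cmult_right summable_weight r)
  have b0: "0 \<le> b \<nu>" for \<nu> using r by (simp add: b_def)
  have gm: "g \<nu> \<in> borel_measurable haar" for \<nu>
    unfolding g_def measurable_haar_cong using measurable_character[of \<nu>] by measurable
  have gb: "cmod (g \<nu> z) \<le> b \<nu>" if "z \<in> space haar" for \<nu> z
    using that r norm_coefficient_le[of \<nu>]
    by (simp add: g_def b_def norm_mult norm_power norm_character space_haar mult_right_mono)
  note S = has_sum_integral_dominated[OF countable_Z0 infinite_Z0 q, of g, OF gm gb b b0]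
  have P: "(\<Sum>\<^sub>\<infinity>\<nu>\<in>Z0. g \<nu> z) = torus_poisson M h r z" for z
    by (simp add: torus_poisson_def g_def)
  have "(LINT z|haar. q z * g \<nu> z) = (LINT y|M. h y * cnj (character \<nu> y)) * of_real r ^ weight \<nu> * (LINT z|haar. q z * character \<nu> z)" for \<nu>
  proof -
    have "(LINT z|haar. q z * g \<nu> z) = (LINT z|haar. ((LINT y|M. h y * cnj (character \<nu> y)) * of_real r ^ weight \<nu>) * (q z * character \<nu> z))"
      by (simp add: g_def mult_ac)
    then show ?thesis by (simp only: integral_mult_right_zero)
  qed
  then show "((\<lambda>\<nu>. (LINT y|M. h y * cnj (character \<nu> y)) * of_real r ^ weight \<nu> * (LINT z|haar. q z * character \<nu> z))
      has_sum (LINT z|haar. q z * torus_poisson M h r z)) Z0"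
    using S(1) unfolding P by simp
  show "integrable haar (\<lambda>z. q z * torus_poisson M h r z)" using S(2) unfolding P .
  show "torus_poisson M h r \<in> borel_measurable haar" using S(3) unfolding P .
qed

lemma integrable_torus_poisson: "integrable haar (torus_poisson M h r)"
  using integrable_torus_poisson_times(1)[of "\<lambda>_. 1"] by simp

end

lemma torus_quotient: "z \<in> torus \<Longrightarrow> y \<in> torus \<Longrightarrow> (\<lambda>j. z j * cnj (y j)) \<in> torus"
  by (simp add: torus_def norm_mult)

text \<open>Positivity of the kernel bounds the modulus of the convolution by the convolution with the modulus.\<close>

lemma torus_poisson_abs:
  assumes M: "sets M = sets torus_borel" and h: "integrable M h" and r: "0 \<le> r" "r < 1" and z: "z \<in> torus"
  shows "torus_poisson M (\<lambda>y. of_real (cmod (h y))) r z = of_real (Re (torus_poisson M (\<lambda>y. of_real (cmod (h y))) r z))"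
    and "cmod (torus_poisson M h r z) \<le> Re (torus_poisson M (\<lambda>y. of_real (cmod (h y))) r z)"
proof -
  have h': "integrable M (\<lambda>y. complex_of_real (cmod (h y)))" using h by simp
  define K where "K y = Re (torus_kernel r (\<lambda>j. z j * cnj (y j)))" for y
  have K: "torus_kernel r (\<lambda>j. z j * cnj (y j)) = of_real (K y)" "0 \<le> K y" if "y \<in> space M" for y
    using torus_kernel_nonneg[OF r torus_quotient[OF z, of y]] that space_eq_torus[OF M] by (auto simp: K_def)
  have eq: "torus_poisson M (\<lambda>y. of_real (cmod (h y))) r z = (LINT y|M. of_real (cmod (h y) * K y))"
    unfolding torus_poisson_kernel(1)[OF M h' r z]
    by (intro Bochner_Integration.integral_cong) (simp_all add: K)
  have i: "integrable M (\<lambda>y. complex_of_real (cmod (h y) * K y))"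
    using torus_poisson_kernel(2)[OF M h' r z] by (simp add: K cong: Bochner_Integration.integrable_cong)
  show "torus_poisson M (\<lambda>y. of_real (cmod (h y))) r z = of_real (Re (torus_poisson M (\<lambda>y. of_real (cmod (h y))) r z))"
    unfolding eq integral_complex_of_real by simp
  have "cmod (torus_poisson M h r z) \<le> (LINT y|M. cmod (h y * torus_kernel r (\<lambda>j. z j * cnj (y j))))"
    unfolding torus_poisson_kernel(1)[OF M h r z] by (rule integral_norm_bound)
  also have "\<dots> = (LINT y|M. cmod (h y) * K y)"
    by (intro Bochner_Integration.integral_cong) (simp_all add: K norm_mult)
  also have "\<dots> = Re (torus_poisson M (\<lambda>y. of_real (cmod (h y))) r z)"
    unfolding eq integral_complex_of_real by simp
  finally show "cmod (torus_poisson M h r z) \<le> Re (torus_poisson M (\<lambda>y. of_real (cmod (h y))) r z)" .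
qed

section \<open>Trigonometric polynomials\<close>

text \<open>The last rule makes the notion depend on the values on the torus only; there, unlike at points with
  vanishing coordinates, a product of characters is a character.\<close>

inductive trig_polynomial :: "((nat \<Rightarrow> complex) \<Rightarrow> complex) \<Rightarrow> bool" where
  monomial: "\<nu> \<in> Z0 \<Longrightarrow> trig_polynomial (\<lambda>z. c * character \<nu> z)"
| add: "trig_polynomial p \<Longrightarrow> trig_polynomial q \<Longrightarrow> trig_polynomial (\<lambda>z. p z + q z)"
| cong: "trig_polynomial p \<Longrightarrow> (\<And>z. z \<in> torus \<Longrightarrow> p z = q z) \<Longrightarrow> trig_polynomial q"

lemma trig_polynomial_const: "trig_polynomial (\<lambda>z. c)"
  using trig_polynomial.monomial[OF Z0_zero, of c] by simp

lemma trig_polynomial_times_monomial: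
  assumes "trig_polynomial p" "\<nu> \<in> Z0"
  shows "trig_polynomial (\<lambda>z. p z * (c * character \<nu> z))"
  using assms
proof induction
  case (monomial \<nu>' c')
  show ?case
    by (rule trig_polynomial.cong[OF trig_polynomial.monomial[OF Z0_add[OF monomial], of "c' * c"]])
       (use monomial in \<open>simp add: character_add mult_ac\<close>)
next
  case (add p q)
  then show ?case using trig_polynomial.add by (fastforce simp: distrib_right)
next
  case (cong p q)
  then show ?case by (auto intro: trig_polynomial.cong)
qed

lemma trig_polynomial_mult:
  assumes "trig_polynomial p" "trig_polynomial q"
  shows "trig_polynomial (\<lambda>z. p z * q z)"
  using assms(2,1)
proof induction
  case (monomial \<nu> c)
  then show ?case using trig_polynomial_times_monomial by blast
next
  case (add q1 q2)
  then show ?case using trig_polynomial.add by (fastforce simp: distrib_left)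
next
  case (cong q1 q2)
  then show ?case by (auto intro: trig_polynomial.cong)
qed

lemma trig_polynomial_cnj:
  assumes "trig_polynomial p"
  shows "trig_polynomial (\<lambda>z. cnj (p z))"
  using assms
proof induction
  case (monomial \<nu> c)
  show ?case
    by (rule trig_polynomial.cong[OF trig_polynomial.monomial[OF Z0_uminus[OF monomial], of "cnj c"]])
       (simp add: character_uminus)
next
  case (add p q)
  then show ?case using trig_polynomial.add by fastforce
next
  case (cong p q)
  then show ?case by (auto intro: trig_polynomial.cong)
qed

lemma trig_polynomial_continuous: "trig_polynomial p \<Longrightarrow> continuous_on torus p"
proof (induction rule: trig_polynomial.induct)
  case (cong p q)
  then show ?case by (metis continuous_on_cong)
qed (auto intro!: continuous_intros continuous_on_character)

lemma trig_polynomial_measurable: "trig_polynomial p \<Longrightarrow> p \<in> borel_measurable torus_borel"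
  unfolding torus_borel_def by (intro borel_measurable_continuous_on_restrict trig_polynomial_continuous)

lemma trig_polynomial_bounded: "trig_polynomial p \<Longrightarrow> \<exists>B. \<forall>z\<in>torus. cmod (p z) \<le> B"
proof (induction rule: trig_polynomial.induct)
  case (monomial \<nu> c)
  then show ?case by (intro exI[of _ "cmod c"]) (simp add: norm_mult norm_character)
next
  case (add p q)
  then obtain B C where "\<forall>z\<in>torus. cmod (p z) \<le> B" "\<forall>z\<in>torus. cmod (q z) \<le> C" by blast
  then show ?case by (intro exI[of _ "B + C"]) (auto intro!: norm_triangle_le add_mono)
qed simp

lemma trig_polynomial_integrable:
  assumes M: "sets M = sets torus_borel" and "finite_measure M" and p: "trig_polynomial p"
  shows "integrable M p"
proof -
  interpret finite_measure M by fact
  obtain B where "\<And>z. z \<in> torus \<Longrightarrow> cmod (p z) \<le> B" using trig_polynomial_bounded[OF p] by blast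
  then show ?thesis
    by (intro integrable_const_bound[of p B])
       (auto intro!: AE_I2 simp: space_eq_torus[OF M] measurable_cong_sets[OF M refl] trig_polynomial_measurable p)
qed

lemma torus_poisson_character:
  assumes \<nu>: "\<nu> \<in> Z0" and r: "0 \<le> r" "r < 1" and z: "z \<in> torus"
  shows "torus_poisson haar (\<lambda>y. c * character \<nu> y) r z = c * of_real r ^ weight \<nu> * character \<nu> z"
proof -
  have "(LINT y|haar. (c * character \<nu> y) * cnj (character \<nu>' y)) = (if \<nu>' = \<nu> then c else 0)" if \<nu>': "\<nu>' \<in> Z0" for \<nu>'
  proof -
    have "(LINT y|haar. (c * character \<nu> y) * cnj (character \<nu>' y)) = (LINT y|haar. c * character (\<lambda>j. \<nu> j + - \<nu>' j) y)"
      by (intro Bochner_Integration.integral_cong refl)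
         (simp only: space_haar character_add[OF \<nu> Z0_uminus[OF \<nu>']] character_uminus mult.assoc)
    also have "\<dots> = c * (if (\<lambda>j. \<nu> j + - \<nu>' j) = (\<lambda>j. 0) then 1 else 0)"
      by (simp only: integral_mult_right_zero integral_haar_character[OF Z0_add[OF \<nu> Z0_uminus[OF \<nu>']]])
    also have "(\<lambda>j. \<nu> j + - \<nu>' j) = (\<lambda>j. 0) \<longleftrightarrow> \<nu>' = \<nu>" by (auto simp: fun_eq_iff)
    finally show ?thesis by simp
  qed
  then have "torus_poisson haar (\<lambda>y. c * character \<nu> y) r z
      = (\<Sum>\<^sub>\<infinity>\<nu>'\<in>Z0. if \<nu>' = \<nu> then c * of_real r ^ weight \<nu> * character \<nu> z else 0)"
    unfolding torus_poisson_def by (intro infsum_cong) auto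
  also have "\<dots> = (\<Sum>\<^sub>\<infinity>\<nu>'\<in>{\<nu>}. c * of_real r ^ weight \<nu> * character \<nu> z)"
    by (rule infsum_cong_neutral) (use \<nu> in auto)
  finally show ?thesis by simp
qed

text \<open>Orthogonality of the characters: smoothing a measure and smoothing a character are adjoint.\<close>

lemma integral_character_torus_poisson:
  assumes \<nu>: "\<nu> \<in> Z0" and M: "sets M = sets torus_borel" and h: "integrable M h" and r: "0 \<le> r" "r < 1"
  shows "(LINT z|haar. (c * character \<nu> z) * torus_poisson M h r z) = (LINT y|M. h y * (c * of_real r ^ weight \<nu> * character \<nu> y))"
proof -
  have ic: "integrable haar (\<lambda>z. c * character \<nu> z)"
    by (intro trig_polynomial_integrable sets_haar haar.finite_measure trig_polynomial.monomial \<nu>)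
  have "(LINT z|haar. (c * character \<nu> z) * character \<nu>' z) = (if \<nu>' = (\<lambda>j. - \<nu> j) then c else 0)" if \<nu>': "\<nu>' \<in> Z0" for \<nu>'
  proof -
    have "(LINT z|haar. (c * character \<nu> z) * character \<nu>' z) = (LINT z|haar. c * character (\<lambda>j. \<nu> j + \<nu>' j) z)"
      by (intro Bochner_Integration.integral_cong refl)
         (simp only: space_haar character_add[OF \<nu> \<nu>'] mult.assoc)
    also have "\<dots> = c * (if (\<lambda>j. \<nu> j + \<nu>' j) = (\<lambda>j. 0) then 1 else 0)"
      by (simp only: integral_mult_right_zero integral_haar_character[OF Z0_add[OF \<nu> \<nu>']])
    also have "(\<lambda>j. \<nu> j + \<nu>' j) = (\<lambda>j. 0) \<longleftrightarrow> \<nu>' = (\<lambda>j. - \<nu> j)" by (auto simp: fun_eq_iff add_eq_0_iff)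
    finally show ?thesis by simp
  qed
  then have "(LINT z|haar. (c * character \<nu> z) * torus_poisson M h r z) =
     (\<Sum>\<^sub>\<infinity>\<nu>'\<in>Z0. if \<nu>' = (\<lambda>j. - \<nu> j) then (LINT y|M. h y * cnj (character (\<lambda>j. - \<nu> j) y)) * of_real r ^ weight \<nu> * c else 0)"
    unfolding infsumI[OF integrable_torus_poisson_times(2)[OF M h r ic], symmetric]
    by (intro infsum_cong) (auto simp: weight_uminus)
  also have "\<dots> = (\<Sum>\<^sub>\<infinity>\<nu>'\<in>{\<lambda>j. - \<nu> j}. (LINT y|M. h y * cnj (character (\<lambda>j. - \<nu> j) y)) * of_real r ^ weight \<nu> * c)"
    by (rule infsum_cong_neutral) (use Z0_uminus[OF \<nu>] in auto)
  also have "\<dots> = (LINT y|M. h y * cnj (character (\<lambda>j. - \<nu> j) y)) * (of_real r ^ weight \<nu> * c)" by simp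
  also have "\<dots> = (LINT y|M. h y * cnj (character (\<lambda>j. - \<nu> j) y) * (of_real r ^ weight \<nu> * c))"
    by (rule integral_mult_left_zero[symmetric])
  also have "\<dots> = (LINT y|M. h y * (c * of_real r ^ weight \<nu> * character \<nu> y))"
    by (intro Bochner_Integration.integral_cong refl) (simp add: space_eq_torus[OF M] character_uminus mult_ac)
  finally show ?thesis .
qed

text \<open>\<open>Q r\<close> is the Poisson integral of the trigonometric polynomial \<open>q\<close>. It is bounded uniformly in \<open>r\<close>, it tends to
  \<open>q\<close>, and an integral of \<open>q\<close> against the Poisson integral of a measure is the integral of \<open>Q r\<close> against the
  measure itself.\<close>

definition poisson_smoothing ::
    "((nat \<Rightarrow> complex) \<Rightarrow> complex) \<Rightarrow> (real \<Rightarrow> (nat \<Rightarrow> complex) \<Rightarrow> complex) \<Rightarrow> real \<Rightarrow> bool" where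
  "poisson_smoothing q Q B \<longleftrightarrow>
     (\<forall>r. 0 \<le> r \<longrightarrow> r < 1 \<longrightarrow> trig_polynomial (Q r) \<and> (\<forall>y\<in>torus. cmod (Q r y) \<le> B \<and> torus_poisson haar q r y = Q r y)) \<and>
     (\<forall>y\<in>torus. ((\<lambda>r. Q r y) \<longlongrightarrow> q y) (at_left 1)) \<and>
     (\<forall>r M h. 0 \<le> r \<longrightarrow> r < 1 \<longrightarrow> sets M = sets torus_borel \<longrightarrow> integrable M h \<longrightarrow>
        (LINT z|haar. q z * torus_poisson M h r z) = (LINT y|M. h y * Q r y))"

lemma trig_polynomial_smoothing:
  assumes "trig_polynomial q"
  shows "\<exists>Q B. poisson_smoothing q Q B"
  using assms
proof induction
  case (monomial \<nu> c)
  define Q where "Q r z = c * of_real r ^ weight \<nu> * character \<nu> z" for r :: real and z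
  have "poisson_smoothing (\<lambda>z. c * character \<nu> z) Q (cmod c)"
    unfolding poisson_smoothing_def
  proof (intro conjI allI impI ballI)
    show "trig_polynomial (Q r)" for r
      unfolding Q_def using trig_polynomial.monomial[OF monomial] by blast
    show "cmod (Q r y) \<le> cmod c" if "0 \<le> r" "r < 1" "y \<in> torus" for r y
      using that by (simp add: Q_def norm_mult norm_power norm_character mult_left_le power_le_one)
    show "((\<lambda>r. Q r y) \<longlongrightarrow> c * character \<nu> y) (at_left 1)" for y
      unfolding Q_def by (auto intro!: tendsto_eq_intros)
  qed (simp_all add: Q_def integral_character_torus_poisson[OF monomial] torus_poisson_character[OF monomial])
  then show ?case by blast
next
  case (add p q)
  obtain P B where PB: "poisson_smoothing p P B" using add.IH(1) by blast
  obtain Q C where QC: "poisson_smoothing q Q C" using add.IH(2) by blast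
  have P: "\<And>r. 0 \<le> r \<Longrightarrow> r < 1 \<Longrightarrow> trig_polynomial (P r)" "\<And>r y. 0 \<le> r \<Longrightarrow> r < 1 \<Longrightarrow> y \<in> torus \<Longrightarrow> cmod (P r y) \<le> B"
    "\<And>y. y \<in> torus \<Longrightarrow> ((\<lambda>r. P r y) \<longlongrightarrow> p y) (at_left 1)"
    "\<And>r M h. 0 \<le> r \<Longrightarrow> r < 1 \<Longrightarrow> sets M = sets torus_borel \<Longrightarrow> integrable M h \<Longrightarrow>
        (LINT z|haar. p z * torus_poisson M h r z) = (LINT y|M. h y * P r y)"
    "\<And>r z. 0 \<le> r \<Longrightarrow> r < 1 \<Longrightarrow> z \<in> torus \<Longrightarrow> torus_poisson haar p r z = P r z"
    using PB by (simp_all add: poisson_smoothing_def)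
  have Q: "\<And>r. 0 \<le> r \<Longrightarrow> r < 1 \<Longrightarrow> trig_polynomial (Q r)" "\<And>r y. 0 \<le> r \<Longrightarrow> r < 1 \<Longrightarrow> y \<in> torus \<Longrightarrow> cmod (Q r y) \<le> C"
    "\<And>y. y \<in> torus \<Longrightarrow> ((\<lambda>r. Q r y) \<longlongrightarrow> q y) (at_left 1)"
    "\<And>r M h. 0 \<le> r \<Longrightarrow> r < 1 \<Longrightarrow> sets M = sets torus_borel \<Longrightarrow> integrable M h \<Longrightarrow>
        (LINT z|haar. q z * torus_poisson M h r z) = (LINT y|M. h y * Q r y)"
    "\<And>r z. 0 \<le> r \<Longrightarrow> r < 1 \<Longrightarrow> z \<in> torus \<Longrightarrow> torus_poisson haar q r z = Q r z"
    using QC by (simp_all add: poisson_smoothing_def)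
  have pi: "integrable haar p" and qi: "integrable haar q"
    using add.hyps by (intro trig_polynomial_integrable sets_haar haar.finite_measure; simp)+
  have 1: "(LINT z|haar. (p z + q z) * torus_poisson M h r z) = (LINT y|M. h y * (P r y + Q r y))"
    if r: "0 \<le> r" "r < 1" and M: "sets M = sets torus_borel" and h: "integrable M h" for r M h
  proof -
    have i: "integrable M (\<lambda>y. h y * T y)" if T: "trig_polynomial T" for T
    proof -
      obtain B where B: "\<And>z. z \<in> torus \<Longrightarrow> cmod (T z) \<le> B" using trig_polynomial_bounded[OF T] by blast
      have [measurable]: "T \<in> borel_measurable M"
        using trig_polynomial_measurable[OF T] by (simp add: measurable_cong_sets[OF M refl])
      have [measurable]: "h \<in> borel_measurable M" using h by simp
      show ?thesis
      proof (rule Bochner_Integration.integrable_bound[OF integrable_mult_right[OF integrable_norm[OF h], of B]])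
        show "AE x in M. norm (h x * T x) \<le> norm (B * norm (h x))"
        proof (rule AE_I2)
          fix x assume "x \<in> space M"
          then have "cmod (T x) \<le> \<bar>B\<bar>" using B[of x] by (simp add: space_eq_torus[OF M])
          then show "norm (h x * T x) \<le> norm (B * norm (h x))"
            using mult_right_mono[of "cmod (T x)" "\<bar>B\<bar>" "norm (h x)"] by (simp add: norm_mult abs_mult mult.commute)
        qed
      qed measurable
    qed
    show ?thesis
      using integrable_torus_poisson_times(1)[OF M h r pi] integrable_torus_poisson_times(1)[OF M h r qi]
        i[OF P(1)[OF r]] i[OF Q(1)[OF r]]
      by (simp add: distrib_left distrib_right P(4)[OF r M h] Q(4)[OF r M h])
  qed
  have 2: "torus_poisson haar (\<lambda>z. p z + q z) r z = P r z + Q r z" if r: "0 \<le> r" "r < 1" and z: "z \<in> torus" for r z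
  proof -
    have "torus_poisson haar (\<lambda>z. p z + q z) r z = torus_poisson haar p r z + torus_poisson haar q r z"
      unfolding torus_poisson_def
      by (subst infsum_add[symmetric, OF torus_poisson_summable[OF sets_haar pi r z] torus_poisson_summable[OF sets_haar qi r z]])
         (use integrable_times_character[OF sets_haar pi r] integrable_times_character[OF sets_haar qi r] in \<open>simp add: distrib_right\<close>)
    then show ?thesis by (simp add: P(5)[OF r z] Q(5)[OF r z])
  qed
  have "poisson_smoothing (\<lambda>z. p z + q z) (\<lambda>r y. P r y + Q r y) (B + C)"
    unfolding poisson_smoothing_def
  proof (intro conjI allI impI ballI)
    show "trig_polynomial (\<lambda>y. P r y + Q r y)" if "0 \<le> r" "r < 1" for r
      using P(1)[OF that] Q(1)[OF that] by (rule trig_polynomial.add)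
    show "cmod (P r y + Q r y) \<le> B + C" if "0 \<le> r" "r < 1" "y \<in> torus" for r y
      using P(2)[OF that] Q(2)[OF that] by (intro norm_triangle_le add_mono)
    show "((\<lambda>r. P r y + Q r y) \<longlongrightarrow> p y + q y) (at_left 1)" if "y \<in> torus" for y
      using P(3)[OF that] Q(3)[OF that] by (rule tendsto_add)
  qed (simp_all add: 1 2)
  then show ?case by blast
next
  case (cong p q)
  have 1: "(LINT z|haar. q z * torus_poisson M h r z) = (LINT z|haar. p z * torus_poisson M h r z)" for M h r
    by (intro Bochner_Integration.integral_cong refl) (simp add: space_haar cong.hyps(2))
  have 2: "torus_poisson haar q r z = torus_poisson haar p r z" for r z
  proof -
    have "(LINT y|haar. q y * cnj (character \<nu> y)) = (LINT y|haar. p y * cnj (character \<nu> y))" for \<nu>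
      by (intro Bochner_Integration.integral_cong refl) (simp add: space_haar cong.hyps(2))
    then show ?thesis by (simp add: torus_poisson_def)
  qed
  obtain Q B where "poisson_smoothing p Q B" using cong.IH by blast
  then have "poisson_smoothing q Q B" unfolding poisson_smoothing_def 1 2 by (simp add: cong.hyps(2))
  then show ?case by blast
qed

lemma compact_torus: "compact torus"
proof -
  have "compactin (product_topology (\<lambda>_. euclidean) (UNIV :: nat set)) (PiE UNIV (\<lambda>_. sphere (0::complex) 1))"
    unfolding compactin_PiE by simp
  moreover have "(PiE UNIV (\<lambda>_. sphere (0::complex) 1)) = torus"
    by (auto simp: torus_def PiE_def)
  ultimately show ?thesis by (simp add: euclidean_product_topology)
qed

lemma torus_in_borel: "torus \<in> sets borel"
  using compact_torus compact_imp_closed borel_closed by blast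

text \<open>Stone-Weierstrass; real and imaginary parts of coordinates separate points.\<close>

lemma real_trig_polynomials_dense:
  fixes \<phi> :: "(nat \<Rightarrow> complex) \<Rightarrow> real"
  assumes \<phi>: "continuous_on torus \<phi>" and e: "0 < e"
  shows "\<exists>q. trig_polynomial q \<and> (\<forall>z\<in>torus. cmod (of_real (\<phi> z) - q z) < e)"
proof -
  define R where "R = {g. trig_polynomial (\<lambda>z. complex_of_real (g z))}"
  interpret function_ring_on R torus
  proof
    show "compact torus" by (rule compact_torus)
    show "continuous_on torus g" if "g \<in> R" for g
    proof -
      have "continuous_on torus (\<lambda>z. Re (complex_of_real (g z)))"
        using that by (intro continuous_intros trig_polynomial_continuous) (simp add: R_def)
      then show ?thesis by simp
    qed
    show "(\<lambda>x. g x + h x) \<in> R" if "g \<in> R" "h \<in> R" for g h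
      using trig_polynomial.add[of "\<lambda>z. of_real (g z)" "\<lambda>z. of_real (h z)"] that by (simp add: R_def)
    show "(\<lambda>x. g x * h x) \<in> R" if "g \<in> R" "h \<in> R" for g h
      using trig_polynomial_mult[of "\<lambda>z. of_real (g z)" "\<lambda>z. of_real (h z)"] that by (simp add: R_def)
    show "(\<lambda>_. c) \<in> R" for c by (simp add: R_def trig_polynomial_const)
    show "\<exists>g\<in>R. g x \<noteq> g y" if "x \<in> torus" "y \<in> torus" "x \<noteq> y" for x y
    proof -
      obtain j where j: "x j \<noteq> y j" using \<open>x \<noteq> y\<close> by auto
      have Z: "trig_polynomial (\<lambda>z. c * z j)" for c
        using trig_polynomial.monomial[OF Z0_single[of j 1], of c] by (simp add: character_single)
      have ZC: "trig_polynomial (\<lambda>z. c * cnj (z j))" for c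
        using trig_polynomial_cnj[OF Z[of "cnj c"]] by simp
      have "(\<lambda>z. (1/2) * z j + (1/2) * cnj (z j)) = (\<lambda>z. complex_of_real (Re (z j)))"
        by (auto simp: fun_eq_iff complex_eq_iff)
      then have 1: "(\<lambda>z. Re (z j)) \<in> R"
        unfolding R_def using trig_polynomial.add[OF Z[of "1/2"] ZC[of "1/2"]] by simp
      have "(\<lambda>z. (-\<i>/2) * z j + (\<i>/2) * cnj (z j)) = (\<lambda>z. complex_of_real (Im (z j)))"
        by (auto simp: fun_eq_iff complex_eq_iff)
      then have 2: "(\<lambda>z. Im (z j)) \<in> R"
        unfolding R_def using trig_polynomial.add[OF Z[of "-\<i>/2"] ZC[of "\<i>/2"]] by simp
      show ?thesis
      proof (cases "Re (x j) = Re (y j)")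
        case True
        then have "Im (x j) \<noteq> Im (y j)" using j by (simp add: complex_eq_iff)
        then show ?thesis using 2 by (intro bexI[of _ "\<lambda>z. Im (z j)"])
      next
        case False
        then show ?thesis using 1 by (intro bexI[of _ "\<lambda>z. Re (z j)"])
      qed
    qed
  qed
  obtain g where g: "g \<in> R" "\<And>z. z \<in> torus \<Longrightarrow> \<bar>\<phi> z - g z\<bar> < e"
    using Stone_Weierstrass_basic[OF \<phi> e] by blast
  then show ?thesis
    by (intro exI[of _ "\<lambda>z. of_real (g z)"]) (auto simp: R_def simp flip: of_real_diff)
qed

text \<open>Finite Borel measures on Polish spaces are inner regular, and the space of all complex sequences is
  Polish.\<close>

lemma inner_regular_torus:
  assumes M: "sets M = sets torus_borel" "finite_measure M" and A: "A \<in> sets torus_borel" and e: "0 < e"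
  shows "\<exists>K. compact K \<and> K \<subseteq> A \<and> measure M (A - K) < e"
proof -
  interpret finite_measure M by fact
  have sp: "space M = torus" by (rule space_eq_torus[OF M(1)])
  have At: "A \<subseteq> torus" using sets.sets_into_space[OF A] by (simp add: space_torus_borel)
  have Ab: "A \<in> sets borel"
    using A torus_in_borel by (auto simp: torus_borel_def sets_restrict_space_iff)
  have meas: "(\<lambda>z. z) \<in> M \<rightarrow>\<^sub>M borel"
    unfolding measurable_cong_sets[OF M(1) refl] torus_borel_def by (rule measurable_restrict_space1) simp
  \<comment> \<open>the measure on the Polish space of all sequences\<close>
  define M' where "M' = distr M borel (\<lambda>z. z)"
  have em: "emeasure M' X = emeasure M (X \<inter> torus)" if "X \<in> sets borel" for X
    unfolding M'_def by (subst emeasure_distr[OF meas that]) (simp add: sp)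
  have "emeasure M' (space M') \<noteq> \<infinity>"
    using em[of UNIV] by (simp add: M'_def emeasure_eq_measure)
  then have "emeasure M' A = (SUP K\<in>{K. K \<subseteq> A \<and> compact K}. emeasure M' K)"
    by (intro inner_regular) (simp_all add: M'_def Ab)
  moreover have "emeasure M' X = emeasure M X" if "X \<in> sets borel" "X \<subseteq> A" for X
    using em[OF that(1)] that(2) At by (simp add: Int_absorb2)
  ultimately have SUP: "emeasure M A = (SUP K\<in>{K. K \<subseteq> A \<and> compact K}. emeasure M K)"
    using Ab by (simp add: compact_imp_closed borel_closed cong: SUP_cong_simp)
  have Ks: "K \<in> sets M" if "K \<subseteq> A" "compact K" for K
    using that At unfolding M(1) torus_borel_def
    by (subst sets_restrict_space_iff) (auto simp: torus_in_borel compact_imp_closed borel_closed)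
  have "\<exists>K. compact K \<and> K \<subseteq> A \<and> measure M A < measure M K + e"
  proof (rule ccontr)
    assume "\<not> ?thesis"
    then have le: "measure M K + e \<le> measure M A" if "K \<subseteq> A" "compact K" for K
      using that by (meson not_less)
    have "emeasure M A \<le> ennreal (measure M A - e)"
      unfolding SUP using le by (intro SUP_least) (auto simp: emeasure_eq_measure intro!: ennreal_leI dest: le)
    moreover have "0 \<le> measure M A - e" using le[of "{}"] by simp
    ultimately show False using e by (simp add: emeasure_eq_measure)
  qed
  then obtain K where K: "compact K" "K \<subseteq> A" "measure M A < measure M K + e" by blast
  then show ?thesis
    using finite_measure_Diff[of A K] A Ks[OF K(2,1)] M(1) by (intro exI[of _ K]) auto
qed

text \<open>Approximate \<open>A\<close> from inside by a compact set, its indicator by continuous functions, and these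
  uniformly by trigonometric polynomials. One polynomial serves for finitely many measures at once,
  which is how it can distinguish Haar measure from a measure singular to it.\<close>

lemma trig_polynomials_dense:
  assumes fin: "finite \<M>" and M: "\<And>M. M \<in> \<M> \<Longrightarrow> sets M = sets torus_borel" "\<And>M. M \<in> \<M> \<Longrightarrow> finite_measure M"
    and A: "A \<in> sets torus_borel" and e: "0 < e"
  shows "\<exists>q. trig_polynomial q \<and> (\<forall>z\<in>torus. cmod (q z) \<le> 2) \<and>
     (\<forall>M\<in>\<M>. (LINT z|M. cmod (indicator A z - q z)) < e)"
proof -
  have "\<forall>M\<in>\<M>. \<exists>K. compact K \<and> K \<subseteq> A \<and> measure M (A - K) < e / 3"
    using inner_regular_torus[OF M(1) M(2) A, of _ "e / 3"] e by auto
  then obtain k where k: "\<And>M. M \<in> \<M> \<Longrightarrow> compact (k M) \<and> k M \<subseteq> A \<and> measure M (A - k M) < e / 3" by metis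
  define K where "K = (\<Union>M\<in>\<M>. k M)"
  have Kc: "compact K" unfolding K_def using fin k by (intro compact_UN) auto
  have KA: "K \<subseteq> A" unfolding K_def using k by blast
  have At: "A \<subseteq> torus" using sets.sets_into_space[OF A] by (simp add: space_torus_borel)
  have Ks: "X \<in> sets torus_borel" if "compact X" "X \<subseteq> A" for X
    using that At unfolding torus_borel_def
    by (subst sets_restrict_space_iff) (auto simp: torus_in_borel compact_imp_closed borel_closed)
  have KM: "measure M (A - K) < e / 3" if "M \<in> \<M>" for M
  proof -
    interpret finite_measure M by (rule M(2)[OF that])
    have "measure M (A - K) \<le> measure M (A - k M)"
      using that A Ks k[OF that] by (intro finite_measure_mono) (auto simp: K_def M(1)[OF that])
    then show ?thesis using k[OF that] by linarith
  qed
  \<comment> \<open>continuous functions that decrease to the indicator of \<open>K\<close>\<close>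
  define \<phi> where "\<phi> n z = (if K = {} then 0 else max 0 (1 - real n * infdist z K))" for n z
  have \<phi>c: "continuous_on UNIV (\<phi> n)" for n
    unfolding \<phi>_def by (cases "K = {}") (auto intro!: continuous_intros)
  have \<phi>b: "0 \<le> \<phi> n z" "\<phi> n z \<le> 1" for n z
    unfolding \<phi>_def by (auto simp: infdist_nonneg)
  have \<phi>lim: "(\<lambda>n. \<phi> n z) \<longlonglongrightarrow> indicator K z" for z
  proof (cases "K = {} \<or> z \<in> K")
    case True
    then have "\<phi> n z = indicator K z" for n by (auto simp: \<phi>_def indicator_def)
    then show ?thesis by simp
  next
    case False
    then have d: "0 < infdist z K"
      using in_closed_iff_infdist_zero[of K z] Kc compact_imp_closed infdist_nonneg[of z K] by force
    obtain N where N: "1 < real N * infdist z K" using reals_Archimedean3[OF d] by blast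
    have "\<phi> n z = 0" if "N \<le> n" for n
    proof -
      have "real N * infdist z K \<le> real n * infdist z K" using that d by (intro mult_right_mono) auto
      then show ?thesis using N by (simp add: \<phi>_def)
    qed
    then have "\<forall>\<^sub>F n in sequentially. \<phi> n z = indicator K z"
      using False by (auto simp: eventually_sequentially)
    then show ?thesis by (rule tendsto_eventually)
  qed
  have \<phi>1: "\<bar>indicator K z - \<phi> n z\<bar> \<le> 1" for n z
    using \<phi>b[of n z] by (cases "z \<in> K") auto
  have \<phi>m: "\<phi> n \<in> borel_measurable M" if "M \<in> \<M>" for n M
    unfolding measurable_cong_sets[OF M(1)[OF that] refl] torus_borel_def
    by (rule borel_measurable_continuous_on_restrict[OF continuous_on_subset[OF \<phi>c]]) simp
  have \<phi>int: "\<forall>\<^sub>F n in sequentially. (LINT z|M. \<bar>indicator K z - \<phi> n z\<bar>) < e / 3" if MM: "M \<in> \<M>" for M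
  proof -
    interpret finite_measure M by (rule M(2)[OF MM])
    have [measurable]: "\<phi> n \<in> borel_measurable M" for n by (rule \<phi>m[OF MM])
    have [measurable]: "K \<in> sets M" using Ks[OF Kc KA] by (simp add: M(1)[OF MM])
    have "(\<lambda>n. LINT z|M. \<bar>indicator K z - \<phi> n z\<bar>) \<longlonglongrightarrow> (LINT z|M. 0)"
    proof (rule integral_dominated_convergence[where w = "\<lambda>_. 1"])
      show "AE z in M. (\<lambda>n. \<bar>indicator K z - \<phi> n z\<bar>) \<longlonglongrightarrow> 0"
      proof (rule AE_I2)
        fix z
        have "(\<lambda>n. \<bar>indicator K z - \<phi> n z\<bar>) \<longlonglongrightarrow> \<bar>indicator K z - indicator K z\<bar>"
          by (intro tendsto_intros \<phi>lim)
        then show "(\<lambda>n. \<bar>indicator K z - \<phi> n z\<bar>) \<longlonglongrightarrow> 0" by simp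
      qed
      show "AE z in M. norm \<bar>indicator K z - \<phi> n z\<bar> \<le> 1" for n
        using \<phi>1 by (intro AE_I2) simp
    qed auto
    then show ?thesis using e by (intro order_tendstoD) auto
  qed
  have "\<forall>\<^sub>F n in sequentially. \<forall>M\<in>\<M>. (LINT z|M. \<bar>indicator K z - \<phi> n z\<bar>) < e / 3"
    using \<phi>int by (simp add: eventually_ball_finite[OF fin])
  then obtain n where n: "\<And>M. M \<in> \<M> \<Longrightarrow> (LINT z|M. \<bar>indicator K z - \<phi> n z\<bar>) < e / 3"
    by (metis (no_types, lifting) eventually_sequentially order_refl)
  define V where "V = (\<Sum>M\<in>\<M>. measure M torus)"
  have V0: "0 \<le> V" unfolding V_def by (intro sum_nonneg) auto
  define W where "W = 1 + V"
  have W: "0 < W" "V < W" using V0 by (auto simp: W_def)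
  \<comment> \<open>at most 1 to keep the bound 2 for \<open>q\<close>, and small against the total masses\<close>
  define \<delta> where "\<delta> = min 1 (e / (3 * W))"
  have \<delta>: "0 < \<delta>" "\<delta> \<le> 1" "\<delta> * V < e / 3" 
  proof -
    show "0 < \<delta>" "\<delta> \<le> 1" using e W by (auto simp: \<delta>_def)
    have "\<delta> * V \<le> e / (3 * W) * V" using V0 by (intro mult_right_mono) (auto simp: \<delta>_def)
    also have "\<dots> < e / (3 * W) * W"
      using e W by (intro mult_strict_left_mono) auto
    also have "\<dots> = e / 3" using W by simp
    finally show "\<delta> * V < e / 3" by simp
  qed
  obtain q where q: "trig_polynomial q" "\<And>z. z \<in> torus \<Longrightarrow> cmod (of_real (\<phi> n z) - q z) < \<delta>"
    using real_trig_polynomials_dense[OF continuous_on_subset[OF \<phi>c] \<delta>(1), of n] by auto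
  have q2: "cmod (q z) \<le> 2" if "z \<in> torus" for z
  proof -
    have "cmod (q z) \<le> cmod (of_real (\<phi> n z)) + cmod (of_real (\<phi> n z) - q z)"
      by (metis norm_minus_commute norm_triangle_sub)
    then show ?thesis using q(2)[OF that] \<delta>(2) \<phi>b[of n z] by simp
  qed
  have "(LINT z|M. cmod (indicator A z - q z)) < e" if MM: "M \<in> \<M>" for M
  proof -
    interpret finite_measure M by (rule M(2)[OF MM])
    have sp: "space M = torus" by (rule space_eq_torus[OF M(1)[OF MM]])
    have [measurable]: "\<phi> n \<in> borel_measurable M" by (rule \<phi>m[OF MM])
    have [measurable]: "q \<in> borel_measurable M"
      using trig_polynomial_measurable[OF q(1)] by (simp add: measurable_cong_sets[OF M(1)[OF MM] refl])
    have [measurable]: "K \<in> sets M" "A \<in> sets M" using Ks[OF Kc KA] A by (simp_all add: M(1)[OF MM])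
    have iA: "integrable M (\<lambda>z. indicator (A - K) z :: real)" by (intro integrable_real_indicator) (auto simp: emeasure_eq_measure)
    have i\<phi>: "integrable M (\<lambda>z. \<bar>indicator K z - \<phi> n z\<bar>)"
      by (rule integrable_const_bound[where B = 1])
         (use \<phi>1 in auto)
    have iq: "integrable M (\<lambda>z. cmod (indicator A z - q z))"
      by (rule integrable_const_bound[where B = 3])
         (auto intro!: AE_I2 order.trans[OF norm_triangle_ineq4] simp: sp indicator_def intro: order.trans[OF q2])
    have pt: "cmod (indicator A z - q z) \<le> indicator (A - K) z + \<bar>indicator K z - \<phi> n z\<bar> + \<delta>" if "z \<in> space M" for z
    proof -
      have "indicator A z - q z = complex_of_real (indicator (A - K) z) + of_real (indicator K z - \<phi> n z) + (of_real (\<phi> n z) - q z)"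
        using KA by (auto simp: indicator_def)
      then have "cmod (indicator A z - q z) \<le> cmod (complex_of_real (indicator (A - K) z)) + cmod (complex_of_real (indicator K z - \<phi> n z)) + cmod (of_real (\<phi> n z) - q z)"
        by (metis norm_triangle_le norm_triangle_ineq add_right_mono)
      then show ?thesis using q(2)[of z] that unfolding norm_of_real by (simp add: sp)
    qed
    have "(LINT z|M. cmod (indicator A z - q z)) \<le> (LINT z|M. indicator (A - K) z + \<bar>indicator K z - \<phi> n z\<bar> + \<delta>)"
      using iA i\<phi> iq pt by (intro integral_mono) auto
    also have "\<dots> = measure M (A - K) + (LINT z|M. \<bar>indicator K z - \<phi> n z\<bar>) + \<delta> * measure M torus"
      using iA i\<phi> sets.sets_into_space[of "A - K" M] by (simp add: sp Int_absorb2 mult.commute)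
    also have "\<delta> * measure M torus \<le> \<delta> * V"
      unfolding V_def using \<delta>(1) MM fin by (intro mult_left_mono member_le_sum) auto
    finally show ?thesis using KM[OF MM] n[OF MM] \<delta>(3) by simp
  qed
  then show ?thesis using q(1) q2 by blast
qed

lemma trig_polynomials_dense_L1:
  assumes f: "integrable haar f" and e: "0 < e"
  shows "\<exists>q. trig_polynomial q \<and> (LINT z|haar. cmod (f z - q z)) < e"
  using f e
proof (induction f arbitrary: e rule: integrable_induct)
  case (base A c)
  have A: "A \<in> sets torus_borel" using base by (simp add: sets_haar)
  have "0 < e / (1 + cmod c)" using base.prems by (simp add: add_pos_nonneg)
  then obtain q where q: "trig_polynomial q" "(LINT z|haar. cmod (indicator A z - q z)) < e / (1 + cmod c)"
    using trig_polynomials_dense[of "{haar}" A "e / (1 + cmod c)"] A by (auto simp: sets_haar haar.finite_measure)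
  have "(LINT z|haar. cmod (indicator A z *\<^sub>R c - c * q z)) = cmod c * (LINT z|haar. cmod (indicator A z - q z))"
  proof -
    have "cmod (indicator A z *\<^sub>R c - c * q z) = cmod c * cmod (indicator A z - q z)" for z
      unfolding norm_mult[symmetric] by (simp add: indicator_def right_diff_distrib)
    then show ?thesis by simp
  qed
  also have "\<dots> \<le> cmod c * (e / (1 + cmod c))" using q(2) by (intro mult_left_mono) auto
  also have "\<dots> < e" using base.prems by (simp add: divide_simps add_pos_nonneg)
  finally have "(LINT z|haar. cmod (indicator A z *\<^sub>R c - c * q z)) < e" .
  then show ?case
    using trig_polynomial_mult[OF trig_polynomial_const[of c] q(1)] by blast
next
  case (add f g)
  obtain p where p: "trig_polynomial p" "(LINT z|haar. cmod (f z - p z)) < e / 2"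
    using add.IH(1)[of "e / 2"] add.prems by auto
  obtain q where q: "trig_polynomial q" "(LINT z|haar. cmod (g z - q z)) < e / 2"
    using add.IH(2)[of "e / 2"] add.prems by auto
  have pi: "integrable haar p" "integrable haar q"
    by (intro trig_polynomial_integrable sets_haar haar.finite_measure p q)+
  have "(LINT z|haar. cmod (f z + g z - (p z + q z))) \<le> (LINT z|haar. cmod (f z - p z) + cmod (g z - q z))"
  proof (rule integral_mono)
    show "cmod (f z + g z - (p z + q z)) \<le> cmod (f z - p z) + cmod (g z - q z)" for z
      by (rule norm_diff_triangle_ineq)
  qed (use add.hyps pi in auto)
  also have "\<dots> < e" using p(2) q(2) add.hyps pi by simp
  finally show ?case using trig_polynomial.add[OF p(1) q(1)] by blast
next
  case (lim f s)
  have "(\<lambda>i. LINT z|haar. cmod (f z - s i z)) \<longlonglongrightarrow> (LINT z|haar. 0)"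
  proof (rule integral_dominated_convergence[where w = "\<lambda>z. 3 * cmod (f z)"])
    have [measurable]: "f \<in> borel_measurable haar" "s i \<in> borel_measurable haar" for i using lim by auto
    show "(\<lambda>z. cmod (f z - s i z)) \<in> borel_measurable haar" for i by measurable
    show "integrable haar (\<lambda>z. 3 * cmod (f z))" using lim by simp
    show "AE z in haar. (\<lambda>i. cmod (f z - s i z)) \<longlonglongrightarrow> 0"
    proof (rule AE_I2)
      fix z assume "z \<in> space haar"
      then have "(\<lambda>i. cmod (f z - s i z)) \<longlonglongrightarrow> cmod (f z - f z)" using lim by (intro tendsto_intros) auto
      then show "(\<lambda>i. cmod (f z - s i z)) \<longlonglongrightarrow> 0" by simp
    qed
    show "AE z in haar. norm (cmod (f z - s i z)) \<le> 3 * cmod (f z)" for i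
    proof (rule AE_I2)
      fix z assume "z \<in> space haar"
      then have "cmod (s i z) \<le> 2 * cmod (f z)" using lim by auto
      then show "norm (cmod (f z - s i z)) \<le> 3 * cmod (f z)" using norm_triangle_ineq4[of "f z" "s i z"] by simp
    qed
  qed simp
  then have "\<forall>\<^sub>F i in sequentially. (LINT z|haar. cmod (f z - s i z)) < e / 2"
    using lim.prems by (intro order_tendstoD) auto
  then obtain i where i: "(LINT z|haar. cmod (f z - s i z)) < e / 2"
    by (auto simp: eventually_sequentially)
  obtain q where q: "trig_polynomial q" "(LINT z|haar. cmod (s i z - q z)) < e / 2"
    using lim.IH[of "e / 2" i] lim.prems by auto
  have qi: "integrable haar q" by (intro trig_polynomial_integrable sets_haar haar.finite_measure q)
  have "(LINT z|haar. cmod (f z - q z)) \<le> (LINT z|haar. cmod (f z - s i z) + cmod (s i z - q z))"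
  proof (rule integral_mono)
    show "cmod (f z - q z) \<le> cmod (f z - s i z) + cmod (s i z - q z)" for z
      using norm_triangle_ineq[of "f z - s i z" "s i z - q z"] by simp
  qed (use lim.hyps qi in auto)
  also have "\<dots> < e" using i q(2) lim.hyps qi by simp
  finally show ?case using q(1) by blast
qed

section \<open>The flow on the torus\<close>

text \<open>The speeds \<open>Suc j\<close> are those of the exponent \<^const>\<open>weight\<close>, so that a character with
  nonnegative frequencies is multiplied by \<open>cis s ^ weight \<nu>\<close>.\<close>

definition torus_flow :: "real \<Rightarrow> (nat \<Rightarrow> complex) \<Rightarrow> nat \<Rightarrow> complex" where
  "torus_flow s z = (\<lambda>j. z j * cis (real (Suc j) * s))"

lemma torus_flow_in_torus: "z \<in> torus \<Longrightarrow> torus_flow s z \<in> torus"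
  by (simp add: torus_flow_def torus_def norm_mult)

lemma measurable_torus_flow: "(\<lambda>(z, s). torus_flow s z) \<in> haar \<Otimes>\<^sub>M angle \<rightarrow>\<^sub>M haar"
proof -
  have comp: "(\<lambda>z. z n) \<in> haar \<rightarrow>\<^sub>M borel" for n
    unfolding measurable_haar_cong torus_borel_def
    by (rule borel_measurable_continuous_on_restrict) (auto intro: continuous_on_subset[OF continuous_on_product_coordinates])
  have c: "(\<lambda>s. cis (real (Suc n) * s)) \<in> borel_measurable angle" for n
    unfolding measurable_cong_sets[OF sets_angle refl]
    by (intro borel_measurable_continuous_onI continuous_intros)
  have "(\<lambda>(z, s). torus_flow s z) \<in> haar \<Otimes>\<^sub>M angle \<rightarrow>\<^sub>M (\<Pi>\<^sub>M n\<in>UNIV. circle_measure)"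
  proof (rule measurable_PiM_single')
    fix n :: nat
    have "(\<lambda>x. fst x n * cis (real (Suc n) * snd x)) \<in> borel_measurable (haar \<Otimes>\<^sub>M angle)"
      by (intro borel_measurable_times measurable_compose[OF measurable_fst comp] measurable_compose[OF measurable_snd c])
    then have "(\<lambda>x. fst x n * cis (real (Suc n) * snd x)) \<in> haar \<Otimes>\<^sub>M angle \<rightarrow>\<^sub>M restrict_space borel (sphere 0 1)"
      by (rule measurable_restrict_space2[rotated]) (auto simp: space_pair_measure space_haar norm_mult cmod_torus)
    then show "(\<lambda>x. (case x of (z, s) \<Rightarrow> torus_flow s z) n) \<in> haar \<Otimes>\<^sub>M angle \<rightarrow>\<^sub>M circle_measure"
      unfolding measurable_cong_sets[OF refl sets_circle_measure]
      by (simp add: case_prod_beta' torus_flow_def)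
  qed (auto simp: space_pair_measure space_haar torus_flow_def norm_mult cmod_torus)
  then show ?thesis by (simp add: haar_def)
qed

lemma measurable_torus_flow': "torus_flow s \<in> haar \<rightarrow>\<^sub>M haar"
  using measurable_compose[OF measurable_Pair2' measurable_torus_flow, of s] by simp

text \<open>Haar measure and its image under the flow have the same Fourier coefficients, since the flow
  multiplies each character by a constant. Trigonometric polynomials approximate the indicator of any
  Borel set for both measures simultaneously.\<close>

lemma distr_torus_flow: "distr haar haar (torus_flow s) = haar"
proof (rule measure_eqI)
  let ?D = "distr haar haar (torus_flow s)"
  fix A assume "A \<in> sets ?D"
  then have A: "A \<in> sets torus_borel" by (simp add: sets_haar)
  interpret D: prob_space ?D by (rule haar.prob_space_distr[OF measurable_torus_flow'])
  have Ds: "sets ?D = sets torus_borel" by (simp add: sets_haar)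
  have inv: "(LINT z|?D. q z) = (LINT z|haar. q z)" if "trig_polynomial q" for q
    using that
  proof induction
    case (monomial \<nu> c)
    have "(LINT z|?D. c * character \<nu> z) = (LINT z|haar. c * character \<nu> (torus_flow s z))"
      by (rule integral_distr[OF measurable_torus_flow'])
         (use measurable_character[of \<nu>] in \<open>simp add: measurable_haar_cong\<close>)
    also have "\<dots> = (LINT z|haar. (c * character \<nu> (\<lambda>j. cis (real (Suc j) * s))) * character \<nu> z)"
      by (simp add: torus_flow_def character_mult mult_ac del: of_nat_Suc)
    also have "\<dots> = c * character \<nu> (\<lambda>j. cis (real (Suc j) * s)) * (LINT z|haar. character \<nu> z)"
      by (rule integral_mult_right_zero)
    also have "\<dots> = c * (LINT z|haar. character \<nu> z)"
      by (auto simp: integral_haar_character[OF monomial])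
    finally show ?case by simp
  next
    case (add p q)
    then show ?case
      using trig_polynomial_integrable[OF Ds D.finite_measure add.hyps(1)] trig_polynomial_integrable[OF Ds D.finite_measure add.hyps(2)]
        trig_polynomial_integrable[OF sets_haar haar.finite_measure add.hyps(1)] trig_polynomial_integrable[OF sets_haar haar.finite_measure add.hyps(2)]
      by simp
  next
    case (cong p q)
    have "(LINT z|?D. p z) = (LINT z|?D. q z)" "(LINT z|haar. p z) = (LINT z|haar. q z)"
      by (intro Bochner_Integration.integral_cong refl; simp add: space_haar cong.hyps)+
    then show ?case using cong.IH by simp
  qed
  have close: "cmod (complex_of_real (measure N A) - (LINT z|N. q z)) \<le> (LINT z|N. cmod (indicator A z - q z))"
    if N: "sets N = sets torus_borel" "finite_measure N" and q: "trig_polynomial q" for N q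
  proof -
    interpret finite_measure N by fact
    have i: "integrable N q" by (rule trig_polynomial_integrable[OF N q])
    have iA: "integrable N (\<lambda>z. complex_of_real (indicator A z))"
      using A N by (intro integrable_of_real integrable_real_indicator) (auto simp: emeasure_eq_measure)
    have "complex_of_real (measure N A) = (LINT z|N. complex_of_real (indicator A z))"
      using A N sets.sets_into_space[of A N] by (simp add: integral_complex_of_real Int_absorb2)
    then have "complex_of_real (measure N A) - (LINT z|N. q z) = (LINT z|N. indicator A z - q z)"
      using i iA by (simp add: of_real_indicator)
    then show ?thesis by simp
  qed
  have "\<bar>measure ?D A - measure haar A\<bar> \<le> e" if e: "0 < e" for e
  proof -
    have "\<exists>q. trig_polynomial q \<and> (\<forall>z\<in>torus. cmod (q z) \<le> 2) \<and> (\<forall>N\<in>{?D, haar}. (LINT z|N. cmod (indicator A z - q z)) < e / 2)"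
      by (rule trig_polynomials_dense[OF _ _ _ A]) (use e in \<open>auto simp: sets_haar haar.finite_measure D.finite_measure\<close>)
    then obtain q where q: "trig_polynomial q" "\<And>N. N \<in> {?D, haar} \<Longrightarrow> (LINT z|N. cmod (indicator A z - q z)) < e / 2"
      by blast
    have "cmod (complex_of_real (measure ?D A) - (LINT z|?D. q z)) < e / 2"
      using close[OF Ds D.finite_measure q(1)] q(2)[of ?D] by simp
    moreover have "cmod (complex_of_real (measure haar A) - (LINT z|haar. q z)) < e / 2"
      using close[OF sets_haar haar.finite_measure q(1)] q(2)[of haar] by simp
    ultimately have "dist (complex_of_real (measure ?D A)) (complex_of_real (measure haar A)) < e"
      unfolding inv[OF q(1)] dist_norm[symmetric] by (rule dist_triangle_half_l)
    then show ?thesis unfolding dist_of_real by (simp add: dist_real_def)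
  qed
  then have "\<bar>measure ?D A - measure haar A\<bar> \<le> 0" by (rule dense_ge)
  then show "emeasure ?D A = emeasure haar A"
    by (simp add: D.emeasure_eq_measure haar.emeasure_eq_measure)
qed simp

lemma norm_add_diff_le: "cmod (a + b - c) \<le> cmod a + cmod b + cmod c"
  using norm_triangle_ineq4[of "a + b" c] norm_triangle_ineq[of a b] by linarith

section \<open>Radial means of complex measures\<close>

lemma has_sum_finite_sum:
  fixes f :: "'k \<Rightarrow> 'i \<Rightarrow> complex"
  assumes "finite S" "\<And>k. k \<in> S \<Longrightarrow> (f k has_sum s k) A"
  shows "((\<lambda>x. \<Sum>k\<in>S. f k x) has_sum (\<Sum>k\<in>S. s k)) A"
  using assms by (induction S rule: finite_induct) (simp_all add: has_sum_add)

lemma integral_torus_poisson: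
  assumes M: "sets M = sets torus_borel" and h: "integrable M h" and r: "0 \<le> r" "r < 1"
  shows "(LINT z|haar. torus_poisson M h r z) = (LINT y|M. h y)"
  using integral_character_torus_poisson[OF Z0_zero M h r, of 1] by simp

text \<open>By positivity the modulus is at most the Poisson integral of \<open>|h| dM\<close>, and that has the integral of \<open>|h|\<close> as its total mass.\<close>

lemma integral_norm_torus_poisson_le:
  assumes M: "sets M = sets torus_borel" and h: "integrable M h" and r: "0 \<le> r" "r < 1"
  shows "(LINT z|haar. cmod (torus_poisson M h r z)) \<le> (LINT y|M. cmod (h y))"
proof -
  have h': "integrable M (\<lambda>y. complex_of_real (cmod (h y)))" using h by simp
  have "(LINT z|haar. cmod (torus_poisson M h r z)) \<le> (LINT z|haar. Re (torus_poisson M (\<lambda>y. of_real (cmod (h y))) r z))"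
    using integrable_torus_poisson[OF M h r] integrable_torus_poisson[OF M h' r] torus_poisson_abs(2)[OF M h r]
    by (intro integral_mono integrable_norm integrable_Re) (auto simp: space_haar)
  also have "\<dots> = Re (LINT z|haar. torus_poisson M (\<lambda>y. of_real (cmod (h y))) r z)"
    by (rule integral_Re[OF integrable_torus_poisson[OF M h' r]])
  also have "\<dots> = (LINT y|M. cmod (h y))"
    by (simp add: integral_torus_poisson[OF M h' r])
  finally show ?thesis .
qed

lemma torus_poisson_diff:
  assumes M: "sets M = sets torus_borel" and f: "integrable M f" and g: "integrable M g" and r: "0 \<le> r" "r < 1" and z: "z \<in> torus"
  shows "torus_poisson M (\<lambda>y. f y - g y) r z = torus_poisson M f r z - torus_poisson M g r z"
  using Bochner_Integration.integrable_diff[OF torus_poisson_kernel(2)[OF M f r z] torus_poisson_kernel(2)[OF M g r z]]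
    torus_poisson_kernel(2)[OF M f r z] torus_poisson_kernel(2)[OF M g r z]
  unfolding torus_poisson_kernel(1)[OF M f r z] torus_poisson_kernel(1)[OF M g r z]
    torus_poisson_kernel(1)[OF M Bochner_Integration.integrable_diff[OF f g] r z]
  by (simp add: left_diff_distrib)

text \<open>Clear for trigonometric polynomials, which are dense; by \<open>integral_norm_torus_poisson_le\<close> the error
  of the approximation does not grow under smoothing.\<close>

lemma torus_poisson_tendsto_L1:
  assumes f: "integrable haar f" and R: "\<And>k. 0 \<le> R k" "\<And>k. R k < 1" "filterlim R (at_left 1) sequentially"
  shows "(\<lambda>k. LINT z|haar. cmod (torus_poisson haar f (R k) z - f z)) \<longlonglongrightarrow> 0"
proof (rule LIMSEQ_I)
  fix e :: real assume e: "0 < e"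
  obtain q where q: "trig_polynomial q" "(LINT z|haar. cmod (f z - q z)) < e / 3"
    using trig_polynomials_dense_L1[OF f, of "e / 3"] e by auto
  have qi: "integrable haar q" by (intro trig_polynomial_integrable sets_haar haar.finite_measure q)
  have fq: "integrable haar (\<lambda>z. f z - q z)" using f qi by simp
  obtain Q B where QB: "poisson_smoothing q Q B" using trig_polynomial_smoothing[OF q(1)] by blast
  have Q: "trig_polynomial (Q (R k))" "\<And>y. y \<in> torus \<Longrightarrow> cmod (Q (R k) y) \<le> B"
      "\<And>y. y \<in> torus \<Longrightarrow> torus_poisson haar q (R k) y = Q (R k) y" for k
    using QB R(1,2)[of k] by (simp_all add: poisson_smoothing_def)
  have Ql: "(\<lambda>k. Q (R k) y) \<longlonglongrightarrow> q y" if "y \<in> torus" for y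
  proof -
    have "((\<lambda>r. Q r y) \<longlongrightarrow> q y) (at_left 1)" using QB that by (simp add: poisson_smoothing_def)
    from filterlim_compose[OF this R(3)] show ?thesis .
  qed
  obtain B' where B': "\<And>z. z \<in> torus \<Longrightarrow> cmod (q z) \<le> B'" using trig_polynomial_bounded[OF q(1)] by blast
  have "(\<lambda>k. LINT z|haar. cmod (Q (R k) z - q z)) \<longlonglongrightarrow> (LINT z|haar. 0)"
  proof (rule integral_dominated_convergence[where w = "\<lambda>_. B + B'"])
    have [measurable]: "q \<in> borel_measurable haar" "Q (R k) \<in> borel_measurable haar" for k
      unfolding measurable_haar_cong by (intro trig_polynomial_measurable q Q)+
    show "(\<lambda>z. cmod (Q (R k) z - q z)) \<in> borel_measurable haar" for k by measurable
    show "AE z in haar. (\<lambda>k. cmod (Q (R k) z - q z)) \<longlonglongrightarrow> 0"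
      by (rule AE_I2) (simp add: space_haar Ql tendsto_norm_zero LIM_zero)
    show "AE z in haar. norm (cmod (Q (R k) z - q z)) \<le> B + B'" for k
      using Q(2)[of _ k] B' by (intro AE_I2) (auto simp: space_haar intro!: order.trans[OF norm_triangle_ineq4] add_mono)
  qed auto
  then have "\<forall>\<^sub>F k in sequentially. (LINT z|haar. cmod (Q (R k) z - q z)) < e / 3"
    using e by (intro order_tendstoD) auto
  then obtain N where N: "\<And>k. N \<le> k \<Longrightarrow> (LINT z|haar. cmod (Q (R k) z - q z)) < e / 3"
    unfolding eventually_sequentially by blast
  have "norm ((LINT z|haar. cmod (torus_poisson haar f (R k) z - f z)) - 0) < e" if k: "N \<le> k" for k
  proof -
    note Rk = R(1,2)[of k]
    have i1: "integrable haar (torus_poisson haar f (R k))" "integrable haar (torus_poisson haar (\<lambda>z. f z - q z) (R k))"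
      by (intro integrable_torus_poisson sets_haar Rk f fq)+
    have i2: "integrable haar (Q (R k))" by (intro trig_polynomial_integrable sets_haar haar.finite_measure Q)
    have "(LINT z|haar. cmod (torus_poisson haar f (R k) z - f z)) \<le>
        (LINT z|haar. cmod (torus_poisson haar (\<lambda>z. f z - q z) (R k) z) + cmod (Q (R k) z - q z) + cmod (f z - q z))"
    proof (rule integral_mono)
      fix z assume "z \<in> space haar"
      then have z: "z \<in> torus" by (simp add: space_haar)
      have "torus_poisson haar f (R k) z - f z = torus_poisson haar (\<lambda>z. f z - q z) (R k) z + (Q (R k) z - q z) - (f z - q z)"
        by (simp add: torus_poisson_diff[OF sets_haar f qi Rk z] Q(3)[OF z])
      then show "cmod (torus_poisson haar f (R k) z - f z) \<le>
          cmod (torus_poisson haar (\<lambda>z. f z - q z) (R k) z) + cmod (Q (R k) z - q z) + cmod (f z - q z)"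
        by (simp only: norm_add_diff_le)
    qed (use f qi i1 i2 in auto)
    also have "\<dots> = (LINT z|haar. cmod (torus_poisson haar (\<lambda>z. f z - q z) (R k) z)) + (LINT z|haar. cmod (Q (R k) z - q z)) + (LINT z|haar. cmod (f z - q z))"
      using f qi i1 i2 by simp
    also have "\<dots> < e / 3 + e / 3 + e / 3"
      using integral_norm_torus_poisson_le[OF sets_haar fq Rk] q(2) N[OF k] by linarith
    finally show ?thesis by simp
  qed
  then show "\<exists>no. \<forall>n\<ge>no. norm ((LINT z|haar. cmod (torus_poisson haar f (R n) z - f z)) - 0) < e" by blast
qed

abbreviation jordan_torus :: "((nat \<Rightarrow> complex) set \<Rightarrow> complex) \<Rightarrow> nat \<Rightarrow> (nat \<Rightarrow> complex) measure" where
  "jordan_torus \<mu> \<equiv> jordan_part torus_borel \<mu>"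

context
  fixes \<mu> :: "(nat \<Rightarrow> complex) set \<Rightarrow> complex"
  assumes \<mu>: "complex_measure torus_borel \<mu>"
begin

lemma sets_jordan_torus: "sets (jordan_torus \<mu> k) = sets torus_borel"
  by (rule sets_jordan_part[OF \<mu>])

lemma integrable_one_jordan_torus: "integrable (jordan_torus \<mu> k) (\<lambda>_. 1 :: complex)"
  using finite_measure_jordan_part[OF \<mu>, of k] by (simp add: finite_measure.integrable_const)

lemma fourier_coeff_eq: "fourier_coeff \<mu> \<nu> = (\<Sum>k<4. \<i> ^ k * (LINT y|jordan_torus \<mu> k. 1 * cnj (character \<nu> y)))"
  unfolding fourier_coeff_def complex_integral_eq
  by (intro sum.cong refl arg_cong2[where f = "(*)"] Bochner_Integration.integral_cong)
     (simp add: space_eq_torus[OF sets_jordan_torus] character_uminus)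

lemma norm_fourier_coeff_le: "cmod (fourier_coeff \<mu> \<nu>) \<le> (\<Sum>k<4. measure (jordan_torus \<mu> k) torus)"
  unfolding fourier_coeff_eq
proof (rule sum_norm_le)
  fix k :: nat
  have "cmod (LINT y|jordan_torus \<mu> k. 1 * cnj (character \<nu> y)) \<le> (LINT y|jordan_torus \<mu> k. cmod 1)"
    by (rule norm_coefficient_le[OF sets_jordan_torus integrable_one_jordan_torus, of 0]) auto
  then show "cmod (\<i> ^ k * (LINT y|jordan_torus \<mu> k. 1 * cnj (character \<nu> y))) \<le> measure (jordan_torus \<mu> k) torus"
    by (simp add: norm_mult norm_power space_eq_torus[OF sets_jordan_torus])
qed

lemma radial_mean_has_sum:
  assumes r: "0 \<le> r" "r < 1" and z: "z \<in> torus"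
  shows "((\<lambda>\<nu>. fourier_coeff \<mu> \<nu> * of_real r ^ weight \<nu> * character \<nu> z) has_sum
     (\<Sum>k<4. \<i> ^ k * torus_poisson (jordan_torus \<mu> k) (\<lambda>_. 1) r z)) Z0"
proof -
  have "((\<lambda>\<nu>. (LINT y|jordan_torus \<mu> k. 1 * cnj (character \<nu> y)) * of_real r ^ weight \<nu> * character \<nu> z)
      has_sum torus_poisson (jordan_torus \<mu> k) (\<lambda>_. 1) r z) Z0" for k
    unfolding torus_poisson_def
    by (rule has_sum_infsum[OF torus_poisson_summable[OF sets_jordan_torus integrable_one_jordan_torus r z]])
  then have "((\<lambda>\<nu>. \<Sum>k<4. \<i> ^ k * ((LINT y|jordan_torus \<mu> k. 1 * cnj (character \<nu> y)) * of_real r ^ weight \<nu> * character \<nu> z)) has_sum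
     (\<Sum>k<4. \<i> ^ k * torus_poisson (jordan_torus \<mu> k) (\<lambda>_. 1) r z)) Z0"
    by (intro has_sum_finite_sum has_sum_cmult_right) auto
  then show ?thesis by (simp only: fourier_coeff_eq sum_distrib_right mult.assoc)
qed

lemma radial_mean_eq:
  assumes r: "0 \<le> r" "r < 1" and z: "z \<in> torus"
  shows "radial_mean \<mu> r z = (\<Sum>k<4. \<i> ^ k * torus_poisson (jordan_torus \<mu> k) (\<lambda>_. 1) r z)"
  unfolding radial_mean_def by (rule infsumI[OF radial_mean_has_sum[OF assms]])

lemma integrable_radial_mean:
  assumes r: "0 \<le> r" "r < 1"
  shows "integrable haar (radial_mean \<mu> r)"
proof -
  have "integrable haar (\<lambda>z. \<Sum>k<4. \<i> ^ k * torus_poisson (jordan_torus \<mu> k) (\<lambda>_. 1) r z)"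
    by (intro Bochner_Integration.integrable_sum integrable_mult_right integrable_torus_poisson sets_jordan_torus integrable_one_jordan_torus r)
  then show ?thesis
    by (rule Bochner_Integration.integrable_cong[THEN iffD1, rotated 2]) (simp_all add: space_haar radial_mean_eq r)
qed

lemma norm_radial_mean_le:
  assumes r: "0 \<le> r" "r < 1" and z: "z \<in> torus"
  shows "cmod (radial_mean \<mu> r z) \<le> (\<Sum>k<4. cmod (torus_poisson (jordan_torus \<mu> k) (\<lambda>_. 1) r z))"
  unfolding radial_mean_eq[OF assms] by (rule sum_norm_le) (simp add: norm_mult norm_power)

lemma integral_norm_radial_mean_le:
  assumes r: "0 \<le> r" "r < 1"
  shows "(LINT z|haar. cmod (radial_mean \<mu> r z)) \<le> (\<Sum>k<4. measure (jordan_torus \<mu> k) torus)"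
proof -
  have i: "integrable haar (\<lambda>z. cmod (torus_poisson (jordan_torus \<mu> k) (\<lambda>_. 1) r z))" for k
    by (intro integrable_norm integrable_torus_poisson sets_jordan_torus integrable_one_jordan_torus r)
  have "(LINT z|haar. cmod (radial_mean \<mu> r z)) \<le> (LINT z|haar. (\<Sum>k<4. cmod (torus_poisson (jordan_torus \<mu> k) (\<lambda>_. 1) r z)))"
    by (intro integral_mono integrable_norm integrable_radial_mean r Bochner_Integration.integrable_sum i)
       (simp add: space_haar norm_radial_mean_le r)
  also have "\<dots> = (\<Sum>k<4. LINT z|haar. cmod (torus_poisson (jordan_torus \<mu> k) (\<lambda>_. 1) r z))"
    by (rule Bochner_Integration.integral_sum[OF i])
  also have "\<dots> \<le> (\<Sum>k<4. measure (jordan_torus \<mu> k) torus)"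
  proof (rule sum_mono)
    fix k :: nat
    have "(LINT z|haar. cmod (torus_poisson (jordan_torus \<mu> k) (\<lambda>_. 1) r z)) \<le> (LINT y|jordan_torus \<mu> k. cmod 1)"
      by (rule integral_norm_torus_poisson_le[OF sets_jordan_torus integrable_one_jordan_torus r])
    then show "(LINT z|haar. cmod (torus_poisson (jordan_torus \<mu> k) (\<lambda>_. 1) r z)) \<le> measure (jordan_torus \<mu> k) torus"
      by (simp add: space_eq_torus[OF sets_jordan_torus])
  qed
  finally show ?thesis .
qed

end

section \<open>Radial means along the orbits of the flow\<close>

text \<open>Grouping the indices by their weight gives a power series.\<close>

lemma holomorphic_weighted_series:
  assumes S: "S \<subseteq> Z0" and d: "\<And>\<nu>. \<nu> \<in> S \<Longrightarrow> cmod (d \<nu>) \<le> C"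
  shows "(\<lambda>w. \<Sum>\<^sub>\<infinity>\<nu>\<in>S. d \<nu> * w ^ weight \<nu>) holomorphic_on ball 0 1"
    and "cmod w < 1 \<Longrightarrow> (\<lambda>\<nu>. d \<nu> * w ^ weight \<nu>) summable_on S"
proof -
  have sm: "(\<lambda>\<nu>. d \<nu> * w ^ weight \<nu>) summable_on S" if w: "cmod w < 1" for w
  proof -
    have "(\<lambda>\<nu>. C * cmod w ^ weight \<nu>) summable_on S"
      by (intro summable_on_cmult_right summable_on_subset_banach[OF summable_weight S]) (use w in auto)
    then have "(\<lambda>\<nu>. norm (d \<nu> * w ^ weight \<nu>)) summable_on S"
      by (rule summable_on_comparison_test) (use d in \<open>auto simp: norm_mult norm_power intro!: mult_right_mono\<close>)
    then show ?thesis by (rule abs_summable_summable)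
  qed
  then show "cmod w < 1 \<Longrightarrow> (\<lambda>\<nu>. d \<nu> * w ^ weight \<nu>) summable_on S" .
  define L where "L n = {\<nu>\<in>S. weight \<nu> = n}" for n
  define a where "a n = (\<Sum>\<^sub>\<infinity>\<nu>\<in>L n. d \<nu>)" for n
  show "(\<lambda>w. \<Sum>\<^sub>\<infinity>\<nu>\<in>S. d \<nu> * w ^ weight \<nu>) holomorphic_on ball 0 1"
  proof (rule power_series_holomorphic[where a = a])
    fix w :: complex assume "w \<in> ball 0 1"
    then have w: "cmod w < 1" by simp
    have "((\<lambda>\<nu>. d \<nu> * w ^ weight \<nu>) has_sum (\<Sum>\<^sub>\<infinity>\<nu>\<in>S. d \<nu> * w ^ weight \<nu>)) S"
      using sm[OF w] by simp
    moreover have "bij_betw snd (Sigma UNIV L) S"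
      by (rule bij_betwI[where g = "\<lambda>\<nu>. (weight \<nu>, \<nu>)"]) (auto simp: L_def)
    ultimately have "((\<lambda>x. d (snd x) * w ^ weight (snd x)) has_sum (\<Sum>\<^sub>\<infinity>\<nu>\<in>S. d \<nu> * w ^ weight \<nu>)) (Sigma UNIV L)"
      using has_sum_reindex_bij_betw[of snd "Sigma UNIV L" S "\<lambda>\<nu>. d \<nu> * w ^ weight \<nu>"] by simp
    then have "((\<lambda>n. \<Sum>\<^sub>\<infinity>\<nu>\<in>L n. d \<nu> * w ^ weight \<nu>) has_sum (\<Sum>\<^sub>\<infinity>\<nu>\<in>S. d \<nu> * w ^ weight \<nu>)) UNIV"
    proof (rule has_sum_SigmaD)
      fix n
      show "((\<lambda>y. d (snd (n, y)) * w ^ weight (snd (n, y))) has_sum (\<Sum>\<^sub>\<infinity>\<nu>\<in>L n. d \<nu> * w ^ weight \<nu>)) (L n)"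
        using summable_on_subset_banach[OF sm[OF w], of "L n"] by (simp add: L_def)
    qed
    moreover have "(\<Sum>\<^sub>\<infinity>\<nu>\<in>L n. d \<nu> * w ^ weight \<nu>) = a n * (w - 0) ^ n" for n
    proof -
      have "(\<Sum>\<^sub>\<infinity>\<nu>\<in>L n. d \<nu> * w ^ weight \<nu>) = (\<Sum>\<^sub>\<infinity>\<nu>\<in>L n. d \<nu> * w ^ n)"
        by (rule infsum_cong) (simp add: L_def)
      then show ?thesis by (simp add: a_def infsum_cmult_left')
    qed
    ultimately show "(\<lambda>n. a n * (w - 0) ^ n) sums (\<Sum>\<^sub>\<infinity>\<nu>\<in>S. d \<nu> * w ^ weight \<nu>)"
      by (simp add: has_sum_imp_sums)
  qed
qed

lemma character_cis_weights:
  assumes "\<nu> \<in> N0"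
  shows "character \<nu> (\<lambda>j. cis (real (Suc j) * s)) = cis s ^ weight \<nu>"
proof -
  have "cis (real (Suc j) * s) powi \<nu> j = cis s ^ (Suc j * nat \<bar>\<nu> j\<bar>)" for j
  proof -
    have "0 \<le> \<nu> j" using assms by (simp add: N0_def)
    then have powi: "x powi \<nu> j = x ^ nat \<bar>\<nu> j\<bar>" for x :: complex
      by (simp add: power_int_def)
    show ?thesis unfolding powi power_mult Complex.DeMoivre ..
  qed
  then show ?thesis by (simp add: character_def weight_def power_sum)
qed

lemma cis_weights_in_torus: "(\<lambda>j. cis (real (Suc j) * s)) \<in> torus"
  by (simp add: torus_def)

text \<open>On \<^const>\<open>N0\<close> the flow and the radius combine to a power of $w = r e^{is}$, on its negative to a power of
  the conjugate of $w$. The zero index lies in both sets and is assigned to the first.\<close>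

lemma radial_slice:
  assumes c: "\<And>\<nu>. \<nu> \<in> Z0 \<Longrightarrow> cmod (c \<nu>) \<le> C" and c0: "\<And>\<nu>. \<nu> \<in> Z0 - (N0 \<union> uminus ` N0) \<Longrightarrow> c \<nu> = 0"
    and z: "z \<in> torus"
  shows "\<exists>A B. A holomorphic_on ball 0 1 \<and> B holomorphic_on ball 0 1 \<and>
    (\<forall>r s. 0 \<le> r \<longrightarrow> r < 1 \<longrightarrow>
      (\<Sum>\<^sub>\<infinity>\<nu>\<in>Z0. c \<nu> * of_real r ^ weight \<nu> * character \<nu> (torus_flow s z)) = A (of_real r * cis s) + cnj (B (of_real r * cis s)))"
proof -
  define S where "S = uminus ` N0 - N0"
  have N0: "N0 \<subseteq> Z0" by (auto simp: N0_def)
  have uZ: "uminus ` N0 \<subseteq> Z0"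
    using N0 Z0_uminus by (auto simp: fun_Compl_def)
  then have S: "S \<subseteq> Z0" by (auto simp: S_def)
  define A where "A w = (\<Sum>\<^sub>\<infinity>\<nu>\<in>N0. (c \<nu> * character \<nu> z) * w ^ weight \<nu>)" for w
  define B where "B w = (\<Sum>\<^sub>\<infinity>\<nu>\<in>S. cnj (c \<nu> * character \<nu> z) * w ^ weight \<nu>)" for w
  have dA: "cmod (c \<nu> * character \<nu> z) \<le> C" if "\<nu> \<in> N0" for \<nu>
    using c that N0 by (auto simp: norm_mult norm_character z)
  have dB: "cmod (cnj (c \<nu> * character \<nu> z)) \<le> C" if "\<nu> \<in> S" for \<nu>
    using c that S by (auto simp: norm_mult norm_character z)
  have A: "A holomorphic_on ball 0 1" unfolding A_def by (rule holomorphic_weighted_series(1)[OF N0 dA])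
  have B: "B holomorphic_on ball 0 1" unfolding B_def by (rule holomorphic_weighted_series(1)[OF S dB])
  have "(\<Sum>\<^sub>\<infinity>\<nu>\<in>Z0. c \<nu> * of_real r ^ weight \<nu> * character \<nu> (torus_flow s z)) = A (of_real r * cis s) + cnj (B (of_real r * cis s))"
    if r: "0 \<le> r" "r < 1" for r s
  proof -
    let ?w = "complex_of_real r * cis s"
    have w: "cmod ?w < 1" using r by (simp add: norm_mult)
    have fl: "character \<nu> (torus_flow s z) = character \<nu> z * character \<nu> (\<lambda>j. cis (real (Suc j) * s))" for \<nu>
      unfolding torus_flow_def by (rule character_mult)
    have tA: "c \<nu> * of_real r ^ weight \<nu> * character \<nu> (torus_flow s z) = (c \<nu> * character \<nu> z) * ?w ^ weight \<nu>" if "\<nu> \<in> N0" for \<nu>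
      unfolding fl character_cis_weights[OF that] power_mult_distrib by (simp only: mult_ac)
    have tB: "c \<nu> * of_real r ^ weight \<nu> * character \<nu> (torus_flow s z) = cnj (cnj (c \<nu> * character \<nu> z) * ?w ^ weight \<nu>)" if \<nu>: "\<nu> \<in> S" for \<nu>
    proof -
      obtain \<nu>' where \<nu>': "\<nu>' \<in> N0" "\<nu> = (\<lambda>j. - \<nu>' j)" using \<nu> by (auto simp: S_def fun_Compl_def)
      have "character \<nu> (\<lambda>j. cis (real (Suc j) * s)) = cnj (cis s ^ weight \<nu>)"
        using \<nu>' character_cis_weights[of \<nu>' s] by (simp add: character_uminus[OF cis_weights_in_torus] weight_uminus del: of_nat_Suc)
      then show ?thesis by (simp add: fl power_mult_distrib mult_ac del: of_nat_Suc)
    qed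
    have "(\<Sum>\<^sub>\<infinity>\<nu>\<in>Z0. c \<nu> * of_real r ^ weight \<nu> * character \<nu> (torus_flow s z))
        = (\<Sum>\<^sub>\<infinity>\<nu>\<in>N0 \<union> S. c \<nu> * of_real r ^ weight \<nu> * character \<nu> (torus_flow s z))"
      by (rule infsum_cong_neutral) (use c0 N0 S in \<open>auto simp: S_def\<close>)
    also have "\<dots> = (\<Sum>\<^sub>\<infinity>\<nu>\<in>N0. c \<nu> * of_real r ^ weight \<nu> * character \<nu> (torus_flow s z)) +
        (\<Sum>\<^sub>\<infinity>\<nu>\<in>S. c \<nu> * of_real r ^ weight \<nu> * character \<nu> (torus_flow s z))"
    proof (rule infsum_Un_disjoint)
      show "(\<lambda>\<nu>. c \<nu> * of_real r ^ weight \<nu> * character \<nu> (torus_flow s z)) summable_on N0"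
        using holomorphic_weighted_series(2)[OF N0 dA w] by (simp add: tA cong: summable_on_cong)
      show "(\<lambda>\<nu>. c \<nu> * of_real r ^ weight \<nu> * character \<nu> (torus_flow s z)) summable_on S"
        using summable_on_cnj_iff[THEN iffD2, OF holomorphic_weighted_series(2)[OF S dB w]]
        by (simp only: tB cong: summable_on_cong)
    qed (auto simp: S_def)
    also have "(\<Sum>\<^sub>\<infinity>\<nu>\<in>N0. c \<nu> * of_real r ^ weight \<nu> * character \<nu> (torus_flow s z)) = A ?w"
      unfolding A_def by (rule infsum_cong[OF tA])
    also have "(\<Sum>\<^sub>\<infinity>\<nu>\<in>S. c \<nu> * of_real r ^ weight \<nu> * character \<nu> (torus_flow s z)) = cnj (B ?w)"
      unfolding B_def infsum_cnj[symmetric] by (rule infsum_cong[OF tB])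
    finally show ?thesis .
  qed
  with A B show ?thesis by blast
qed

section \<open>Existence of radial limits\<close>

lemma limit_at_left_1_if_rational_Cauchy:
  fixes \<phi> :: "real \<Rightarrow> complex"
  assumes cont: "continuous_on {0..<1} \<phi>"
    and C: "\<And>e. 0 < e \<Longrightarrow> \<exists>b<1. \<forall>p q. b < real_of_rat p \<longrightarrow> real_of_rat p < 1 \<longrightarrow> b < real_of_rat q \<longrightarrow> real_of_rat q < 1 \<longrightarrow>
      cmod (\<phi> (of_rat p) - \<phi> (of_rat q)) \<le> e"
  shows "\<exists>L. (\<phi> \<longlongrightarrow> L) (at_left 1)"
proof -
  have R: "\<exists>b. 0 \<le> b \<and> b < 1 \<and> (\<forall>x y. b < x \<longrightarrow> x < 1 \<longrightarrow> b < y \<longrightarrow> y < 1 \<longrightarrow> cmod (\<phi> x - \<phi> y) \<le> e)" if e: "0 < e" for e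
  proof -
    obtain b0 where b0: "b0 < 1" "\<And>p q. b0 < real_of_rat p \<Longrightarrow> real_of_rat p < 1 \<Longrightarrow> b0 < real_of_rat q \<Longrightarrow> real_of_rat q < 1 \<Longrightarrow>
      cmod (\<phi> (of_rat p) - \<phi> (of_rat q)) \<le> e / 3"
      using C[of "e / 3"] e by auto
    define b where "b = max b0 0"
    have b: "b0 \<le> b" "0 \<le> b" "b < 1" using b0(1) by (auto simp: b_def)
    have near: "\<exists>p. b < real_of_rat p \<and> real_of_rat p < 1 \<and> cmod (\<phi> x - \<phi> (of_rat p)) \<le> e / 3" if x: "b < x" "x < 1" for x
    proof -
      have "x \<in> {0..<1}" using x b by auto
      then obtain d where d: "0 < d" "\<And>y. y \<in> {0..<1} \<Longrightarrow> dist y x < d \<Longrightarrow> dist (\<phi> y) (\<phi> x) < e / 3"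
        using cont e unfolding continuous_on_iff by (metis divide_pos_pos zero_less_numeral)
      obtain p where p: "x < real_of_rat p" "real_of_rat p < min 1 (x + d)"
        using of_rat_dense[of x "min 1 (x + d)"] x d(1) by auto
      have "0 < real_of_rat p" using p(1) x b by linarith
      then have "dist (\<phi> (of_rat p)) (\<phi> x) < e / 3"
        using p x b by (intro d(2)) (auto simp: dist_real_def)
      then show ?thesis using p x by (intro exI[of _ p]) (auto simp: dist_norm norm_minus_commute)
    qed
    have "cmod (\<phi> x - \<phi> y) \<le> e" if xy: "b < x" "x < 1" "b < y" "y < 1" for x y
    proof -
      obtain p where p: "b < real_of_rat p" "real_of_rat p < 1" "cmod (\<phi> x - \<phi> (of_rat p)) \<le> e / 3"
        using near[OF xy(1,2)] by blast
      obtain q where q: "b < real_of_rat q" "real_of_rat q < 1" "cmod (\<phi> y - \<phi> (of_rat q)) \<le> e / 3"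
        using near[OF xy(3,4)] by blast
      have pq: "cmod (\<phi> (of_rat p) - \<phi> (of_rat q)) \<le> e / 3" using p q b by (intro b0(2)) auto
      have "\<phi> x - \<phi> y = (\<phi> x - \<phi> (of_rat p)) + (\<phi> (of_rat p) - \<phi> (of_rat q)) - (\<phi> y - \<phi> (of_rat q))" by simp
      then have "cmod (\<phi> x - \<phi> y) \<le> cmod (\<phi> x - \<phi> (of_rat p)) + cmod (\<phi> (of_rat p) - \<phi> (of_rat q)) + cmod (\<phi> y - \<phi> (of_rat q))"
        by (simp only: norm_add_diff_le)
      then show ?thesis using p(3) q(3) pq by linarith
    qed
    then show ?thesis using b by (intro exI[of _ b]) auto
  qed
  define x where "x k = 1 - 1 / real (k + 2)" for k
  have "x \<longlonglongrightarrow> 1 - 0" unfolding x_def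
    by (intro tendsto_intros LIMSEQ_ignore_initial_segment[OF lim_1_over_n])
  then have x1: "x \<longlonglongrightarrow> 1" by simp
  have x_lt: "x k < 1" for k by (simp add: x_def)
  have "Cauchy (\<lambda>k. \<phi> (x k))"
  proof (rule CauchyI)
    fix e :: real assume "0 < e"
    then obtain b where b: "b < 1" "\<And>x y. b < x \<Longrightarrow> x < 1 \<Longrightarrow> b < y \<Longrightarrow> y < 1 \<Longrightarrow> cmod (\<phi> x - \<phi> y) \<le> e / 2"
      using R[of "e / 2"] by auto
    have "\<forall>\<^sub>F k in sequentially. b < x k" by (rule order_tendstoD(1)[OF x1 b(1)])
    then obtain N where N: "\<And>k. N \<le> k \<Longrightarrow> b < x k" unfolding eventually_sequentially by blast
    have "norm (\<phi> (x m) - \<phi> (x n)) < e" if "N \<le> m" "N \<le> n" for m n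
      using b(2)[OF N[OF that(1)] x_lt N[OF that(2)] x_lt] \<open>0 < e\<close> by simp
    then show "\<exists>M. \<forall>m\<ge>M. \<forall>n\<ge>M. norm (\<phi> (x m) - \<phi> (x n)) < e" by blast
  qed
  then obtain L where L: "(\<lambda>k. \<phi> (x k)) \<longlonglongrightarrow> L" using Cauchy_convergent convergent_def by blast
  have "(\<phi> \<longlongrightarrow> L) (at_left 1)"
  proof (rule tendstoI)
    fix e :: real assume e: "0 < e"
    then obtain b where b: "b < 1" "\<And>x y. b < x \<Longrightarrow> x < 1 \<Longrightarrow> b < y \<Longrightarrow> y < 1 \<Longrightarrow> cmod (\<phi> x - \<phi> y) \<le> e / 2"
      using R[of "e / 2"] by auto
    have close: "dist (\<phi> r) L < e" if r: "b < r" "r < 1" for r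
    proof -
      have "(\<lambda>k. cmod (\<phi> r - \<phi> (x k))) \<longlonglongrightarrow> cmod (\<phi> r - L)" by (intro tendsto_intros L)
      moreover have "\<forall>\<^sub>F k in sequentially. cmod (\<phi> r - \<phi> (x k)) \<le> e / 2"
        using order_tendstoD(1)[OF x1 b(1)] by eventually_elim (use b(2) r x_lt in auto)
      ultimately have "cmod (\<phi> r - L) \<le> e / 2" by (intro tendsto_upperbound) auto
      then show ?thesis using e by (simp add: dist_norm)
    qed
    show "\<forall>\<^sub>F r in at_left 1. dist (\<phi> r) L < e"
      using b(1) close by (intro eventually_at_leftI[of b]) auto
  qed
  then show ?thesis ..
qed

text \<open>By invariance the complement of \<open>A\<close> has the same measure as each of its preimages under the flow,
  and by Fubini's theorem almost all of these preimages are null sets.\<close>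

lemma AE_haar_if_AE_flow:
  assumes A: "A \<in> sets haar" and AE: "AE z in haar. AE s in angle. torus_flow s z \<in> A"
  shows "AE z in haar. z \<in> A"
proof -
  interpret P: pair_sigma_finite haar angle ..
  define N where "N = space haar - A"
  have N: "N \<in> sets haar" using A by (simp add: N_def)
  define u :: "(nat \<Rightarrow> complex) \<times> real \<Rightarrow> ennreal" where "u x = indicator N (torus_flow (snd x) (fst x))" for x
  have u: "u \<in> borel_measurable (haar \<Otimes>\<^sub>M angle)"
    unfolding u_def
    by (rule measurable_compose[OF measurable_torus_flow[unfolded case_prod_beta'] borel_measurable_indicator[OF N]])
  have "(\<integral>\<^sup>+s. (\<integral>\<^sup>+z. u (z, s) \<partial>haar) \<partial>angle) = emeasure haar N"
  proof -
    have "(\<integral>\<^sup>+z. u (z, s) \<partial>haar) = emeasure haar N" for s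
    proof -
      have "(\<integral>\<^sup>+z. u (z, s) \<partial>haar) = (\<integral>\<^sup>+z. indicator N z \<partial>distr haar haar (torus_flow s))"
        unfolding u_def fst_conv snd_conv
        by (rule nn_integral_distr[symmetric, OF measurable_torus_flow']) (simp add: borel_measurable_indicator N)
      then show ?thesis using N by (simp add: distr_torus_flow)
    qed
    then show ?thesis using angle.emeasure_space_1 by simp
  qed
  moreover have "(\<integral>\<^sup>+s. (\<integral>\<^sup>+z. u (z, s) \<partial>haar) \<partial>angle) = (\<integral>\<^sup>+z. (\<integral>\<^sup>+s. u (z, s) \<partial>angle) \<partial>haar)"
    by (rule P.Fubini[OF u])
  moreover have "(\<integral>\<^sup>+z. (\<integral>\<^sup>+s. u (z, s) \<partial>angle) \<partial>haar) = (\<integral>\<^sup>+z. 0 \<partial>haar)"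
  proof (rule nn_integral_cong_AE, use AE in eventually_elim)
    fix z assume "AE s in angle. torus_flow s z \<in> A"
    then have "(\<integral>\<^sup>+s. u (z, s) \<partial>angle) = (\<integral>\<^sup>+s. 0 \<partial>angle)"
      by (intro nn_integral_cong_AE) (auto elim!: eventually_mono simp: u_def N_def)
    then show "(\<integral>\<^sup>+s. u (z, s) \<partial>angle) = 0" by simp
  qed
  ultimately have "emeasure haar N = 0" by simp
  then have "AE z in haar. z \<notin> N" using N by (intro AE_not_in) auto
  then show ?thesis by (rule AE_mp) (auto intro!: AE_I2 simp: N_def)
qed

lemma liminf_finite_subsequence:
  fixes u :: "nat \<Rightarrow> ennreal"
  assumes "liminf u \<noteq> \<infinity>"
  shows "\<exists>(\<sigma> :: nat \<Rightarrow> nat) C. strict_mono \<sigma> \<and> 0 \<le> C \<and> (\<forall>k. u (\<sigma> k) \<le> ennreal C)"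
proof -
  obtain c where c: "0 \<le> c" "liminf u = ennreal c"
    using assms by (cases "liminf u") auto
  have "\<exists>\<^sub>F k in sequentially. u k < ennreal (c + 1)"
  proof (rule ccontr)
    assume "\<not> (\<exists>\<^sub>F k in sequentially. u k < ennreal (c + 1))"
    then have "\<forall>\<^sub>F k in sequentially. ennreal (c + 1) \<le> u k"
      by (simp add: frequently_def not_less)
    then have "ennreal (c + 1) \<le> liminf u" by (rule Liminf_bounded)
    then show False using c by simp
  qed
  then have "infinite {k. u k < ennreal (c + 1)}"
    by (simp add: frequently_cofinite[symmetric] cofinite_eq_sequentially)
  then obtain \<sigma> :: "nat \<Rightarrow> nat" where "strict_mono \<sigma>" "\<And>k. \<sigma> k \<in> {k. u k < ennreal (c + 1)}"
    using infinite_enumerate by blast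
  then show ?thesis using c(1) by (intro exI[of _ \<sigma>] exI[of _ "c + 1"]) (auto intro: less_imp_le)
qed

text \<open>The real and imaginary parts of \<open>A + cnj B\<close> are the real parts of the holomorphic functions \<open>A + B\<close>
  and \<open>- \<i> * (A - B)\<close>.\<close>

lemma Fatou_h1_pair:
  assumes A: "A holomorphic_on ball 0 1" and B: "B holomorphic_on ball 0 1"
    and R: "\<And>k. 0 \<le> R k" "\<And>k. R k < 1" "R \<longlonglongrightarrow> 1"
    and C: "\<And>k. (\<integral>\<^sup>+s. ennreal (cmod (A (of_real (R k) * cis s) + cnj (B (of_real (R k) * cis s)))) \<partial>angle) \<le> ennreal C" "0 \<le> C"
  shows "AE s in angle. \<exists>L. ((\<lambda>r. A (of_real r * cis s) + cnj (B (of_real r * cis s))) \<longlongrightarrow> L) (at_left 1)"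
proof -
  define G where "G w = A w + cnj (B w)" for w
  define H1 where "H1 w = A w + B w" for w
  define H2 where "H2 w = - \<i> * (A w - B w)" for w
  have H1: "H1 holomorphic_on ball 0 1" and H2: "H2 holomorphic_on ball 0 1"
    unfolding H1_def H2_def by (intro holomorphic_intros A B)+
  have Re: "Re (H1 w) = Re (G w)" and Im: "Re (H2 w) = Im (G w)" for w
    by (simp_all add: H1_def H2_def G_def)
  have bound: "(LINT t|angle. \<bar>Re (H (of_real (R k) * cis t))\<bar>) \<le> C"
    if H: "H holomorphic_on ball 0 1" and le: "\<And>w. \<bar>Re (H w)\<bar> \<le> cmod (G w)" for H k
  proof -
    have "integrable angle (\<lambda>t. \<bar>Re (H (of_real (R k) * cis t))\<bar>)"
      by (intro integrable_angle_continuous continuous_intros continuous_on_circle_of_holomorphic[OF H R(1,2)])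
    then have "ennreal (LINT t|angle. \<bar>Re (H (of_real (R k) * cis t))\<bar>) = (\<integral>\<^sup>+t. ennreal \<bar>Re (H (of_real (R k) * cis t))\<bar> \<partial>angle)"
      by (intro nn_integral_eq_integral[symmetric]) auto
    also have "\<dots> \<le> (\<integral>\<^sup>+t. ennreal (cmod (G (of_real (R k) * cis t))) \<partial>angle)"
      by (intro nn_integral_mono ennreal_leI le)
    also have "\<dots> \<le> ennreal C" using C(1)[of k] by (simp add: G_def)
    finally show ?thesis using C(2) by simp
  qed
  have "AE s in angle. \<exists>L. ((\<lambda>r. Re (H1 (of_real r * cis s))) \<longlongrightarrow> L) (at_left 1)"
    by (rule Fatou_h1[OF H1 R bound[OF H1]]) (simp add: Re abs_Re_le_cmod)
  moreover have "AE s in angle. \<exists>L. ((\<lambda>r. Re (H2 (of_real r * cis s))) \<longlongrightarrow> L) (at_left 1)"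
    by (rule Fatou_h1[OF H2 R bound[OF H2]]) (simp add: Im abs_Im_le_cmod)
  ultimately show ?thesis
  proof eventually_elim
    case (elim s)
    then obtain L1 L2 where "((\<lambda>r. Re (H1 (of_real r * cis s))) \<longlongrightarrow> L1) (at_left 1)"
        "((\<lambda>r. Re (H2 (of_real r * cis s))) \<longlongrightarrow> L2) (at_left 1)" by blast
    then have "((\<lambda>r. Complex (Re (H1 (of_real r * cis s))) (Re (H2 (of_real r * cis s)))) \<longlongrightarrow> Complex L1 L2) (at_left 1)"
      by (rule tendsto_Complex)
    then show ?case unfolding Re Im complex_surj G_def by blast
  qed
qed

text \<open>Fatou's lemma bounds the lower limit of the $L^1$ means over orbits, for almost every orbit; this
  yields a sequence of radii, depending on the orbit, to which \<open>Fatou_h1_pair\<close> applies. The result on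
  almost every orbit is transferred to the torus by \<open>AE_haar_if_AE_flow\<close>.\<close>

theorem AE_radial_limit_exists:
  assumes \<mu>: "complex_measure torus_borel \<mu>" and spec: "spectrum_in \<mu> (N0 \<union> uminus ` N0)"
  shows "AE z in haar. \<exists>L. ((\<lambda>r. radial_mean \<mu> r z) \<longlongrightarrow> L) (at_left 1)"
proof -
  define G where "G = radial_mean \<mu>"
  define K where "K = (\<Sum>k<4. measure (jordan_torus \<mu> k) torus)"
  have K0: "0 \<le> K" unfolding K_def by (intro sum_nonneg) simp
  have Gi: "integrable haar (G r)" if "0 \<le> r" "r < 1" for r
    unfolding G_def by (rule integrable_radial_mean[OF \<mu> that])
  have slice: "\<exists>A B. A holomorphic_on ball 0 1 \<and> B holomorphic_on ball 0 1 \<and>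
      (\<forall>r s. 0 \<le> r \<longrightarrow> r < 1 \<longrightarrow> G r (torus_flow s z) = A (of_real r * cis s) + cnj (B (of_real r * cis s)))"
    if "z \<in> torus" for z
    unfolding G_def radial_mean_def
    by (rule radial_slice[OF norm_fourier_coeff_le[OF \<mu>] _ that]) (use spec in \<open>auto simp: spectrum_in_def\<close>)
  define \<rho> where "\<rho> k = 1 - 1 / real (k + 2)" for k
  have \<rho>: "0 \<le> \<rho> k" "\<rho> k < 1" for k by (auto simp: \<rho>_def divide_simps)
  have "\<rho> \<longlonglongrightarrow> 1 - 0" unfolding \<rho>_def
    by (intro tendsto_intros LIMSEQ_ignore_initial_segment[OF lim_1_over_n])
  then have \<rho>1: "\<rho> \<longlonglongrightarrow> 1" by simp
  interpret P: pair_sigma_finite haar angle ..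
  define u where "u k x = ennreal (cmod (G (\<rho> k) (torus_flow (snd x) (fst x))))" for k x
  have Gm: "G (\<rho> k) \<in> borel_measurable haar" for k using Gi[OF \<rho>] by simp
  have um [measurable]: "u k \<in> borel_measurable (haar \<Otimes>\<^sub>M angle)" for k
  proof -
    have "(\<lambda>x. G (\<rho> k) (torus_flow (snd x) (fst x))) \<in> borel_measurable (haar \<Otimes>\<^sub>M angle)"
      by (rule measurable_compose[OF measurable_torus_flow[unfolded case_prod_beta'] Gm])
    then show ?thesis unfolding u_def[abs_def] by measurable
  qed
  have uK: "(\<integral>\<^sup>+z. (\<integral>\<^sup>+s. u k (z, s) \<partial>angle) \<partial>haar) \<le> ennreal K" for k
  proof -
    have inner: "(\<integral>\<^sup>+z. u k (z, s) \<partial>haar) \<le> ennreal K" for s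
    proof -
      have "(\<integral>\<^sup>+z. u k (z, s) \<partial>haar) = (\<integral>\<^sup>+z. ennreal (cmod (G (\<rho> k) z)) \<partial>distr haar haar (torus_flow s))"
        unfolding u_def fst_conv snd_conv
        by (rule nn_integral_distr[symmetric, OF measurable_torus_flow']) (use Gm in measurable)
      also have "\<dots> = ennreal (LINT z|haar. cmod (G (\<rho> k) z))"
        unfolding distr_torus_flow by (rule nn_integral_eq_integral) (use Gi[OF \<rho>] in auto)
      also have "\<dots> \<le> ennreal K"
        unfolding G_def K_def by (rule ennreal_leI[OF integral_norm_radial_mean_le[OF \<mu> \<rho>]])
      finally show ?thesis .
    qed
    have "(\<integral>\<^sup>+z. (\<integral>\<^sup>+s. u k (z, s) \<partial>angle) \<partial>haar) = (\<integral>\<^sup>+s. (\<integral>\<^sup>+z. u k (z, s) \<partial>haar) \<partial>angle)"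
      by (rule P.Fubini[OF um, symmetric])
    also have "\<dots> \<le> (\<integral>\<^sup>+s. ennreal K \<partial>angle)" by (intro nn_integral_mono inner)
    also have "\<dots> = ennreal K" using angle.emeasure_space_1 by simp
    finally show ?thesis .
  qed
  have "(\<integral>\<^sup>+z. liminf (\<lambda>k. \<integral>\<^sup>+s. u k (z, s) \<partial>angle) \<partial>haar) \<le> liminf (\<lambda>k. \<integral>\<^sup>+z. (\<integral>\<^sup>+s. u k (z, s) \<partial>angle) \<partial>haar)"
    by (rule nn_integral_liminf) (rule angle.borel_measurable_nn_integral_fst[OF um])
  also have "\<dots> \<le> liminf (\<lambda>k. ennreal K)" by (intro Liminf_mono always_eventually allI uK)
  also have "\<dots> = ennreal K" by (simp add: Liminf_const)
  finally have "(\<integral>\<^sup>+z. liminf (\<lambda>k. \<integral>\<^sup>+s. u k (z, s) \<partial>angle) \<partial>haar) \<noteq> \<infinity>" by (auto simp: top_unique)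
  moreover have "(\<lambda>z. liminf (\<lambda>k. \<integral>\<^sup>+s. u k (z, s) \<partial>angle)) \<in> borel_measurable haar"
    by (intro borel_measurable_liminf angle.borel_measurable_nn_integral_fst um)
  ultimately have "AE z in haar. liminf (\<lambda>k. \<integral>\<^sup>+s. u k (z, s) \<partial>angle) \<noteq> \<infinity>"
    by (rule nn_integral_PInf_AE[rotated])
  moreover have "AE z in haar. z \<in> torus" by (rule AE_I2) (simp add: space_haar)
  ultimately have flow: "AE z in haar. AE s in angle. \<exists>L. ((\<lambda>r. G r (torus_flow s z)) \<longlongrightarrow> L) (at_left 1)"
  proof eventually_elim
    case (elim z)
    obtain A B where AB: "A holomorphic_on ball 0 1" "B holomorphic_on ball 0 1"
        "\<And>r s. 0 \<le> r \<Longrightarrow> r < 1 \<Longrightarrow> G r (torus_flow s z) = A (of_real r * cis s) + cnj (B (of_real r * cis s))"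
      using slice[OF elim(2)] by blast
    obtain \<sigma> :: "nat \<Rightarrow> nat" and C where \<sigma>: "strict_mono \<sigma>" "0 \<le> C" "\<And>k. (\<integral>\<^sup>+s. u (\<sigma> k) (z, s) \<partial>angle) \<le> ennreal C"
      using liminf_finite_subsequence[OF elim(1)] by blast
    have "AE s in angle. \<exists>L. ((\<lambda>r. A (of_real r * cis s) + cnj (B (of_real r * cis s))) \<longlongrightarrow> L) (at_left 1)"
    proof (rule Fatou_h1_pair[OF AB(1,2), of "\<lambda>k. \<rho> (\<sigma> k)"])
      show "(\<lambda>k. \<rho> (\<sigma> k)) \<longlonglongrightarrow> 1" using LIMSEQ_subseq_LIMSEQ[OF \<rho>1 \<sigma>(1)] by (simp add: o_def)
      show "(\<integral>\<^sup>+s. ennreal (cmod (A (of_real (\<rho> (\<sigma> k)) * cis s) + cnj (B (of_real (\<rho> (\<sigma> k)) * cis s)))) \<partial>angle) \<le> ennreal C" for k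
        using \<sigma>(3)[of k] by (simp add: u_def AB(3)[OF \<rho>])
    qed (use \<rho> \<sigma>(2) in auto)
    then show ?case
    proof eventually_elim
      case (elim s)
      then obtain L where "((\<lambda>r. A (of_real r * cis s) + cnj (B (of_real r * cis s))) \<longlongrightarrow> L) (at_left 1)" by blast
      moreover have "\<forall>\<^sub>F r in at_left 1. A (of_real r * cis s) + cnj (B (of_real r * cis s)) = G r (torus_flow s z)"
        by (rule eventually_at_leftI[of 0]) (simp_all add: AB(3))
      ultimately have "((\<lambda>r. G r (torus_flow s z)) \<longlongrightarrow> L) (at_left 1)" by (rule Lim_transform_eventually)
      then show ?case by blast
    qed
  qed
  \<comment> \<open>rational radii make the set of convergence measurable; radii outside of the unit interval are replaced by 0\<close>
  define g where "g p = G (if 0 \<le> real_of_rat p \<and> real_of_rat p < 1 then real_of_rat p else 0)" for p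
  have [measurable]: "g p \<in> borel_measurable haar" for p
    unfolding g_def by (rule borel_measurable_integrable[OF Gi]) auto
  define good where "good = {z \<in> space haar. \<forall>n::nat. \<exists>m::nat. \<forall>p q.
     1 - 1 / real (Suc m) < real_of_rat p \<longrightarrow> real_of_rat p < 1 \<longrightarrow> 1 - 1 / real (Suc m) < real_of_rat q \<longrightarrow> real_of_rat q < 1 \<longrightarrow>
       cmod (g p z - g q z) \<le> 1 / real (Suc n)}"
  have good: "good \<in> sets haar" unfolding good_def by measurable
  have g_eq: "g p z = G (of_rat p) z" if "1 - 1 / real (Suc m) < real_of_rat p" "real_of_rat p < 1" for p m z
  proof -
    have "(0::real) \<le> 1 - 1 / real (Suc m)" by (simp add: divide_simps)
    then have "0 < real_of_rat p" using that(1) by linarith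
    then show ?thesis using that(2) by (simp add: g_def)
  qed
  have limit_good: "z \<in> good" if z: "z \<in> torus" and L: "((\<lambda>r. G r z) \<longlongrightarrow> L) (at_left 1)" for z L
  proof -
    have "\<exists>m::nat. \<forall>p q. 1 - 1 / real (Suc m) < real_of_rat p \<longrightarrow> real_of_rat p < 1 \<longrightarrow> 1 - 1 / real (Suc m) < real_of_rat q \<longrightarrow> real_of_rat q < 1 \<longrightarrow>
       cmod (g p z - g q z) \<le> 1 / real (Suc n)" for n
    proof -
      define e where "e = 1 / real (Suc n)"
      have e: "0 < e" by (simp add: e_def)
      have "\<forall>\<^sub>F r in at_left 1. dist (G r z) L < e / 2" by (rule tendstoD[OF L]) (use e in simp)
      then obtain b where b: "b < 1" "\<And>r. b < r \<Longrightarrow> r < 1 \<Longrightarrow> dist (G r z) L < e / 2"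
        unfolding eventually_at_left_field by blast
      obtain m where m: "1 / real (Suc m) < 1 - b" using nat_approx_posE[of "1 - b"] b(1) by auto
      have "cmod (g p z - g q z) \<le> e"
        if p: "1 - 1 / real (Suc m) < real_of_rat p" "real_of_rat p < 1" and q: "1 - 1 / real (Suc m) < real_of_rat q" "real_of_rat q < 1" for p q
      proof -
        have "b < real_of_rat p" "b < real_of_rat q" using p q m by linarith+
        then have "dist (G (of_rat p) z) L < e / 2" "dist (G (of_rat q) z) L < e / 2"
          using p q b(2) by blast+
        then have "dist (G (of_rat p) z) (G (of_rat q) z) < e" by (rule dist_triangle_half_l)
        then show ?thesis unfolding g_eq[OF p] g_eq[OF q] dist_norm by simp
      qed
      then show ?thesis unfolding e_def by blast
    qed
    then show ?thesis using z by (simp add: good_def space_haar)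
  qed
  have good_limit: "\<exists>L. ((\<lambda>r. G r z) \<longlongrightarrow> L) (at_left 1)" if z: "z \<in> good" for z
  proof (rule limit_at_left_1_if_rational_Cauchy)
    have zt: "z \<in> torus" using z by (simp add: good_def space_haar)
    obtain A B where AB: "A holomorphic_on ball 0 1" "B holomorphic_on ball 0 1"
        "\<And>r s. 0 \<le> r \<Longrightarrow> r < 1 \<Longrightarrow> G r (torus_flow s z) = A (of_real r * cis s) + cnj (B (of_real r * cis s))"
      using slice[OF zt] by blast
    have "torus_flow 0 z = z" by (simp add: torus_flow_def)
    then have eq: "G r z = A (of_real r) + cnj (B (of_real r))" if "r \<in> {0..<1}" for r
      using AB(3)[of r 0] that by simp
    have "continuous_on {0..<1} (\<lambda>r::real. A (of_real r) + cnj (B (of_real r)))"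
      by (intro continuous_intros continuous_on_compose2[OF holomorphic_on_imp_continuous_on[OF AB(1)]]
          continuous_on_compose2[OF holomorphic_on_imp_continuous_on[OF AB(2)]]) auto
    then show "continuous_on {0..<1} (\<lambda>r. G r z)" by (simp add: eq cong: continuous_on_cong_simp)
    fix e :: real assume "0 < e"
    then obtain n where n: "1 / real (Suc n) < e" using nat_approx_posE by blast
    obtain m where m: "\<And>p q. 1 - 1 / real (Suc m) < real_of_rat p \<Longrightarrow> real_of_rat p < 1 \<Longrightarrow> 1 - 1 / real (Suc m) < real_of_rat q \<Longrightarrow> real_of_rat q < 1 \<Longrightarrow>
       cmod (g p z - g q z) \<le> 1 / real (Suc n)"
      using z unfolding good_def by blast
    show "\<exists>b<1. \<forall>p q. b < real_of_rat p \<longrightarrow> real_of_rat p < 1 \<longrightarrow> b < real_of_rat q \<longrightarrow> real_of_rat q < 1 \<longrightarrow>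
      cmod (G (of_rat p) z - G (of_rat q) z) \<le> e"
    proof (intro exI[of _ "1 - 1 / real (Suc m)"] conjI allI impI)
      fix p q assume p: "1 - 1 / real (Suc m) < real_of_rat p" "real_of_rat p < 1" and q: "1 - 1 / real (Suc m) < real_of_rat q" "real_of_rat q < 1"
      show "cmod (G (of_rat p) z - G (of_rat q) z) \<le> e"
        using m[OF p q] n unfolding g_eq[OF p] g_eq[OF q] by linarith
    qed simp
  qed
  have "AE z in haar. AE s in angle. torus_flow s z \<in> good"
    using flow \<open>AE z in haar. z \<in> torus\<close>
  proof eventually_elim
    case (elim z)
    from elim(1) show ?case
      by eventually_elim (use elim(2) torus_flow_in_torus limit_good in blast)
  qed
  then have "AE z in haar. z \<in> good" by (rule AE_haar_if_AE_flow[OF good])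
  then show ?thesis by eventually_elim (use good_limit in \<open>simp add: G_def\<close>)
qed

section \<open>The value of the radial limit\<close>

lemma fourier_coeff_add_density:
  assumes \<mu>: "complex_measure torus_borel \<mu>" and \<mu>s: "complex_measure torus_borel \<mu>s" and f: "integrable haar f"
    and sum: "\<And>A. A \<in> sets torus_borel \<Longrightarrow> \<mu> A = density_measure haar f A + \<mu>s A"
  shows "fourier_coeff \<mu> \<nu> = (LINT z|haar. f z * cnj (character \<nu> z)) + fourier_coeff \<mu>s \<nu>"
    and "fourier_coeff (density_measure haar f) \<nu> = (LINT z|haar. f z * cnj (character \<nu> z))"
proof -
  define g where "g = character (\<lambda>j. - \<nu> j)"
  have g: "g \<in> bounded_measurable torus_borel"
    unfolding bounded_measurable_def g_def
    using measurable_character norm_character by (auto simp: space_torus_borel intro!: exI[of _ 1])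
  have F: "complex_measure torus_borel (density_measure haar f)"
    by (rule complex_measure_density_measure[OF f sets_haar[symmetric]])
  have "complex_integral torus_borel \<mu> g = complex_integral torus_borel (density_measure haar f) g + complex_integral torus_borel \<mu>s g"
  proof (rule continuous_functional_eqI[OF continuous_functional_complex_integral[OF \<mu>] _ _ g])
    show "continuous_functional torus_borel (\<lambda>g. complex_integral torus_borel (density_measure haar f) g + complex_integral torus_borel \<mu>s g)"
      by (intro continuous_functional_add continuous_functional_complex_integral F \<mu>s)
  qed (simp add: complex_integral_indicator[OF \<mu>] complex_integral_indicator[OF \<mu>s] complex_integral_indicator[OF F] sum)
  moreover have dens: "complex_integral torus_borel (density_measure haar f) g = (LINT z|haar. f z * cnj (character \<nu> z))"
    unfolding complex_integral_density_measure[OF f sets_haar[symmetric] F g]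
    by (intro Bochner_Integration.integral_cong refl) (simp add: g_def space_haar character_uminus)
  ultimately show "fourier_coeff \<mu> \<nu> = (LINT z|haar. f z * cnj (character \<nu> z)) + fourier_coeff \<mu>s \<nu>"
    by (simp add: fourier_coeff_def g_def)
  show "fourier_coeff (density_measure haar f) \<nu> = (LINT z|haar. f z * cnj (character \<nu> z))"
    using dens by (simp add: fourier_coeff_def g_def)
qed

text \<open>The square of the modulus of \<open>q\<close> is itself a trigonometric polynomial, so smoothing can be moved
  from the measure to it.\<close>

lemma integral_square_torus_poisson_one:
  assumes M: "sets M = sets torus_borel" "finite_measure M" and q: "trig_polynomial q"
    and R: "\<And>k. 0 \<le> R k" "\<And>k. R k < 1" "filterlim R (at_left 1) sequentially"
  shows "(\<lambda>k. LINT z|haar. (cmod (q z))\<^sup>2 * cmod (torus_poisson M (\<lambda>_. 1) (R k) z)) \<longlonglongrightarrow> (LINT y|M. (cmod (q y))\<^sup>2)"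
proof -
  interpret finite_measure M by fact
  have one: "integrable M (\<lambda>_. 1 :: complex)" by simp
  have sp: "space M = torus" by (rule space_eq_torus[OF M(1)])
  define p where "p z = q z * cnj (q z)" for z
  have p: "trig_polynomial p" unfolding p_def by (intro trig_polynomial_mult trig_polynomial_cnj q)
  have p_eq: "p z = of_real ((cmod (q z))\<^sup>2)" for z unfolding p_def by (rule complex_norm_square[symmetric])
  obtain Q B where QB: "poisson_smoothing p Q B" using trig_polynomial_smoothing[OF p] by blast
  have Q: "trig_polynomial (Q (R k))" "\<And>y. y \<in> torus \<Longrightarrow> cmod (Q (R k) y) \<le> B"
      "(LINT z|haar. p z * torus_poisson M (\<lambda>_. 1) (R k) z) = (LINT y|M. 1 * Q (R k) y)" for k
    using QB R(1,2)[of k] M(1) one by (simp_all add: poisson_smoothing_def)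
  have Ql: "(\<lambda>k. Q (R k) y) \<longlonglongrightarrow> p y" if "y \<in> torus" for y
  proof -
    have "((\<lambda>r. Q r y) \<longlongrightarrow> p y) (at_left 1)" using QB that by (simp add: poisson_smoothing_def)
    from filterlim_compose[OF this R(3)] show ?thesis .
  qed
  have "(\<lambda>k. LINT y|M. Q (R k) y) \<longlonglongrightarrow> (LINT y|M. p y)"
  proof (rule integral_dominated_convergence[where w = "\<lambda>_. B"])
    show "p \<in> borel_measurable M" "Q (R k) \<in> borel_measurable M" for k
      unfolding measurable_cong_sets[OF M(1) refl] by (intro trig_polynomial_measurable p Q)+
    show "AE y in M. (\<lambda>k. Q (R k) y) \<longlonglongrightarrow> p y" by (rule AE_I2) (simp add: sp Ql)
    show "AE y in M. norm (Q (R k) y) \<le> B" for k by (rule AE_I2) (simp add: sp Q)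
  qed simp
  then have "(\<lambda>k. Re (LINT z|haar. p z * torus_poisson M (\<lambda>_. 1) (R k) z)) \<longlonglongrightarrow> Re (LINT y|M. p y)"
    unfolding Q(3) mult_1 by (intro tendsto_Re)
  moreover have "Re (LINT y|M. p y) = (LINT y|M. (cmod (q y))\<^sup>2)"
    unfolding p_eq integral_complex_of_real by simp
  moreover have "Re (LINT z|haar. p z * torus_poisson M (\<lambda>_. 1) (R k) z) = (LINT z|haar. (cmod (q z))\<^sup>2 * cmod (torus_poisson M (\<lambda>_. 1) (R k) z))" for k
  proof -
    have "p z * torus_poisson M (\<lambda>_. 1) (R k) z = of_real ((cmod (q z))\<^sup>2 * cmod (torus_poisson M (\<lambda>_. 1) (R k) z))" if z: "z \<in> torus" for z
    proof -
      have "torus_poisson M (\<lambda>_. 1) (R k) z = of_real (Re (torus_poisson M (\<lambda>_. 1) (R k) z))"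
        "cmod (torus_poisson M (\<lambda>_. 1) (R k) z) \<le> Re (torus_poisson M (\<lambda>_. 1) (R k) z)"
        using torus_poisson_abs[OF M(1) one R(1,2) z] by simp_all
      then have "torus_poisson M (\<lambda>_. 1) (R k) z = of_real (cmod (torus_poisson M (\<lambda>_. 1) (R k) z))"
        using complex_Re_le_cmod[of "torus_poisson M (\<lambda>_. 1) (R k) z"] by (metis order.antisym)
      then show ?thesis unfolding p_eq by (metis of_real_mult)
    qed
    then have "(LINT z|haar. p z * torus_poisson M (\<lambda>_. 1) (R k) z) = (LINT z|haar. complex_of_real ((cmod (q z))\<^sup>2 * cmod (torus_poisson M (\<lambda>_. 1) (R k) z)))"
      by (intro Bochner_Integration.integral_cong refl) (simp only: space_haar)
    then show ?thesis unfolding integral_complex_of_real by simp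
  qed
  ultimately show ?thesis by simp
qed

text \<open>With weights \<open>|q n|^2\<close>, where \<open>q n\<close> approximates the indicator of the complement \<open>A\<close> of a carrier of
  the measure, the integrals of the radial means have a limit that is small with the total mass that
  \<open>|q n|^2\<close> has for the measure. Two applications of Fatou's lemma, first along the radii and then
  along \<open>q n\<close>, give integral 0 for \<open>|D|\<close>.\<close>

lemma singular_radial_limit_zero:
  assumes \<mu>: "complex_measure torus_borel \<mu>" and sing: "singular_to haar \<mu>"
    and R: "\<And>k. 0 \<le> R k" "\<And>k. R k < 1" "filterlim R (at_left 1) sequentially"
    and lim: "AE z in haar. (\<lambda>k. radial_mean \<mu> (R k) z) \<longlonglongrightarrow> D z"
    and D [measurable]: "D \<in> borel_measurable haar"
  shows "AE z in haar. D z = 0"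
proof -
  obtain N where N: "N \<in> null_sets haar" "\<And>A. A \<in> sets haar \<Longrightarrow> A \<inter> N = {} \<Longrightarrow> \<mu> A = 0"
    using sing unfolding singular_to_def by blast
  define A where "A = torus - N"
  have Ah: "A \<in> sets haar" using N(1) unfolding A_def space_haar[symmetric] by auto
  then have A: "A \<in> sets torus_borel" by (simp add: sets_haar)
  have A_null: "emeasure (jordan_torus \<mu> k) A = 0" for k
    by (rule jordan_part_null[OF \<mu> A]) (use N(2) in \<open>auto simp: sets_haar A_def\<close>)
  let ?\<M> = "insert haar (jordan_torus \<mu> ` {..<4})"
  have fin: "finite_measure (jordan_torus \<mu> k)" for k by (rule finite_measure_jordan_part[OF \<mu>])
  note sj = sets_jordan_torus[OF \<mu>]
  have "\<exists>q. trig_polynomial q \<and> (\<forall>z\<in>torus. cmod (q z) \<le> 2) \<and> (\<forall>M\<in>?\<M>. (LINT z|M. cmod (indicator A z - q z)) < (1/2)^n)" for n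
    by (rule trig_polynomials_dense[OF _ _ _ A]) (auto simp: sets_haar sj fin haar.finite_measure)
  then obtain q where q: "\<And>n. trig_polynomial (q n)" "\<And>n z. z \<in> torus \<Longrightarrow> cmod (q n z) \<le> 2"
      "\<And>n M. M \<in> ?\<M> \<Longrightarrow> (LINT z|M. cmod (indicator A z - q n z)) < (1/2)^n" by metis
  have qm [measurable]: "q n \<in> borel_measurable haar" for n
    unfolding measurable_haar_cong by (rule trig_polynomial_measurable[OF q(1)])
  have rm [measurable]: "radial_mean \<mu> (R k) \<in> borel_measurable haar" for k
    by (rule borel_measurable_integrable[OF integrable_radial_mean[OF \<mu> R(1,2)]])
  have q_sq: "(LINT y|jordan_torus \<mu> k. (cmod (q n y))\<^sup>2) \<le> 2 * (1/2)^n" if k: "k < 4" for n k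
  proof -
    interpret finite_measure "jordan_torus \<mu> k" by (rule fin)
    have [measurable]: "q n \<in> borel_measurable (jordan_torus \<mu> k)"
      unfolding measurable_cong_sets[OF sj refl] by (rule trig_polynomial_measurable[OF q(1)])
    have [measurable]: "A \<in> sets (jordan_torus \<mu> k)" using A by (simp add: sj)
    have nA: "AE y in jordan_torus \<mu> k. y \<notin> A" using A_null[of k] A by (intro AE_not_in) (auto simp: null_sets_def sj)
    have i1: "integrable (jordan_torus \<mu> k) (\<lambda>y. cmod (q n y))"
      by (intro integrable_norm trig_polynomial_integrable sj fin q)
    have i2: "integrable (jordan_torus \<mu> k) (\<lambda>y. (cmod (q n y))\<^sup>2)"
    proof (rule integrable_const_bound[where B = "2\<^sup>2"])
      show "AE y in jordan_torus \<mu> k. norm ((cmod (q n y))\<^sup>2) \<le> 2\<^sup>2"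
      proof (rule AE_I2)
        fix y assume "y \<in> space (jordan_torus \<mu> k)"
        then have "cmod (q n y) \<le> 2" using q(2) by (simp add: space_eq_torus[OF sj])
        then have "(cmod (q n y))\<^sup>2 \<le> 2\<^sup>2" by (rule power_mono) simp
        then show "norm ((cmod (q n y))\<^sup>2) \<le> 2\<^sup>2" by simp
      qed
    qed measurable
    have "(LINT y|jordan_torus \<mu> k. (cmod (q n y))\<^sup>2) \<le> (LINT y|jordan_torus \<mu> k. 2 * cmod (q n y))"
    proof (rule integral_mono[OF i2 integrable_mult_right[OF i1]])
      fix y assume "y \<in> space (jordan_torus \<mu> k)"
      then have "cmod (q n y) \<le> 2" using q(2) by (simp add: space_eq_torus[OF sj])
      then show "(cmod (q n y))\<^sup>2 \<le> 2 * cmod (q n y)" unfolding power2_eq_square by (intro mult_right_mono) auto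
    qed
    also have "\<dots> = 2 * (LINT y|jordan_torus \<mu> k. cmod (indicator A y - q n y))"
    proof -
      have "(LINT y|jordan_torus \<mu> k. cmod (q n y)) = (LINT y|jordan_torus \<mu> k. cmod (indicator A y - q n y))"
        by (rule integral_cong_AE) (use nA in \<open>auto elim!: eventually_mono\<close>)
      then show ?thesis by simp
    qed
    also have "\<dots> \<le> 2 * (1/2)^n" using q(3)[of "jordan_torus \<mu> k" n] k by simp
    finally show ?thesis .
  qed
  have weighted: "(\<integral>\<^sup>+z. ennreal ((cmod (q n z))\<^sup>2 * cmod (D z)) \<partial>haar) \<le> ennreal (8 * (1/2)^n)" for n
  proof -
    define S where "S k = (\<Sum>j<4. LINT z|haar. (cmod (q n z))\<^sup>2 * cmod (torus_poisson (jordan_torus \<mu> j) (\<lambda>_. 1) (R k) z))" for k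
    have S_lim: "S \<longlonglongrightarrow> (\<Sum>j<4. LINT y|jordan_torus \<mu> j. (cmod (q n y))\<^sup>2)"
      unfolding S_def by (intro tendsto_sum integral_square_torus_poisson_one sj fin q R)
    have S_bound: "(\<integral>\<^sup>+z. ennreal ((cmod (q n z))\<^sup>2 * cmod (radial_mean \<mu> (R k) z)) \<partial>haar) \<le> ennreal (S k)" for k
    proof -
      have tp: "integrable haar (torus_poisson (jordan_torus \<mu> j) (\<lambda>_. 1) (R k))" for j
        by (intro integrable_torus_poisson sj integrable_one_jordan_torus \<mu> R)
      have [measurable]: "torus_poisson (jordan_torus \<mu> j) (\<lambda>_. 1) (R k) \<in> borel_measurable haar" for j
        using tp by simp
      have i: "integrable haar (\<lambda>z. (cmod (q n z))\<^sup>2 * cmod (torus_poisson (jordan_torus \<mu> j) (\<lambda>_. 1) (R k) z))" for j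
      proof (rule Bochner_Integration.integrable_bound[OF integrable_mult_right[OF integrable_norm[OF tp], of 4]])
        show "AE z in haar. norm ((cmod (q n z))\<^sup>2 * cmod (torus_poisson (jordan_torus \<mu> j) (\<lambda>_. 1) (R k) z))
            \<le> norm (4 * norm (torus_poisson (jordan_torus \<mu> j) (\<lambda>_. 1) (R k) z))"
        proof (rule AE_I2)
          fix z assume "z \<in> space haar"
          then have "(cmod (q n z))\<^sup>2 \<le> 2\<^sup>2" using q(2) by (intro power_mono) (auto simp: space_haar)
          then show "norm ((cmod (q n z))\<^sup>2 * cmod (torus_poisson (jordan_torus \<mu> j) (\<lambda>_. 1) (R k) z))
            \<le> norm (4 * norm (torus_poisson (jordan_torus \<mu> j) (\<lambda>_. 1) (R k) z))"
            by (simp add: abs_mult mult_right_mono)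
        qed
      qed measurable
      have "(\<integral>\<^sup>+z. ennreal ((cmod (q n z))\<^sup>2 * cmod (radial_mean \<mu> (R k) z)) \<partial>haar)
          \<le> (\<integral>\<^sup>+z. ennreal (\<Sum>j<4. (cmod (q n z))\<^sup>2 * cmod (torus_poisson (jordan_torus \<mu> j) (\<lambda>_. 1) (R k) z)) \<partial>haar)"
        using norm_radial_mean_le[OF \<mu> R(1,2)]
        by (intro nn_integral_mono ennreal_leI) (simp add: space_haar sum_distrib_left[symmetric] mult_left_mono)
      also have "\<dots> = ennreal (LINT z|haar. (\<Sum>j<4. (cmod (q n z))\<^sup>2 * cmod (torus_poisson (jordan_torus \<mu> j) (\<lambda>_. 1) (R k) z)))"
        by (intro nn_integral_eq_integral Bochner_Integration.integrable_sum i) (auto intro!: AE_I2 sum_nonneg)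
      also have "\<dots> = ennreal (S k)" unfolding S_def by (simp only: Bochner_Integration.integral_sum[OF i])
      finally show ?thesis .
    qed
    have "(\<integral>\<^sup>+z. ennreal ((cmod (q n z))\<^sup>2 * cmod (D z)) \<partial>haar) =
        (\<integral>\<^sup>+z. liminf (\<lambda>k. ennreal ((cmod (q n z))\<^sup>2 * cmod (radial_mean \<mu> (R k) z))) \<partial>haar)"
    proof (rule nn_integral_cong_AE, use lim in eventually_elim)
      fix z assume "(\<lambda>k. radial_mean \<mu> (R k) z) \<longlonglongrightarrow> D z"
      then have "(\<lambda>k. ennreal ((cmod (q n z))\<^sup>2 * cmod (radial_mean \<mu> (R k) z))) \<longlonglongrightarrow> ennreal ((cmod (q n z))\<^sup>2 * cmod (D z))"
        by (intro tendsto_ennrealI tendsto_mult tendsto_const tendsto_norm)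
      then show "ennreal ((cmod (q n z))\<^sup>2 * cmod (D z)) = liminf (\<lambda>k. ennreal ((cmod (q n z))\<^sup>2 * cmod (radial_mean \<mu> (R k) z)))"
        by (intro lim_imp_Liminf[symmetric]) auto
    qed
    also have "\<dots> \<le> liminf (\<lambda>k. \<integral>\<^sup>+z. ennreal ((cmod (q n z))\<^sup>2 * cmod (radial_mean \<mu> (R k) z)) \<partial>haar)"
      by (rule nn_integral_liminf) measurable
    also have "\<dots> \<le> liminf (\<lambda>k. ennreal (S k))" by (intro Liminf_mono always_eventually allI S_bound)
    also have "\<dots> = ennreal (\<Sum>j<4. LINT y|jordan_torus \<mu> j. (cmod (q n y))\<^sup>2)"
      by (intro lim_imp_Liminf tendsto_ennrealI S_lim) auto
    also have "\<dots> \<le> ennreal (8 * (1/2)^n)"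
    proof (rule ennreal_leI)
      have "(\<Sum>j<4. LINT y|jordan_torus \<mu> j. (cmod (q n y))\<^sup>2) \<le> (\<Sum>j<(4::nat). 2 * (1/2)^n)"
        by (intro sum_mono q_sq) auto
      then show "(\<Sum>j<4. LINT y|jordan_torus \<mu> j. (cmod (q n y))\<^sup>2) \<le> 8 * (1/2)^n" by simp
    qed
    finally show ?thesis .
  qed
  have "(\<lambda>n. LINT z|haar. norm (indicator A z - q n z)) \<longlonglongrightarrow> 0"
  proof (rule tendsto_sandwich[of "\<lambda>_. 0" _ _ "\<lambda>n. (1/2)^n"])
    show "\<forall>\<^sub>F n in sequentially. (LINT z|haar. norm (indicator A z - q n z)) \<le> (1/2)^n"
      using q(3)[of haar] by (intro always_eventually allI less_imp_le) auto
    show "(\<lambda>n. (1/2::real)^n) \<longlonglongrightarrow> 0" by (rule LIMSEQ_realpow_zero) auto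
  qed (auto intro!: always_eventually)
  moreover have "integrable haar (\<lambda>z. indicator A z - q n z)" for n
  proof (rule Bochner_Integration.integrable_diff[OF _ trig_polynomial_integrable[OF sets_haar haar.finite_measure q(1)]])
    show "integrable haar (\<lambda>z. indicator A z :: complex)"
      by (rule haar.integrable_const_bound[where B = 1]) (use Ah in \<open>auto simp: indicator_def\<close>)
  qed
  ultimately obtain \<tau> :: "nat \<Rightarrow> nat" where \<tau>: "strict_mono \<tau>" "AE z in haar. (\<lambda>n. indicator A z - q (\<tau> n) z) \<longlonglongrightarrow> 0"
    using tendsto_L1_AE_subseq[of haar "\<lambda>n z. indicator A z - q n z"] by blast
  have "AE z in haar. z \<notin> N" by (rule AE_not_in[OF N(1)])
  moreover have "AE z in haar. z \<in> torus" by (rule AE_I2) (simp add: space_haar)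
  ultimately have q1: "AE z in haar. (\<lambda>n. q (\<tau> n) z) \<longlonglongrightarrow> 1"
    using \<tau>(2)
  proof eventually_elim
    case (elim z)
    then have "(\<lambda>n. indicator A z - (indicator A z - q (\<tau> n) z)) \<longlonglongrightarrow> indicator A z - 0"
      by (intro tendsto_diff tendsto_const) auto
    then show ?case using elim by (simp add: A_def)
  qed
  have "(\<integral>\<^sup>+z. ennreal (cmod (D z)) \<partial>haar) = (\<integral>\<^sup>+z. liminf (\<lambda>n. ennreal ((cmod (q (\<tau> n) z))\<^sup>2 * cmod (D z))) \<partial>haar)"
  proof (rule nn_integral_cong_AE, use q1 in eventually_elim)
    fix z assume "(\<lambda>n. q (\<tau> n) z) \<longlonglongrightarrow> 1"
    then have "(\<lambda>n. ennreal ((cmod (q (\<tau> n) z))\<^sup>2 * cmod (D z))) \<longlonglongrightarrow> ennreal ((cmod 1)\<^sup>2 * cmod (D z))"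
      by (intro tendsto_ennrealI tendsto_mult tendsto_const tendsto_norm tendsto_power)
    then show "ennreal (cmod (D z)) = liminf (\<lambda>n. ennreal ((cmod (q (\<tau> n) z))\<^sup>2 * cmod (D z)))"
      using lim_imp_Liminf[OF sequentially_bot] by fastforce
  qed
  also have "\<dots> \<le> liminf (\<lambda>n. \<integral>\<^sup>+z. ennreal ((cmod (q (\<tau> n) z))\<^sup>2 * cmod (D z)) \<partial>haar)"
    by (rule nn_integral_liminf) measurable
  also have "\<dots> \<le> liminf (\<lambda>n. ennreal (8 * (1/2)^\<tau> n))" by (intro Liminf_mono always_eventually allI weighted)
  also have "\<dots> = ennreal (8 * 0)"
  proof (intro lim_imp_Liminf tendsto_ennrealI tendsto_mult tendsto_const)
    have "(\<lambda>n. (1/2::real)^n) \<longlonglongrightarrow> 0" by (rule LIMSEQ_realpow_zero) auto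
    then show "(\<lambda>n. (1/2::real)^\<tau> n) \<longlonglongrightarrow> 0" using LIMSEQ_subseq_LIMSEQ[OF _ \<tau>(1)] by (fastforce simp: o_def)
  qed simp
  finally have "(\<integral>\<^sup>+z. ennreal (cmod (D z)) \<partial>haar) = 0" by simp
  then have "AE z in haar. ennreal (cmod (D z)) = 0"
    by (subst (asm) nn_integral_0_iff_AE) auto
  then show ?thesis by eventually_elim simp
qed

theorem theorem2:
  fixes \<mu> \<mu>\<^sub>s :: "(nat \<Rightarrow> complex) set \<Rightarrow> complex"
    and f :: "(nat \<Rightarrow> complex) \<Rightarrow> complex"
  assumes "complex_measure torus_borel \<mu>"
    and "complex_measure torus_borel \<mu>\<^sub>s"
    and "integrable haar f"
    and "\<And>A. A \<in> sets torus_borel \<Longrightarrow> \<mu> A = density_measure haar f A + \<mu>\<^sub>s A"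
    and "singular_to haar \<mu>\<^sub>s"
    and "spectrum_in (density_measure haar f) (N0 \<union> uminus ` N0)"
    and "spectrum_in \<mu>\<^sub>s (N0 \<union> uminus ` N0)"
  shows "AE z in haar. ((\<lambda>r. radial_mean \<mu> r z) \<longlongrightarrow> f z) (at_left 1)"
proof -
  note \<mu> = assms(1) and \<mu>s = assms(2) and f = assms(3)
  have coeff: "fourier_coeff \<mu> \<nu> = (LINT z|haar. f z * cnj (character \<nu> z)) + fourier_coeff \<mu>\<^sub>s \<nu>"
    "fourier_coeff (density_measure haar f) \<nu> = (LINT z|haar. f z * cnj (character \<nu> z))" for \<nu>
    by (rule fourier_coeff_add_density[OF \<mu> \<mu>s f assms(4)]; assumption)+
  have spec: "spectrum_in \<mu> (N0 \<union> uminus ` N0)"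
    using assms(6,7) unfolding spectrum_in_def coeff by simp
  have split: "radial_mean \<mu> r z = torus_poisson haar f r z + radial_mean \<mu>\<^sub>s r z"
    if r: "0 \<le> r" "r < 1" and z: "z \<in> torus" for r z
  proof -
    have "radial_mean \<mu> r z = (\<Sum>\<^sub>\<infinity>\<nu>\<in>Z0. (LINT y|haar. f y * cnj (character \<nu> y)) * of_real r ^ weight \<nu> * character \<nu> z
        + fourier_coeff \<mu>\<^sub>s \<nu> * of_real r ^ weight \<nu> * character \<nu> z)"
      unfolding radial_mean_def coeff(1) by (simp only: distrib_right)
    also have "\<dots> = torus_poisson haar f r z + radial_mean \<mu>\<^sub>s r z"
      unfolding torus_poisson_def radial_mean_def
      by (rule infsum_add[OF torus_poisson_summable[OF sets_haar f r z] has_sum_imp_summable[OF radial_mean_has_sum[OF \<mu>s r z]]])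
    finally show ?thesis .
  qed
  define \<rho> where "\<rho> k = 1 - 1 / real (k + 2)" for k
  have \<rho>: "0 \<le> \<rho> k" "\<rho> k < 1" for k by (auto simp: \<rho>_def divide_simps)
  have "\<rho> \<longlonglongrightarrow> 1 - 0" unfolding \<rho>_def
    by (intro tendsto_intros LIMSEQ_ignore_initial_segment[OF lim_1_over_n])
  then have \<rho>1: "filterlim \<rho> (at_left 1) sequentially"
    unfolding filterlim_at using \<rho> by (auto intro!: always_eventually simp: less_imp_neq)
  have "integrable haar (\<lambda>z. torus_poisson haar f (\<rho> k) z - f z)" for k
    by (intro Bochner_Integration.integrable_diff integrable_torus_poisson sets_haar f \<rho>)
  \<comment> \<open>along these radii the means of \<open>f\<close> converge almost everywhere, not only in $L^1$\<close>
  then obtain \<sigma> :: "nat \<Rightarrow> nat" where \<sigma>: "strict_mono \<sigma>"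
      "AE z in haar. (\<lambda>k. torus_poisson haar f (\<rho> (\<sigma> k)) z - f z) \<longlonglongrightarrow> 0"
    using tendsto_L1_AE_subseq[OF _ torus_poisson_tendsto_L1[OF f \<rho> \<rho>1]] by blast
  have \<rho>\<sigma>: "filterlim (\<lambda>k. \<rho> (\<sigma> k)) (at_left 1) sequentially"
    by (rule filterlim_compose[OF \<rho>1 filterlim_subseq[OF \<sigma>(1)]])
  \<comment> \<open>a measurable version of the limit\<close>
  define L where "L z = lim (\<lambda>k. radial_mean \<mu> (\<rho> (\<sigma> k)) z)" for z
  have Lm: "L \<in> borel_measurable haar"
    unfolding L_def by (intro borel_measurable_lim_metric borel_measurable_integrable[OF integrable_radial_mean[OF \<mu> \<rho>]])
  have ex: "AE z in haar. ((\<lambda>r. radial_mean \<mu> r z) \<longlongrightarrow> L z) (at_left 1)"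
    using AE_radial_limit_exists[OF \<mu> spec]
  proof eventually_elim
    case (elim z)
    then obtain l where l: "((\<lambda>r. radial_mean \<mu> r z) \<longlongrightarrow> l) (at_left 1)" by blast
    have "L z = l" unfolding L_def by (rule limI[OF filterlim_compose[OF l \<rho>\<sigma>]])
    then show ?case using l by simp
  qed
  have torus: "AE z in haar. z \<in> torus" by (rule AE_I2) (simp add: space_haar)
  have "AE z in haar. (\<lambda>k. radial_mean \<mu>\<^sub>s (\<rho> (\<sigma> k)) z) \<longlonglongrightarrow> L z - f z"
    using ex \<sigma>(2) torus
  proof eventually_elim
    case (elim z)
    have "(\<lambda>k. radial_mean \<mu> (\<rho> (\<sigma> k)) z - (torus_poisson haar f (\<rho> (\<sigma> k)) z - f z) - f z) \<longlonglongrightarrow> L z - 0 - f z"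
      by (intro tendsto_diff tendsto_const elim(2) filterlim_compose[OF elim(1) \<rho>\<sigma>])
    then show ?case by (simp add: split[OF \<rho> elim(3)])
  qed
  then have "AE z in haar. L z - f z = 0"
    by (rule singular_radial_limit_zero[OF \<mu>s assms(5) \<rho> \<rho>\<sigma>]) (use Lm f in measurable)
  with ex show ?thesis by eventually_elim simp
qed

end
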